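(* Let $f,g\in L^2(\mathbb{R}^{2d},\mathbb{H})$ with $f\neq0$ and $g\neq0$. Let $U\subseteq\mathbb{R}^{2d}\times\mathbb{R}^{2d}$ be a measurable set and $\varepsilon\ge0$. If $W(f,g)$ is $\varepsilon$-concentrated on $U$, then for all $p>2$, $$\mu_{4d}(U)\ge\frac1{2^{4d}}(1-\varepsilon^2)^{\frac{p}{p-2}}\,C_{p,q}^{\frac{2p}{2-p}},$$ where $C_{p,q}=\left(\frac4p\right)^{\frac dp}\left(\frac1q\right)^{\frac dq}$ and $\frac1p+\frac1q=1$.
   Context: $d\ge 1$ is an integer and $\mathbb{H}$ is the algebra of quaternions with units $i,j,k$. On $\mathbb{R}^n$, $d\mu_n(x)=dx/(2\pi)^{n/2}$, $\|F\|_{2,n}=\big(\int_{\mathbb{R}^n}|F|^2d\mu_n\big)^{1/2}$, and $\mathbb{R}^{2d}\times\mathbb{R}^{2d}$ is identified with $\mathbb{R}^{4d}$. The quaternion Wigner transform of $f,g\in L^2(\mathbb{R}^{2d},\mathbb{H})$ is $$W(f,g)(x,w)=\int_{\mathbb{R}^{2d}}e^{-i\,w_1\cdot t_1}f\big(x+\tfrac t2\big)\overline{g\big(x-\tfrac t2\big)}e^{-j\,w_2\cdot t_2}\,d\mu_{2d}(t),\quad x\in\mathbb{R}^{2d},\ w=(w_1,w_2),\ t=(t_1,t_2)\in\mathbb{R}^d\times\mathbb{R}^d.$$ A function $F\in L^2(\mathbb{R}^{2d}\times\mathbb{R}^{2d},\mathbb{H})$ is $\varepsilon$-concentrated on a measurable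 set $U\subseteq\mathbb{R}^{2d}\times\mathbb{R}^{2d}$ if $\big(\int_{U^c}|F|^2d\mu_{4d}\big)^{1/2}\le\varepsilon\|F\|_{2,4d}$, where $U^c$ is the complement of $U$.
   Formalization: The formal statement assumes 0 ≤ ε ≤ 1 instead of ε ≥ 0; for ε > 1 the power of 1−ε² is undefined for general p, and the claim fails for U = ∅, ε = 2, p = 4. *)

theory Defs
  imports "HOL-Analysis.Analysis"
begin

section \<open>The quaternions\<close>

datatype quat = Quat (qRe: real) (qI: real) (qJ: real) (qK: real)

lemma quat_eq_iff: "x = y \<longleftrightarrow> qRe x = qRe y \<and> qI x = qI y \<and> qJ x = qJ y \<and> qK x = qK y"
  by (auto intro: quat.expand)

instantiation quat :: real_vector
begin

definition "0 = Quat 0 0 0 0"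
definition "x + y = Quat (qRe x + qRe y) (qI x + qI y) (qJ x + qJ y) (qK x + qK y)"
definition "- x = Quat (- qRe x) (- qI x) (- qJ x) (- qK x)"
definition "x - y = Quat (qRe x - qRe y) (qI x - qI y) (qJ x - qJ y) (qK x - qK y)"
definition "r *\<^sub>R x = Quat (r * qRe x) (r * qI x) (r * qJ x) (r * qK x)"

instance
  by standard
    (simp_all add: quat_eq_iff zero_quat_def plus_quat_def uminus_quat_def minus_quat_def
      scaleR_quat_def algebra_simps)

end

lemma quat_zero_sel [simp]: "qRe 0 = 0" "qI 0 = 0" "qJ 0 = 0" "qK 0 = 0"
  by (simp_all add: zero_quat_def)

lemma quat_add_sel [simp]:
  "qRe (x + y) = qRe x + qRe y" "qI (x + y) = qI x + qI y"
  "qJ (x + y) = qJ x + qJ y" "qK (x + y) = qK x + qK y"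
  by (simp_all add: plus_quat_def)

lemma quat_uminus_sel [simp]:
  "qRe (- x) = - qRe x" "qI (- x) = - qI x" "qJ (- x) = - qJ x" "qK (- x) = - qK x"
  by (simp_all add: uminus_quat_def)

lemma quat_minus_sel [simp]:
  "qRe (x - y) = qRe x - qRe y" "qI (x - y) = qI x - qI y"
  "qJ (x - y) = qJ x - qJ y" "qK (x - y) = qK x - qK y"
  by (simp_all add: minus_quat_def)

lemma quat_scaleR_sel [simp]:
  "qRe (r *\<^sub>R x) = r * qRe x" "qI (r *\<^sub>R x) = r * qI x"
  "qJ (r *\<^sub>R x) = r * qJ x" "qK (r *\<^sub>R x) = r * qK x"
  by (simp_all add: scaleR_quat_def)

instantiation quat :: real_algebra_1
begin

definition "1 = Quat 1 0 0 0"

definition "x * y = Quat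
  (qRe x * qRe y - qI x * qI y - qJ x * qJ y - qK x * qK y)
  (qRe x * qI y + qI x * qRe y + qJ x * qK y - qK x * qJ y)
  (qRe x * qJ y - qI x * qK y + qJ x * qRe y + qK x * qI y)
  (qRe x * qK y + qI x * qJ y - qJ x * qI y + qK x * qRe y)"

instance
  by standard (simp_all add: quat_eq_iff one_quat_def times_quat_def algebra_simps)

end

lemma quat_one_sel [simp]: "qRe 1 = 1" "qI 1 = 0" "qJ 1 = 0" "qK 1 = 0"
  by (simp_all add: one_quat_def)

lemma quat_mult_sel [simp]:
  "qRe (x * y) = qRe x * qRe y - qI x * qI y - qJ x * qJ y - qK x * qK y"
  "qI (x * y) = qRe x * qI y + qI x * qRe y + qJ x * qK y - qK x * qJ y"
  "qJ (x * y) = qRe x * qJ y - qI x * qK y + qJ x * qRe y + qK x * qI y"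
  "qK (x * y) = qRe x * qK y + qI x * qJ y - qJ x * qI y + qK x * qRe y"
  by (simp_all add: times_quat_def)

instantiation quat :: real_inner
begin

definition inner_quat_def:
  "x \<bullet> y = qRe x * qRe y + qI x * qI y + qJ x * qJ y + qK x * qK y"
definition norm_quat_def: "norm (x :: quat) = sqrt (x \<bullet> x)"
definition sgn_quat_def: "sgn (x :: quat) = x /\<^sub>R norm x"
definition dist_quat_def: "dist x (y :: quat) = norm (x - y)"
definition uniformity_quat_def [code del]:
  "(uniformity :: (quat \<times> quat) filter) = (INF e\<in>{0 <..}. principal {(x, y). dist x y < e})"
definition open_quat_def [code del]:
  "open (U :: quat set) \<longleftrightarrow> (\<forall>x\<in>U. eventually (\<lambda>(x', y). x' = x \<longrightarrow> y \<in> U) uniformity)"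

instance
proof
  fix x y z :: quat and r :: real and U :: "quat set"
  show "x \<bullet> y = y \<bullet> x" "(x + y) \<bullet> z = x \<bullet> z + y \<bullet> z" "(r *\<^sub>R x) \<bullet> y = r * (x \<bullet> y)" "0 \<le> x \<bullet> x"
    by (simp_all add: inner_quat_def algebra_simps)
  show "x \<bullet> x = 0 \<longleftrightarrow> x = 0"
    by (auto simp: inner_quat_def quat_eq_iff add_nonneg_eq_0_iff)
qed (rule norm_quat_def sgn_quat_def dist_quat_def uniformity_quat_def open_quat_def)+

end

lemma norm_quat_eq: "norm x = sqrt ((qRe x)\<^sup>2 + (qI x)\<^sup>2 + (qJ x)\<^sup>2 + (qK x)\<^sup>2)"
  by (simp add: norm_quat_def inner_quat_def power2_eq_square)

lemma norm_quat_mult: "norm (x * y) = norm x * norm (y :: quat)"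
proof -
  have "(x * y) \<bullet> (x * y) = (x \<bullet> x) * (y \<bullet> y)"
    unfolding inner_quat_def quat_mult_sel by algebra
  then show ?thesis
    by (simp add: norm_quat_def real_sqrt_mult)
qed

instance quat :: real_normed_algebra_1
proof
  fix x y :: quat
  show "norm (x * y) \<le> norm x * norm y"
    by (simp add: norm_quat_mult)
  show "norm (1 :: quat) = 1"
    by (simp add: norm_quat_eq)
qed

definition quat_i :: quat where "quat_i = Quat 0 1 0 0"
definition quat_j :: quat where "quat_j = Quat 0 0 1 0"
definition quat_k :: quat where "quat_k = Quat 0 0 0 1"

instantiation quat :: euclidean_space
begin

definition Basis_quat_def: "Basis = {1, quat_i, quat_j, quat_k}"

instance
proof
  fix u v x :: quat
  show "(Basis :: quat set) \<noteq> {}" "finite (Basis :: quat set)"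
    by (simp_all add: Basis_quat_def)
  show "u \<bullet> v = (if u = v then 1 else 0)" if "u \<in> Basis" "v \<in> Basis"
    using that unfolding Basis_quat_def
    by (elim insertE emptyE)
      (simp_all add: inner_quat_def one_quat_def quat_i_def quat_j_def quat_k_def)
  show "(\<forall>u\<in>Basis. x \<bullet> u = 0) \<longleftrightarrow> x = 0"
    unfolding Basis_quat_def
    by (simp add: inner_quat_def quat_i_def quat_j_def quat_k_def) (simp add: quat_eq_iff)
qed

end

lemma quat_units:
  "quat_i * quat_i = -1" "quat_j * quat_j = -1" "quat_k * quat_k = -1"
  "quat_i * quat_j = quat_k" "quat_j * quat_k = quat_i" "quat_k * quat_i = quat_j"
  "quat_j * quat_i = - quat_k" "quat_k * quat_j = - quat_i" "quat_i * quat_k = - quat_j"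
  by (simp_all add: quat_eq_iff quat_i_def quat_j_def quat_k_def)

definition quat_cnj :: "quat \<Rightarrow> quat" where
  "quat_cnj x = Quat (qRe x) (- qI x) (- qJ x) (- qK x)"

lemma quat_mult_cnj: "x * quat_cnj x = of_real ((norm x)\<^sup>2)"
  by (simp add: quat_eq_iff quat_cnj_def norm_quat_eq of_real_def algebra_simps power2_eq_square)


section \<open>Normalised Lebesgue measure and square-integrable functions\<close>

definition mu :: "'a::euclidean_space measure" where
  "mu = density lebesgue (\<lambda>_. ennreal (1 / (2 * pi) powr (DIM('a) / 2)))"

definition L2 :: "('a::euclidean_space \<Rightarrow> quat) set" where
  "L2 = {F \<in> borel_measurable mu. integrable mu (\<lambda>x. (norm (F x))\<^sup>2)}"

definition norm2 :: "('a::euclidean_space \<Rightarrow> quat) \<Rightarrow> real" where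
  "norm2 F = sqrt (\<integral>x. (norm (F x))\<^sup>2 \<partial>mu)"

text \<open>Intended for \<open>F \<in> L2\<close> and measurable \<open>U\<close>; outside these the integrals take
  the library's default value 0.\<close>

definition eps_concentrated ::
  "real \<Rightarrow> 'a::euclidean_space set \<Rightarrow> ('a \<Rightarrow> quat) \<Rightarrow> bool" where
  "eps_concentrated \<epsilon> U F \<longleftrightarrow> sqrt (LINT x:(- U)|mu. (norm (F x))\<^sup>2) \<le> \<epsilon> * norm2 F"


section \<open>The quaternion Wigner transform\<close>

text \<open>The space of dimension \<open>2d\<close> is \<open>real^'d \<times> real^'d\<close> with \<open>d = CARD('d)\<close>.
  For square-integrable \<open>f\<close> and \<open>g\<close> the integrand is integrable at every \<open>(x, w)\<close> by the
  Cauchy-Schwarz inequality, so the integral is meaningful pointwise.\<close>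

definition wigner ::
  "((real^'d) \<times> (real^'d) \<Rightarrow> quat) \<Rightarrow> ((real^'d) \<times> (real^'d) \<Rightarrow> quat) \<Rightarrow>
   ((real^'d) \<times> (real^'d)) \<times> ((real^'d) \<times> (real^'d)) \<Rightarrow> quat" where
  "wigner f g = (\<lambda>(x, (w1, w2)).
     \<integral>t. exp (- ((w1 \<bullet> fst t) *\<^sub>R quat_i)) * f (x + t /\<^sub>R 2) * quat_cnj (g (x - t /\<^sub>R 2))
         * exp (- ((w2 \<bullet> snd t) *\<^sub>R quat_j)) \<partial>mu)"

definition C_const :: "nat \<Rightarrow> real \<Rightarrow> real \<Rightarrow> real" where
  "C_const d p q = (4 / p) powr (d / p) * (1 / q) powr (d / q)"

end

theory Submission
  imports Defs "HOL-Probability.Characteristic_Functions"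
begin

text \<open>
  It suffices to bound the \<open>2k\<close>-th power integrals of \<open>|W(f,g)|\<close> for integers \<open>k \<ge> 2\<close> with the sharp
  Lieb constant \<open>4^(2dk) / (4k)^(2d)\<close>: together with Plancherel's theorem and the tangent line of
  \<open>s \<mapsto> s^k\<close> this gives \<open>\<mu>(U)^(k-1) \<ge> (1 - \<epsilon>\<^sup>2)^k (4k)^(2d) / 4^(2dk)\<close>, and for each real \<open>p > 2\<close> the
  asserted bound is weaker than the one for \<open>k = max 2 \<lceil>p/2\<rceil>\<close>. No sharp Hausdorff-Young or Young
  inequality is needed.

  For even exponents the Lieb inequality is elementary. After inserting a Gaussian weight, the integral of
  the \<open>2k\<close>-th power of a Fourier transform in \<open>w\<close> becomes an integral over \<open>t\<^sub>1, \<dots>, t\<^sub>k, t'\<^sub>1, \<dots>, t'\<^sub>k\<close> of a product of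
  factors \<open>|f(x + t/2)| |g(x - t/2)|\<close> against an approximate delta at \<open>\<Sum> t\<^sub>i - \<Sum> t'\<^sub>i\<close>. The Cauchy-Schwarz
  inequality, pairing the \<open>f\<close>-factors at the \<open>t\<^sub>i\<close> with the \<open>g\<close>-factors at the \<open>t'\<^sub>i\<close>, replaces it by a
  product of squares, and the variables \<open>x + t\<^sub>i/2\<close>, \<open>x - t'\<^sub>i/2\<close> and \<open>x\<close> then separate completely.

  Noncommutativity is handled by carrying out the right transform (with \<open>j\<close>) first and then the left one
  (with \<open>i\<close>), each being an honest complex transform of an autocorrelation. The sharp constants of
  the two blocks of variables simply multiply.
\<close>

section \<open>Gaussian regularisation\<close>

text \<open>A two-sided quaternion transform has no scalar autocorrelation: in its squared modulus
  the exponentials in i and j stand on different sides of noncommuting factors. For a one-sided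
  transform the obstacle disappears after projection onto the plane of 1 and the unit of that
  transform. The projection is linear over this plane from both sides, so the two exponentials merge
  into one character of s - s', and it loses nothing on the squared modulus, which is real.

  The left transform then acts on the partial right transform, of which only moduli at 2k different
  points t enter. Their product has to be integrated over (x2, w2), and each modulus belongs to a
  different pair of slices of f and g. This is why the right transform is estimated for lists of
  distinct pairs instead of a single k-th power. Afterwards the slices survive only through their L2
  norms, a scalar pair to which the same separation of variables applies once more.

  The Gaussian weight makes the frequency integrals absolutely convergent; the mass of its transform
  does not depend on \<eta>, so all bounds are uniform and monotone convergence removes the
  weight.\<close>

definition gauss :: "real \<Rightarrow> 'a::euclidean_space \<Rightarrow> real" where
  "gauss \<eta> w = exp (- (\<eta>\<^sup>2 * (norm w)\<^sup>2 / 2))"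

definition gauss_ft :: "real \<Rightarrow> 'a::euclidean_space \<Rightarrow> real" where
  "gauss_ft \<eta> u = (sqrt (2 * pi) / \<eta>) ^ DIM('a) * exp (- ((norm u)\<^sup>2 / (2 * \<eta>\<^sup>2)))"

lemma gauss_pos: "0 < gauss \<eta> w"
  and gauss_le_1: "gauss \<eta> w \<le> 1"
  by (auto simp: gauss_def)

lemma gauss_ft_nonneg: "0 < \<eta> \<Longrightarrow> 0 \<le> gauss_ft \<eta> u"
  by (auto simp: gauss_ft_def)

lemma gauss_ft_uminus [simp]: "gauss_ft \<eta> (- u) = gauss_ft \<eta> u"
  by (simp add: gauss_ft_def)

lemma gauss_measurable [measurable]: "gauss \<eta> \<in> borel_measurable borel"
  unfolding gauss_def [abs_def] by measurable

lemma gauss_ft_measurable [measurable]: "gauss_ft \<eta> \<in> borel_measurable borel"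
  unfolding gauss_ft_def [abs_def] by measurable

lemma norm_square_Basis: "(norm w)\<^sup>2 = (\<Sum>b\<in>Basis. (w \<bullet> b)\<^sup>2)" for w :: "'a::euclidean_space"
  unfolding norm_eq_sqrt_inner
  by (subst real_sqrt_pow2) (auto simp: euclidean_inner[of w w] power2_eq_square intro: sum_nonneg)

lemma gauss_prod: "gauss \<eta> w = (\<Prod>b\<in>Basis. gauss \<eta> (w \<bullet> b))"
  unfolding gauss_def norm_square_Basis[of w]
  by (simp add: exp_sum[symmetric] sum_negf[symmetric] sum_distrib_left sum_divide_distrib)

lemma gauss_ft_prod: "gauss_ft \<eta> u = (\<Prod>b\<in>Basis. gauss_ft \<eta> (u \<bullet> b))"
  unfolding gauss_ft_def norm_square_Basis[of u] DIM_real power_one_right prod.distrib prod_constant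
    real_norm_def power2_abs
  by (simp add: exp_sum[symmetric] sum_negf sum_divide_distrib)

lemma cis_borel_measurable [measurable]: "cis \<in> borel_measurable borel"
  by (intro borel_measurable_continuous_onI continuous_on_cis continuous_on_id)

lemma gauss_ft_real:
  fixes t :: real
  assumes "0 < \<eta>"
  shows "integrable lborel (\<lambda>x::real. gauss \<eta> x)"
    and "(\<integral>x. complex_of_real (gauss \<eta> x) * cis (- (x * t)) \<partial>lborel) = complex_of_real (gauss_ft \<eta> t)"
proof -
  have eq: "gauss \<eta> x = sqrt (2 * pi) * std_normal_density (0 + \<eta> * x)" for x :: real
    by (simp add: gauss_def std_normal_density_def power_mult_distrib)
  have "integrable lborel std_normal_density"
    using integrable_std_normal_moment[of 0] by simp
  then have "integrable lborel (\<lambda>x. std_normal_density (0 + \<eta> * x))"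
    using assms by (subst lborel_integrable_real_affine_iff) auto
  then show "integrable lborel (\<lambda>x::real. gauss \<eta> x)"
    unfolding eq by simp
  \<comment> \<open>Substituting \<open>\<eta> * x\<close> turns the weight into a standard normal
    density, whose characteristic function at \<open>- (t / \<eta>)\<close> is known. The factor
    \<open>sqrt (2 * pi)\<close> of the density and the factor \<open>1 / \<eta>\<close> of the
    substitution form the prefactor of \<open>gauss_ft\<close>.\<close>
  have "(\<integral>x. complex_of_real (std_normal_density x) * cis (- (x * t / \<eta>)) \<partial>lborel)
    = char std_normal_distribution (- (t / \<eta>))"
    unfolding char_def
    by (subst integral_density) (auto simp: scaleR_conv_of_real cis_conv_exp mult_ac)
  also have "\<dots> = complex_of_real (exp (- ((t / \<eta>)\<^sup>2 / 2)))"
    by (simp add: char_std_normal_distribution)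
  finally have "complex_of_real (exp (- ((t / \<eta>)\<^sup>2 / 2)))
    = \<eta> *\<^sub>R (\<integral>x. complex_of_real (std_normal_density (0 + \<eta> * x)) * cis (- ((0 + \<eta> * x) * t / \<eta>)) \<partial>lborel)"
    using assms by (subst (asm) lborel_integral_real_affine[where c=\<eta> and t=0]) auto
  then have *: "(\<integral>x. complex_of_real (std_normal_density (0 + \<eta> * x)) * cis (- (x * t)) \<partial>lborel)
    = complex_of_real (exp (- ((t / \<eta>)\<^sup>2 / 2)) / \<eta>)"
    using assms by (simp add: scaleR_conv_of_real field_simps)
  have "(\<integral>x. complex_of_real (gauss \<eta> x) * cis (- (x * t)) \<partial>lborel)
    = complex_of_real (sqrt (2 * pi)) *
      (\<integral>x. complex_of_real (std_normal_density (0 + \<eta> * x)) * cis (- (x * t)) \<partial>lborel)"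
    unfolding eq by (subst integral_mult_right_zero[symmetric]) (simp add: mult_ac)
  also have "\<dots> = complex_of_real (gauss_ft \<eta> t)"
    unfolding * by (simp add: gauss_ft_def power_divide)
  finally show "(\<integral>x. complex_of_real (gauss \<eta> x) * cis (- (x * t)) \<partial>lborel) = complex_of_real (gauss_ft \<eta> t)" .
qed

lemma gauss_integrable:
  assumes "0 < \<eta>"
  shows "integrable lborel (gauss \<eta> :: 'a::euclidean_space \<Rightarrow> real)"
proof (rule integrableI_bounded)
  have "(\<integral>\<^sup>+(w::'a). norm (gauss \<eta> w) \<partial>lborel) = (\<integral>\<^sup>+(w::'a). (\<Prod>b\<in>Basis. ennreal (gauss \<eta> (w \<bullet> b))) \<partial>lborel)"
    by (intro nn_integral_cong) (subst gauss_prod, simp add: less_imp_le[OF gauss_pos] prod_ennreal abs_prod)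
  also have "\<dots> = (\<Prod>b\<in>(Basis::'a set). (\<integral>\<^sup>+(x::real). ennreal (gauss \<eta> x) \<partial>lborel))"
    by (subst nn_integral_lborel_prod) auto
  also have "\<dots> < \<infinity>"
    using gauss_ft_real(1)[OF assms]
    by (auto simp: integrable_iff_bounded less_top[symmetric] power_eq_top_ennreal less_imp_le[OF gauss_pos])
  finally show "(\<integral>\<^sup>+(w::'a). norm (gauss \<eta> w) \<partial>lborel) < \<infinity>" .
qed simp

lemma gauss_fourier:
  fixes u :: "'a::euclidean_space"
  assumes "0 < \<eta>"
  shows "(\<integral>w. complex_of_real (gauss \<eta> w) * cis (- (w \<bullet> u)) \<partial>lborel) = complex_of_real (gauss_ft \<eta> u)"
proof -
  interpret product_sigma_finite "\<lambda>_::'a. lborel :: real measure" ..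
  let ?f = "\<lambda>b x. complex_of_real (gauss \<eta> x) * cis (- (x * (u \<bullet> b)))"
  have [simp]: "(\<Sum>b\<in>Basis. g b *\<^sub>R b) \<bullet> c = g c" if "c \<in> Basis" for g and c :: 'a
    using that by (simp add: inner_sum_left inner_Basis if_distrib cong: if_cong)
  have inn: "(\<Sum>b\<in>Basis. g b *\<^sub>R b) \<bullet> u = (\<Sum>b\<in>Basis. g b * (u \<bullet> b))" for g
    unfolding inner_sum_left by (simp add: inner_commute)
  have cis_sum: "cis (\<Sum>b\<in>B. h b) = (\<Prod>b\<in>B. cis (h b))" if "finite B" for h and B :: "'a set"
    using that by (induction B) (auto simp: cis_mult[symmetric])
  have int: "integrable lborel (?f b)" for b
    using gauss_ft_real(1)[OF assms]
    by (rule Bochner_Integration.integrable_bound) (auto simp: norm_mult)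
  have "(\<integral>w. complex_of_real (gauss \<eta> w) * cis (- (w \<bullet> u)) \<partial>lborel)
    = (\<integral>g. (\<Prod>b\<in>Basis. ?f b (g b)) \<partial>(\<Pi>\<^sub>M b\<in>Basis. lborel))"
    by (subst lborel_eq, subst integral_distr)
      (auto simp: gauss_prod[of \<eta> "\<Sum>b\<in>Basis. _ b *\<^sub>R b"] inn cis_sum prod.distrib sum_negf[symmetric]
         intro!: Bochner_Integration.integral_cong borel_measurable_times)
  also have "\<dots> = (\<Prod>b\<in>Basis. integral\<^sup>L lborel (?f b))"
    by (rule product_integral_prod) (auto intro: int)
  also have "\<dots> = (\<Prod>b\<in>Basis. complex_of_real (gauss_ft \<eta> (u \<bullet> b)))"
    by (simp add: gauss_ft_real[OF assms])
  also have "\<dots> = complex_of_real (gauss_ft \<eta> u)"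
    by (simp add: gauss_ft_prod[of \<eta> u])
  finally show ?thesis .
qed

section \<open>Affine substitution, mass and monotone limit of the Gaussian kernels\<close>

lemma nn_integral_lborel_affine:
  fixes a :: "'a::euclidean_space" and F :: "'a \<Rightarrow> ennreal"
  assumes [measurable]: "F \<in> borel_measurable borel" and "c \<noteq> 0"
  shows "(\<integral>\<^sup>+x. F (a + c *\<^sub>R x) \<partial>lborel) = ennreal (1 / \<bar>c\<bar> ^ DIM('a)) * (\<integral>\<^sup>+x. F x \<partial>lborel)"
proof -
  have "(\<integral>\<^sup>+x. F x \<partial>lborel) = ennreal (\<bar>c\<bar> ^ DIM('a)) * (\<integral>\<^sup>+x. F (a + c *\<^sub>R x) \<partial>lborel)"
    by (subst lborel_affine[OF \<open>c \<noteq> 0\<close>, of a])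
      (simp add: nn_integral_density nn_integral_distr nn_integral_cmult)
  then show ?thesis
    using \<open>c \<noteq> 0\<close> by (simp add: mult.assoc[symmetric] ennreal_mult[symmetric])
qed

text \<open>Independence of \<eta> is the point: \<open>gauss_ft \<eta>\<close> is (2 pi)^n times an
  approximate identity as \<eta> tends to 0. This mass becomes the constant in Plancherel's theorem
  and the factor (2 pi)^n in the Lieb constant.\<close>

lemma nn_integral_gauss_ft:
  assumes "0 < \<eta>"
  shows "(\<integral>\<^sup>+u. ennreal (gauss_ft \<eta> (u::'a::euclidean_space)) \<partial>lborel) = ennreal ((2 * pi) ^ DIM('a))"
proof -
  have "integral\<^sup>L lborel std_normal_density = 1"
    by simp
  then have 1: "(\<integral>\<^sup>+(x::real). ennreal (std_normal_density x) \<partial>lborel) = 1"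
    using integrable_std_normal_moment[of 0] by (subst nn_integral_eq_integral) auto
  have 2: "(\<integral>\<^sup>+(x::real). ennreal (gauss_ft \<eta> x) \<partial>lborel) = ennreal (2 * pi)"
  proof -
    have "(\<integral>\<^sup>+(x::real). ennreal (gauss_ft \<eta> x) \<partial>lborel)
      = (\<integral>\<^sup>+(x::real). ennreal (2 * pi / \<eta>) * ennreal (std_normal_density (0 + (1 / \<eta>) *\<^sub>R x)) \<partial>lborel)"
      using assms
      by (intro nn_integral_cong, subst ennreal_mult[symmetric])
        (auto simp: gauss_ft_def std_normal_density_def power_divide real_sqrt_mult field_simps)
    also have "\<dots> = ennreal (2 * pi / \<eta>) * ennreal \<eta>"
      using assms by (subst nn_integral_cmult, simp, subst nn_integral_lborel_affine)
         (auto simp: 1)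
    finally show ?thesis
      using assms by (simp add: ennreal_mult[symmetric])
  qed
  have "(\<integral>\<^sup>+(u::'a). ennreal (gauss_ft \<eta> u) \<partial>lborel) = (\<integral>\<^sup>+(u::'a). (\<Prod>b\<in>Basis. ennreal (gauss_ft \<eta> (u \<bullet> b))) \<partial>lborel)"
  proof (intro nn_integral_cong)
    fix u :: 'a
    show "ennreal (gauss_ft \<eta> u) = (\<Prod>b\<in>Basis. ennreal (gauss_ft \<eta> (u \<bullet> b)))"
      using assms by (subst prod_ennreal) (auto simp: gauss_ft_nonneg gauss_ft_prod[of \<eta> u])
  qed
  also have "\<dots> = (\<Prod>b\<in>(Basis::'a set). (\<integral>\<^sup>+(x::real). ennreal (gauss_ft \<eta> x) \<partial>lborel))"
    by (subst nn_integral_lborel_prod) auto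
  also have "\<dots> = ennreal ((2 * pi) ^ DIM('a))"
    by (simp add: 2 ennreal_power)
  finally show ?thesis .
qed

lemma gauss_incseq: "incseq (\<lambda>n. gauss (1 / real (Suc n)) (w :: 'a::euclidean_space))"
proof (rule incseq_SucI)
  fix n
  have "(1 / real (Suc (Suc n)))\<^sup>2 \<le> (1 / real (Suc n))\<^sup>2"
    by (intro power_mono) (auto simp: field_simps)
  then have "(1 / real (Suc (Suc n)))\<^sup>2 * (norm w)\<^sup>2 \<le> (1 / real (Suc n))\<^sup>2 * (norm w)\<^sup>2"
    by (rule mult_right_mono) auto
  then show "gauss (1 / real (Suc n)) w \<le> gauss (1 / real (Suc (Suc n))) w"
    unfolding gauss_def by simp
qed

lemma gauss_SUP: "(SUP n. ennreal (gauss (1 / real (Suc n)) w)) = 1"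
  for w :: "'a::euclidean_space"
proof (rule LIMSEQ_unique[OF LIMSEQ_SUP])
  show "incseq (\<lambda>n. ennreal (gauss (1 / real (Suc n)) w))"
    using gauss_incseq[of w] by (auto simp: incseq_def intro!: ennreal_leI)
  have "(\<lambda>n. gauss (1 / real (Suc n)) w) \<longlonglongrightarrow> exp (- (0\<^sup>2 * (norm w)\<^sup>2 / 2))"
    unfolding gauss_def by (intro tendsto_intros LIMSEQ_Suc[OF lim_1_over_n]) auto
  then show "(\<lambda>n. ennreal (gauss (1 / real (Suc n)) w)) \<longlonglongrightarrow> 1"
    using tendsto_ennrealI by fastforce
qed


section \<open>Chains of convolutions\<close>

text \<open>Unfolded for a list A1, ..., Ak, this is the integral over s1, s1', ..., sk, sk' of the
  product of all Ai(si) Ai(si') against G(u + sum of si - sum of si'). Recursion over a list keeps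
  every integral on one copy of the space and lets inductions shift u. The parameter p is carried
  along so that a chain can be integrated over it.\<close>

primrec chain :: "('v \<Rightarrow> ennreal) \<Rightarrow> ('p \<Rightarrow> 'v \<Rightarrow> ennreal) list \<Rightarrow> 'p \<Rightarrow> 'v::euclidean_space \<Rightarrow> ennreal" where
  "chain G [] p u = G u"
| "chain G (A # As) p u = (\<integral>\<^sup>+s. \<integral>\<^sup>+s'. A p s * A p s' * chain G As p (u + s - s') \<partial>lborel \<partial>lborel)"

lemma chain_measurable:
  fixes M :: "'p measure"
  assumes [measurable]: "G \<in> borel_measurable borel"
    and "\<And>A. A \<in> set As \<Longrightarrow> (\<lambda>(p, s). A p s) \<in> borel_measurable (M \<Otimes>\<^sub>M borel)"
  shows "(\<lambda>(p, u). chain G As p u) \<in> borel_measurable (M \<Otimes>\<^sub>M borel)"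
  using assms(2)
proof (induction As)
  case (Cons A As)
  have [measurable]: "(\<lambda>(p, s). A p s) \<in> borel_measurable (M \<Otimes>\<^sub>M borel)"
    "(\<lambda>(p, u). chain G As p u) \<in> borel_measurable (M \<Otimes>\<^sub>M borel)"
    using Cons by auto
  show ?case by simp
next
  case Nil
  have "(chain G [] :: 'p \<Rightarrow> _) = (\<lambda>p. G)" by (intro ext) simp
  then show ?case by simp
qed

lemma chain_measurable_point:
  assumes [measurable]: "G \<in> borel_measurable borel"
    and "\<And>A. A \<in> set As \<Longrightarrow> A p \<in> borel_measurable borel"
  shows "chain G As p \<in> borel_measurable borel"
  using assms(2)
proof (induction As)
  case (Cons A As)
  have [measurable]: "A p \<in> borel_measurable borel" "chain G As p \<in> borel_measurable borel"
    using Cons by auto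
  show ?case by simp
next
  case Nil
  have "chain G [] p = G" by (rule ext) simp
  then show ?case by simp
qed

section \<open>Chains of squares and their comparison with chains\<close>

primrec sq_chain :: "('v \<Rightarrow> ennreal) \<Rightarrow> (('v \<Rightarrow> ennreal) \<times> ('v \<Rightarrow> ennreal)) list \<Rightarrow> 'v \<Rightarrow> 'v::euclidean_space \<Rightarrow> ennreal" where
  "sq_chain G [] x u = G u"
| "sq_chain G (q # L) x u = (\<integral>\<^sup>+s. \<integral>\<^sup>+s'. (fst q (x + s /\<^sub>R 2))\<^sup>2 * (snd q (x - s' /\<^sub>R 2))\<^sup>2 *
     sq_chain G L x (u + s - s') \<partial>lborel \<partial>lborel)"

definition wprod :: "('v \<Rightarrow> ennreal) \<times> ('v \<Rightarrow> ennreal) \<Rightarrow> 'v \<Rightarrow> 'v::euclidean_space \<Rightarrow> ennreal" where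
  "wprod q x s = fst q (x + s /\<^sub>R 2) * snd q (x - s /\<^sub>R 2)"

definition borel_pair :: "('v::euclidean_space \<Rightarrow> ennreal) \<times> ('v \<Rightarrow> ennreal) \<Rightarrow> bool" where
  "borel_pair q \<longleftrightarrow> fst q \<in> borel_measurable borel \<and> snd q \<in> borel_measurable borel"


lemma wprod_measurable:
  "borel_pair q \<Longrightarrow> (\<lambda>(x, s). wprod q x s) \<in> borel_measurable (borel \<Otimes>\<^sub>M borel)"
proof -
  assume "borel_pair q"
  then have [measurable]: "fst q \<in> borel_measurable borel" "snd q \<in> borel_measurable borel"
    by (auto simp: borel_pair_def)
  show ?thesis unfolding wprod_def by measurable
qed

lemma wprod_measurable_point: "borel_pair q \<Longrightarrow> wprod q x \<in> borel_measurable borel"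
proof -
  assume "borel_pair q"
  then have [measurable]: "fst q \<in> borel_measurable borel" "snd q \<in> borel_measurable borel"
    by (auto simp: borel_pair_def)
  show ?thesis unfolding wprod_def by measurable
qed

lemma sq_chain_measurable:
  assumes [measurable]: "G \<in> borel_measurable borel" and "\<forall>q\<in>set L. borel_pair q"
  shows "(\<lambda>(x, u). sq_chain G L x u) \<in> borel_measurable (borel \<Otimes>\<^sub>M borel)"
  using assms(2)
proof (induction L)
  case (Cons q L)
  have [measurable]: "fst q \<in> borel_measurable borel" "snd q \<in> borel_measurable borel"
    "(\<lambda>(p, u). sq_chain G L p u) \<in> borel_measurable (borel \<Otimes>\<^sub>M borel)"
    using Cons by (auto simp: borel_pair_def)
  show ?case by simp
next
  case Nil
  have "sq_chain G [] = (\<lambda>p. G)" by (intro ext) simp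
  then show ?case by simp
qed

lemma ennreal_power2_le_cancel:
  fixes c d :: ennreal
  assumes "c\<^sup>2 \<le> d\<^sup>2"
  shows "c \<le> d"
proof (cases "d = top \<or> c = top")
  case True
  then show ?thesis using assms by (cases "d = top") (auto simp: top_power_ennreal top_unique power_eq_top_ennreal)
next
  case False
  then obtain x y where "c = ennreal x" "d = ennreal y" "0 \<le> x" "0 \<le> y"
    by (metis ennreal_cases)
  then show ?thesis using assms
    by (auto simp: ennreal_power intro!: ennreal_leI intro: power2_le_imp_le)
qed

text \<open>Cauchy-Schwarz for a pointwise bound on the square of h, the form in which the induction
  hypothesis about a squared chain delivers its estimate.\<close>

lemma nn_integral_Cauchy_Schwarz_le:
  fixes h a b :: "'a \<Rightarrow> ennreal"
  assumes [measurable]: "a \<in> borel_measurable M" "b \<in> borel_measurable M" "h \<in> borel_measurable M"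
    and le: "\<And>x. (h x)\<^sup>2 \<le> a x * b x"
  shows "(\<integral>\<^sup>+x. h x \<partial>M)\<^sup>2 \<le> (\<integral>\<^sup>+x. a x \<partial>M) * (\<integral>\<^sup>+x. b x \<partial>M)"
proof -
  \<comment> \<open>A square root with value \<open>top\<close> at \<open>top\<close>, so that
    \<open>r2\<close> covers infinite values.\<close>
  define r where "r = (\<lambda>y::ennreal. if y = top then top else ennreal (sqrt (enn2real y)))"
  have r2: "(r y)\<^sup>2 = y" for y
    by (cases y) (auto simp: r_def ennreal_power top_power_ennreal)
  have [measurable]: "r \<in> borel_measurable borel"
    unfolding r_def by measurable
  have "(\<integral>\<^sup>+x. h x \<partial>M)\<^sup>2 \<le> (\<integral>\<^sup>+x. r (a x) * r (b x) \<partial>M)\<^sup>2"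
  proof (rule power_mono)
    show "(\<integral>\<^sup>+x. h x \<partial>M) \<le> (\<integral>\<^sup>+x. r (a x) * r (b x) \<partial>M)"
    proof (rule nn_integral_mono)
      fix x
      have "(h x)\<^sup>2 \<le> (r (a x) * r (b x))\<^sup>2"
        by (simp add: power_mult_distrib r2 le)
      then show "h x \<le> r (a x) * r (b x)"
        by (rule ennreal_power2_le_cancel)
    qed
  qed simp
  also have "\<dots> \<le> (\<integral>\<^sup>+x. (r (a x))\<^sup>2 \<partial>M) * (\<integral>\<^sup>+x. (r (b x))\<^sup>2 \<partial>M)"
    by (rule Cauchy_Schwarz_nn_integral) auto
  finally show ?thesis by (simp add: r2)
qed

lemma nn_integral_lborel_pair:
  fixes F :: "'a::euclidean_space \<Rightarrow> 'b::euclidean_space \<Rightarrow> ennreal"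
  assumes "(\<lambda>(x, y). F x y) \<in> borel_measurable (borel \<Otimes>\<^sub>M borel)"
  shows "(\<integral>\<^sup>+x. \<integral>\<^sup>+y. F x y \<partial>lborel \<partial>lborel) = (\<integral>\<^sup>+z. F (fst z) (snd z) \<partial>lborel)"
    and "(\<integral>\<^sup>+x. \<integral>\<^sup>+y. F x y \<partial>lborel \<partial>lborel) = (\<integral>\<^sup>+y. \<integral>\<^sup>+x. F x y \<partial>lborel \<partial>lborel)"
proof -
  have [measurable]: "(\<lambda>(x, y). F x y) \<in> borel_measurable (lborel \<Otimes>\<^sub>M lborel)"
    using assms by (simp cong: measurable_cong_sets sets_pair_measure_cong)
  have "(\<lambda>z. F (fst z) (snd z)) \<in> borel_measurable (lborel \<Otimes>\<^sub>M lborel)"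
    by measurable
  from lborel.nn_integral_fst[OF this]
  show "(\<integral>\<^sup>+x. \<integral>\<^sup>+y. F x y \<partial>lborel \<partial>lborel) = (\<integral>\<^sup>+z. F (fst z) (snd z) \<partial>lborel)"
    by (simp add: lborel_prod)
  show "(\<integral>\<^sup>+x. \<integral>\<^sup>+y. F x y \<partial>lborel \<partial>lborel) = (\<integral>\<^sup>+y. \<integral>\<^sup>+x. F x y \<partial>lborel \<partial>lborel)"
    by (rule lborel_pair.Fubini'[symmetric]) measurable
qed

lemma borel_measurable_lborel_pairI:
  assumes "(\<lambda>(x, y). F x y) \<in> borel_measurable (borel \<Otimes>\<^sub>M borel)"
  shows "(\<lambda>z. F (fst z) (snd z)) \<in> borel_measurable lborel"
  using assms[unfolded borel_prod] by (simp add: case_prod_unfold)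

text \<open>Pairing the first factors at \<open>s\<close> with the second factors at \<open>s'\<close> leaves no loss when the base function is
  even: the two factors on the right coincide at \<open>u = 0\<close>.\<close>

lemma chain_wprod_square_le:
  fixes L :: "(('v::euclidean_space \<Rightarrow> ennreal) \<times> ('v \<Rightarrow> ennreal)) list"
  assumes [measurable]: "G \<in> borel_measurable borel" and G: "\<And>u. G (- u) = G u"
    and "\<forall>q\<in>set L. borel_pair q"
  shows "(chain G (map wprod L) x u)\<^sup>2 \<le> sq_chain G L x u * sq_chain G L x (- u)"
  using assms(3)
proof (induction L arbitrary: u)
  case Nil
  then show ?case by (simp add: G power2_eq_square)
next
  case (Cons q L)
  have q: "borel_pair q" using Cons by auto
  then have [measurable]: "fst q \<in> borel_measurable borel" "snd q \<in> borel_measurable borel"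
    by (auto simp: borel_pair_def)
  have [measurable]: "(\<lambda>(p, u). sq_chain G L p u) \<in> borel_measurable (borel \<Otimes>\<^sub>M borel)"
    by (rule sq_chain_measurable) (use Cons in auto)
  have [measurable]: "(\<lambda>(p, u). chain G (map wprod L) p u) \<in> borel_measurable (borel \<Otimes>\<^sub>M borel)"
    by (rule chain_measurable) (use Cons wprod_measurable in auto)
  note [measurable] = wprod_measurable[OF q]
  let ?a = "\<lambda>s s'. (fst q (x + s /\<^sub>R 2))\<^sup>2 * (snd q (x - s' /\<^sub>R 2))\<^sup>2 * sq_chain G L x (u + s - s')"
  let ?b = "\<lambda>s s'. (fst q (x + s' /\<^sub>R 2))\<^sup>2 * (snd q (x - s /\<^sub>R 2))\<^sup>2 * sq_chain G L x (- u + s' - s)"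
  let ?h = "\<lambda>s s'. wprod q x s * wprod q x s' * chain G (map wprod L) x (u + s - s')"
  have "(chain G (map wprod (q # L)) x u)\<^sup>2 = (\<integral>\<^sup>+z. ?h (fst z) (snd z) \<partial>lborel)\<^sup>2"
    by (simp add: nn_integral_lborel_pair(1)[of ?h])
  also have "\<dots> \<le> (\<integral>\<^sup>+z. ?a (fst z) (snd z) \<partial>lborel) * (\<integral>\<^sup>+z. ?b (fst z) (snd z) \<partial>lborel)"
  proof (rule nn_integral_Cauchy_Schwarz_le)
    fix z :: "'v \<times> 'v"
    let ?s = "fst z" and ?s' = "snd z"
    have "(?h ?s ?s')\<^sup>2 = (wprod q x ?s)\<^sup>2 * (wprod q x ?s')\<^sup>2 * (chain G (map wprod L) x (u + ?s - ?s'))\<^sup>2"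
      by (simp add: power_mult_distrib)
    also have "\<dots> \<le> (wprod q x ?s)\<^sup>2 * (wprod q x ?s')\<^sup>2 *
        (sq_chain G L x (u + ?s - ?s') * sq_chain G L x (- (u + ?s - ?s')))"
      by (intro mult_left_mono Cons.IH) (use Cons.prems in auto)
    also have "- (u + ?s - ?s') = - u + ?s' - ?s" by simp
    finally show "(?h ?s ?s')\<^sup>2 \<le> ?a ?s ?s' * ?b ?s ?s'"
      by (simp add: wprod_def[of q] power_mult_distrib mult_ac)
  qed (intro borel_measurable_lborel_pairI; measurable)+
  also have "(\<integral>\<^sup>+z. ?a (fst z) (snd z) \<partial>lborel) = sq_chain G (q # L) x u"
    unfolding sq_chain.simps by (rule nn_integral_lborel_pair(1)[symmetric]) measurable
  \<comment> \<open>Negating u + s - s' interchanges the roles of s and s', so after swapping the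
    two integrations this factor is the chain of squares at - u.\<close>
  also have "(\<integral>\<^sup>+z. ?b (fst z) (snd z) \<partial>lborel) = sq_chain G (q # L) x (- u)"
    unfolding sq_chain.simps
    by (subst nn_integral_lborel_pair(1)[of ?b, symmetric], measurable)
      (rule nn_integral_lborel_pair(2), measurable)
  finally show ?case .
qed

lemma chain_wprod_le:
  assumes "G \<in> borel_measurable borel" and "\<And>u. G (- u) = G u" and "\<forall>q\<in>set L. borel_pair q"
  shows "chain G (map wprod L) x 0 \<le> sq_chain G L x 0"
proof -
  have "(chain G (map wprod L) x 0)\<^sup>2 \<le> (sq_chain G L x 0)\<^sup>2"
    using chain_wprod_square_le[OF assms, of x 0] by (simp add: power2_eq_square)
  then show ?thesis by (rule ennreal_power2_le_cancel)
qed

section \<open>Separation of variables in the chain of squares\<close>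

lemma nn_integral_lborel_affine2:
  fixes F :: "'v::euclidean_space \<Rightarrow> ennreal"
  assumes "F \<in> borel_measurable borel" and "\<bar>c\<bar> = 2"
  shows "(\<integral>\<^sup>+s. F s \<partial>lborel) = 2 ^ DIM('v) * (\<integral>\<^sup>+y. F (a + c *\<^sub>R y) \<partial>lborel)"
proof -
  have "(2::ennreal) ^ DIM('v) = ennreal (2 ^ DIM('v))"
    by (metis ennreal_numeral ennreal_power zero_le_numeral)
  then have "(2::ennreal) ^ DIM('v) * ennreal (1 / 2 ^ DIM('v)) = 1"
    by (simp add: ennreal_mult[symmetric])
  moreover have "c \<noteq> 0" using assms(2) by auto
  ultimately show ?thesis
    using assms by (simp add: nn_integral_lborel_affine mult.assoc[symmetric])
qed

text \<open>With y = x + s/2 and z = x - s'/2 one has s - s' = 2y + 2z - 4x. Each pair therefore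
  costs a Jacobian 2^n * 2^n = 4^n and raises the coefficient of x in the argument of G by 4, while
  its squared factors depend on y and z alone. When the list is exhausted, integrating over x
  rescales G by the accumulated coefficient. General u and c are what the induction needs, and
  \<open>0 < c + real (length L)\<close> makes the final rescaling invertible.\<close>

lemma nn_integral_sq_chain:
  fixes L :: "(('v::euclidean_space \<Rightarrow> ennreal) \<times> ('v \<Rightarrow> ennreal)) list"
  assumes [measurable]: "G \<in> borel_measurable borel" and "\<forall>q\<in>set L. borel_pair q"
    and "0 \<le> c" "0 < c + real (length L)"
  shows "(\<integral>\<^sup>+x. sq_chain G L x (u - c *\<^sub>R x) \<partial>lborel) =
    (\<Prod>q\<leftarrow>L. 4 ^ DIM('v) * (\<integral>\<^sup>+y. (fst q y)\<^sup>2 \<partial>lborel) * (\<integral>\<^sup>+z. (snd q z)\<^sup>2 \<partial>lborel)) *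
    (\<integral>\<^sup>+x. G x \<partial>lborel) * ennreal (1 / \<bar>c + 4 * real (length L)\<bar> ^ DIM('v))"
  using assms(2-4)
proof (induction L arbitrary: u c)
  case Nil
  have "(\<integral>\<^sup>+x. G (u - c *\<^sub>R x) \<partial>lborel) = (\<integral>\<^sup>+x. G (u + (- c) *\<^sub>R x) \<partial>lborel)" by simp
  also have "\<dots> = ennreal (1 / \<bar>- c\<bar> ^ DIM('v)) * (\<integral>\<^sup>+x. G x \<partial>lborel)"
    using Nil by (intro nn_integral_lborel_affine) auto
  finally show ?case by (simp add: mult.commute)
next
  case (Cons q L)
  have q: "borel_pair q" using Cons by auto
  then have [measurable]: "fst q \<in> borel_measurable borel" "snd q \<in> borel_measurable borel"
    by (auto simp: borel_pair_def)
  have [measurable]: "(\<lambda>(p, u). sq_chain G L p u) \<in> borel_measurable (borel \<Otimes>\<^sub>M borel)"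
    by (rule sq_chain_measurable) (use Cons in auto)
  let ?K = "\<lambda>x s s'. (fst q (x + s /\<^sub>R 2))\<^sup>2 * (snd q (x - s' /\<^sub>R 2))\<^sup>2 * sq_chain G L x (u - c *\<^sub>R x + s - s')"
  let ?H = "\<lambda>x y z. (fst q y)\<^sup>2 * (snd q z)\<^sup>2 * sq_chain G L x (u + 2 *\<^sub>R y + 2 *\<^sub>R z - (c + 4) *\<^sub>R x)"
  have 4: "(2::ennreal) ^ DIM('v) * 2 ^ DIM('v) = 4 ^ DIM('v)"
    by (simp add: power_mult_distrib[symmetric])
  have "(\<integral>\<^sup>+x. sq_chain G (q # L) x (u - c *\<^sub>R x) \<partial>lborel) = (\<integral>\<^sup>+x. \<integral>\<^sup>+s. \<integral>\<^sup>+s'. ?K x s s' \<partial>lborel \<partial>lborel \<partial>lborel)"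
    by simp
  also have "\<dots> = (\<integral>\<^sup>+x. \<integral>\<^sup>+s. 2 ^ DIM('v) * (\<integral>\<^sup>+z. ?K x s (2 *\<^sub>R x + (- 2) *\<^sub>R z) \<partial>lborel) \<partial>lborel \<partial>lborel)"
    by (intro nn_integral_cong nn_integral_lborel_affine2) auto
  also have "\<dots> = (\<integral>\<^sup>+x. 2 ^ DIM('v) * (\<integral>\<^sup>+y. 2 ^ DIM('v) * (\<integral>\<^sup>+z. ?K x (- 2 *\<^sub>R x + 2 *\<^sub>R y) (2 *\<^sub>R x + (- 2) *\<^sub>R z) \<partial>lborel) \<partial>lborel) \<partial>lborel)"
  proof (intro nn_integral_cong)
    fix x
    let ?R = "\<lambda>s. 2 ^ DIM('v) * (\<integral>\<^sup>+z. ?K x s (2 *\<^sub>R x + (- 2) *\<^sub>R z) \<partial>lborel)"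
    have "?R \<in> borel_measurable borel" by measurable
    from nn_integral_lborel_affine2[OF this, of 2 "- 2 *\<^sub>R x"]
    show "(\<integral>\<^sup>+s. ?R s \<partial>lborel) = 2 ^ DIM('v) * (\<integral>\<^sup>+y. ?R (- 2 *\<^sub>R x + 2 *\<^sub>R y) \<partial>lborel)"
      by simp
  qed
  also have "\<dots> = (\<integral>\<^sup>+x. 4 ^ DIM('v) * (\<integral>\<^sup>+y. \<integral>\<^sup>+z. ?H x y z \<partial>lborel \<partial>lborel) \<partial>lborel)"
  proof (intro nn_integral_cong)
    fix x
    have "?K x (- 2 *\<^sub>R x + 2 *\<^sub>R y) (2 *\<^sub>R x + (- 2) *\<^sub>R z) = ?H x y z" for y z
    proof -
      have "u - c *\<^sub>R x + (- 2 *\<^sub>R x + 2 *\<^sub>R y) - (2 *\<^sub>R x + (- 2) *\<^sub>R z) = u + 2 *\<^sub>R y + 2 *\<^sub>R z - (c + 4) *\<^sub>R x"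
        by (simp add: algebra_simps) (simp add: scaleR_add_left[symmetric] add.assoc[symmetric] del: scaleR_add_left)
      moreover have "x + (- 2 *\<^sub>R x + 2 *\<^sub>R y) /\<^sub>R 2 = y" "x - (2 *\<^sub>R x + (- 2) *\<^sub>R z) /\<^sub>R 2 = z"
        by (simp_all add: algebra_simps)
      ultimately show ?thesis by (simp only:)
    qed
    then show "2 ^ DIM('v) * (\<integral>\<^sup>+y. 2 ^ DIM('v) * (\<integral>\<^sup>+z. ?K x (- 2 *\<^sub>R x + 2 *\<^sub>R y) (2 *\<^sub>R x + (- 2) *\<^sub>R z) \<partial>lborel) \<partial>lborel)
      = 4 ^ DIM('v) * (\<integral>\<^sup>+y. \<integral>\<^sup>+z. ?H x y z \<partial>lborel \<partial>lborel)"
      by (subst nn_integral_cmult) (auto simp: mult.assoc[symmetric] 4)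
  qed
  also have "\<dots> = 4 ^ DIM('v) * (\<integral>\<^sup>+x. \<integral>\<^sup>+y. \<integral>\<^sup>+z. ?H x y z \<partial>lborel \<partial>lborel \<partial>lborel)"
    by (rule nn_integral_cmult) measurable
  also have "(\<integral>\<^sup>+x. \<integral>\<^sup>+y. \<integral>\<^sup>+z. ?H x y z \<partial>lborel \<partial>lborel \<partial>lborel) = (\<integral>\<^sup>+y. \<integral>\<^sup>+x. \<integral>\<^sup>+z. ?H x y z \<partial>lborel \<partial>lborel \<partial>lborel)"
    by (rule nn_integral_lborel_pair(2)) measurable
  also have "\<dots> = (\<integral>\<^sup>+y. \<integral>\<^sup>+z. \<integral>\<^sup>+x. ?H x y z \<partial>lborel \<partial>lborel \<partial>lborel)"
    by (intro nn_integral_cong nn_integral_lborel_pair(2)) measurable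
  also have "\<dots> = (\<integral>\<^sup>+y. \<integral>\<^sup>+z. (fst q y)\<^sup>2 * (snd q z)\<^sup>2 * (\<integral>\<^sup>+x. sq_chain G L x (u + 2 *\<^sub>R y + 2 *\<^sub>R z - (c + 4) *\<^sub>R x) \<partial>lborel) \<partial>lborel \<partial>lborel)"
    by (intro nn_integral_cong nn_integral_cmult) measurable
  also have "\<dots> = (\<integral>\<^sup>+y. \<integral>\<^sup>+z. (fst q y)\<^sup>2 * ((snd q z)\<^sup>2 * ((\<Prod>q\<leftarrow>L. 4 ^ DIM('v) * (\<integral>\<^sup>+y. (fst q y)\<^sup>2 \<partial>lborel) * (\<integral>\<^sup>+z. (snd q z)\<^sup>2 \<partial>lborel)) *
    (\<integral>\<^sup>+x. G x \<partial>lborel) * ennreal (1 / \<bar>(c + 4) + 4 * real (length L)\<bar> ^ DIM('v)))) \<partial>lborel \<partial>lborel)"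
    using Cons.prems by (subst Cons.IH) (auto simp: mult.assoc)
  also have "\<dots> = (\<integral>\<^sup>+y. (fst q y)\<^sup>2 \<partial>lborel) * ((\<integral>\<^sup>+z. (snd q z)\<^sup>2 \<partial>lborel) * ((\<Prod>q\<leftarrow>L. 4 ^ DIM('v) * (\<integral>\<^sup>+y. (fst q y)\<^sup>2 \<partial>lborel) * (\<integral>\<^sup>+z. (snd q z)\<^sup>2 \<partial>lborel)) *
    (\<integral>\<^sup>+x. G x \<partial>lborel) * ennreal (1 / \<bar>(c + 4) + 4 * real (length L)\<bar> ^ DIM('v))))"
    by (simp add: nn_integral_cmult nn_integral_multc)
  finally show ?case by (simp add: mult_ac add_ac distrib_left)
qed

lemma nn_integral_chain_wprod_le:
  fixes L :: "(('v::euclidean_space \<Rightarrow> ennreal) \<times> ('v \<Rightarrow> ennreal)) list"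
  assumes "G \<in> borel_measurable borel" and "\<And>u. G (- u) = G u" and "\<forall>q\<in>set L. borel_pair q" and "L \<noteq> []"
  shows "(\<integral>\<^sup>+x. chain G (map wprod L) x 0 \<partial>lborel) \<le>
    (\<Prod>q\<leftarrow>L. 4 ^ DIM('v) * (\<integral>\<^sup>+y. (fst q y)\<^sup>2 \<partial>lborel) * (\<integral>\<^sup>+z. (snd q z)\<^sup>2 \<partial>lborel)) *
    (\<integral>\<^sup>+x. G x \<partial>lborel) * ennreal (1 / (4 * real (length L)) ^ DIM('v))"
proof -
  have "(\<integral>\<^sup>+x. chain G (map wprod L) x 0 \<partial>lborel) \<le> (\<integral>\<^sup>+x. sq_chain G L x (0 - 0 *\<^sub>R x) \<partial>lborel)"
    using chain_wprod_le[OF assms(1-3)] by (intro nn_integral_mono) auto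
  also note nn_integral_sq_chain[OF assms(1,3), of 0 0]
  finally show ?thesis using assms(4) by simp
qed


section \<open>Even powers of a Fourier transform\<close>

text \<open>The function \<open>N\<close> is the squared modulus of a Fourier transform, written as the transform of the
  tensor-type kernel \<open>c\<close> on pairs; \<open>A\<close> is the modulus of the transformed function. This is all that is
  used of the quaternion structure, and both the left and the right transform have this form.\<close>

definition autocorr_rep :: "('v::euclidean_space \<Rightarrow> ennreal) \<Rightarrow> ('v \<Rightarrow> real) \<Rightarrow> ('v \<times> 'v \<Rightarrow> complex) \<Rightarrow> bool" where
  "autocorr_rep A N c \<longleftrightarrow> A \<in> borel_measurable borel \<and> (\<integral>\<^sup>+s. A s \<partial>lborel) < \<infinity> \<and> (\<forall>w. 0 \<le> N w) \<and>
    c \<in> borel_measurable borel \<and> (\<forall>z. ennreal (cmod (c z)) \<le> A (fst z) * A (snd z)) \<and>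
    (\<forall>w. complex_of_real (N w) = (\<integral>z. cis (- (w \<bullet> (fst z - snd z))) * c z \<partial>lborel))"

definition autocorr :: "('v::euclidean_space \<Rightarrow> ennreal) \<Rightarrow> ('v \<Rightarrow> real) \<Rightarrow> bool" where
  "autocorr A N \<longleftrightarrow> (\<exists>c. autocorr_rep A N c)"

lemma borel_measurable_fst_snd:
  "fst \<in> borel_measurable (borel :: ('a::second_countable_topology \<times> 'b::second_countable_topology) measure)"
  "snd \<in> borel_measurable (borel :: ('a::second_countable_topology \<times> 'b::second_countable_topology) measure)"
  by (auto intro!: borel_measurable_continuous_onI continuous_intros)

lemma autocorr_bounds:
  assumes "autocorr A N"
  shows "N \<in> borel_measurable borel" and "\<exists>B. \<forall>w. \<bar>N w\<bar> \<le> B"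
proof -
  note [measurable] = borel_measurable_fst_snd
  from assms obtain c where [measurable]: "A \<in> borel_measurable borel" "c \<in> borel_measurable borel"
    and fin: "(\<integral>\<^sup>+s. A s \<partial>lborel) < \<infinity>" and pos: "\<And>w. 0 \<le> N w"
    and le: "\<And>z. ennreal (cmod (c z)) \<le> A (fst z) * A (snd z)"
    and N: "\<And>w. complex_of_real (N w) = (\<integral>z. cis (- (w \<bullet> (fst z - snd z))) * c z \<partial>lborel)"
    by (auto simp: autocorr_def autocorr_rep_def)
  have "(\<lambda>w. Re (\<integral>z. cis (- (w \<bullet> (fst z - snd z))) * c z \<partial>lborel)) \<in> borel_measurable borel"
    by measurable
  then show "N \<in> borel_measurable borel"
    by (simp flip: N)
  have fin2: "(\<integral>\<^sup>+z. A (fst z) * A (snd z) \<partial>lborel) < \<infinity>"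
  proof -
    have "(\<integral>\<^sup>+z. A (fst z) * A (snd z) \<partial>lborel) = (\<integral>\<^sup>+s. \<integral>\<^sup>+s'. A s * A s' \<partial>lborel \<partial>lborel)"
      by (subst nn_integral_lborel_pair(1)) auto
    also have "\<dots> = (\<integral>\<^sup>+s. A s \<partial>lborel) * (\<integral>\<^sup>+s. A s \<partial>lborel)"
      by (simp add: nn_integral_cmult nn_integral_multc)
    finally show ?thesis using fin by (simp add: ennreal_mult_less_top)
  qed
  have "\<bar>N w\<bar> \<le> enn2real (\<integral>\<^sup>+z. A (fst z) * A (snd z) \<partial>lborel)" for w
  proof -
    have "ennreal \<bar>N w\<bar> = ennreal (cmod (complex_of_real (N w)))" by simp
    \<comment> \<open>Without integrability the integral has the default value 0, and the bound is
      trivial.\<close>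
    also have "\<dots> \<le> (\<integral>\<^sup>+z. norm (cis (- (w \<bullet> (fst z - snd z))) * c z) \<partial>lborel)"
      unfolding N by (cases "integrable lborel (\<lambda>z. cis (- (w \<bullet> (fst z - snd z))) * c z)")
        (auto simp: integral_norm_bound_ennreal not_integrable_integral_eq)
    also have "\<dots> \<le> (\<integral>\<^sup>+z. A (fst z) * A (snd z) \<partial>lborel)"
      by (intro nn_integral_mono) (simp add: norm_mult le)
    finally show ?thesis
      using fin2 by (simp add: enn2real_nonneg le_ennreal_iff)
       (metis enn2real_ennreal enn2real_mono abs_ge_zero less_top)
  qed
  then show "\<exists>B. \<forall>w. \<bar>N w\<bar> \<le> B" by blast
qed

text \<open>Inserting the integral that represents N and applying Fubini turns multiplication by N
  in frequency into an average of the transform of M over shifts by s - s', weighted by c. The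
  double integral converges absolutely because M is bounded and the Gaussian and c are
  integrable.\<close>

lemma autocorr_rep_fourier:
  fixes M :: "'v::euclidean_space \<Rightarrow> real"
  assumes \<eta>: "0 < \<eta>" and autocorr: "autocorr_rep A N c" and [measurable]: "M \<in> borel_measurable borel"
    and B: "\<And>w. \<bar>M w\<bar> \<le> B"
  defines "J \<equiv> \<lambda>u. (\<integral>w. complex_of_real (M w * gauss \<eta> w) * cis (- (w \<bullet> u)) \<partial>lborel)"
  shows "integrable lborel c"
    and "(\<integral>w. complex_of_real ((N w * M w) * gauss \<eta> w) * cis (- (w \<bullet> u)) \<partial>lborel) =
      (\<integral>z. c z * J (u + fst z - snd z) \<partial>lborel)"
proof -
  note [measurable] = borel_measurable_fst_snd
  from autocorr have [measurable]: "A \<in> borel_measurable borel" "c \<in> borel_measurable borel"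
    and fin: "(\<integral>\<^sup>+s. A s \<partial>lborel) < \<infinity>"
    and le: "\<And>z. ennreal (cmod (c z)) \<le> A (fst z) * A (snd z)"
    and N: "\<And>w. complex_of_real (N w) = (\<integral>z. cis (- (w \<bullet> (fst z - snd z))) * c z \<partial>lborel)"
    by (auto simp: autocorr_rep_def)
  have Mint: "integrable lborel (\<lambda>w. M w * gauss \<eta> w)"
  proof (rule Bochner_Integration.integrable_bound)
    show "integrable lborel (\<lambda>w::'v. B * gauss \<eta> w)"
      by (intro integrable_mult_right gauss_integrable[OF \<eta>])
    show "AE w in lborel. norm (M w * gauss \<eta> w) \<le> norm (B * gauss \<eta> w)"
      using B by (auto simp: abs_mult intro!: mult_right_mono AE_I2) (meson abs_ge_self order_trans)
  qed measurable
  have cint: "integrable lborel c"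
  proof (rule integrableI_bounded)
    have "(\<integral>\<^sup>+z. norm (c z) \<partial>lborel) \<le> (\<integral>\<^sup>+z. A (fst z) * A (snd z) \<partial>lborel)"
      by (intro nn_integral_mono le)
    also have "\<dots> = (\<integral>\<^sup>+s. \<integral>\<^sup>+s'. A s * A s' \<partial>lborel \<partial>lborel)"
      by (subst nn_integral_lborel_pair(1)) auto
    also have "\<dots> = (\<integral>\<^sup>+s. A s \<partial>lborel) * (\<integral>\<^sup>+s. A s \<partial>lborel)"
      by (simp add: nn_integral_cmult nn_integral_multc)
    finally show "(\<integral>\<^sup>+z. norm (c z) \<partial>lborel) < \<infinity>"
      using fin by (simp add: ennreal_mult_less_top less_top[symmetric] top_unique) (metis ennreal_mult_eq_top_iff top.extremum_uniqueI)
  qed measurable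
  have main: "(\<integral>w. complex_of_real ((N w * M w) * gauss \<eta> w) * cis (- (w \<bullet> u)) \<partial>lborel) = (\<integral>z. c z * J (u + fst z - snd z) \<partial>lborel)"
  proof -
    let ?f = "\<lambda>w z. c z * (complex_of_real (M w * gauss \<eta> w) * cis (- (w \<bullet> (u + fst z - snd z))))"
    have "(\<integral>w. complex_of_real ((N w * M w) * gauss \<eta> w) * cis (- (w \<bullet> u)) \<partial>lborel) = (\<integral>w. \<integral>z. ?f w z \<partial>lborel \<partial>lborel)"
    proof (rule Bochner_Integration.integral_cong[OF refl])
      fix w
      have "complex_of_real ((N w * M w) * gauss \<eta> w) * cis (- (w \<bullet> u)) =
        (complex_of_real (M w * gauss \<eta> w) * cis (- (w \<bullet> u))) * complex_of_real (N w)"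
        by simp
      also have "\<dots> = (\<integral>z. (complex_of_real (M w * gauss \<eta> w) * cis (- (w \<bullet> u))) * (cis (- (w \<bullet> (fst z - snd z))) * c z) \<partial>lborel)"
        unfolding N by (rule integral_mult_right_zero[symmetric])
      also have "\<dots> = (\<integral>z. ?f w z \<partial>lborel)"
      proof (rule Bochner_Integration.integral_cong[OF refl])
        fix z :: "'v \<times> 'v"
        have "cis (- (w \<bullet> (u + fst z - snd z))) = cis (- (w \<bullet> u)) * cis (- (w \<bullet> (fst z - snd z)))"
          by (simp add: cis_mult inner_simps add_ac diff_diff_eq)
        then show "complex_of_real (M w * gauss \<eta> w) * cis (- (w \<bullet> u)) * (cis (- (w \<bullet> (fst z - snd z))) * c z) = ?f w z"
          by simp
      qed
      finally show "complex_of_real ((N w * M w) * gauss \<eta> w) * cis (- (w \<bullet> u)) = (\<integral>z. ?f w z \<partial>lborel)" .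
    qed
    also have "\<dots> = (\<integral>z. \<integral>w. ?f w z \<partial>lborel \<partial>lborel)"
    proof (rule lborel_pair.Fubini_integral[symmetric])
      show "integrable (lborel \<Otimes>\<^sub>M lborel) (case_prod ?f)"
      proof (rule lborel_pair.Fubini_integrable)
        show "case_prod ?f \<in> borel_measurable (lborel \<Otimes>\<^sub>M lborel)" by measurable
        have "integrable lborel (\<lambda>w. norm (M w * gauss \<eta> w) * (\<integral>z. norm (c z) \<partial>lborel))"
          using Mint by (intro integrable_mult_left integrable_norm)
        then show "integrable lborel (\<lambda>w. \<integral>z. norm (case (w, z) of (w, z) \<Rightarrow> ?f w z) \<partial>lborel)"
          by (simp add: norm_mult mult_ac abs_mult)
        show "AE w in lborel. integrable lborel (\<lambda>z. case (w, z) of (w, z) \<Rightarrow> ?f w z)"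
        proof (intro AE_I2)
          fix w
          show "integrable lborel (\<lambda>z. case (w, z) of (w, z) \<Rightarrow> ?f w z)"
            by (rule Bochner_Integration.integrable_bound[OF integrable_mult_left[OF cint, of "complex_of_real (M w * gauss \<eta> w)"]])
              (auto simp: norm_mult)
        qed
      qed
    qed
    also have "\<dots> = (\<integral>z. c z * J (u + fst z - snd z) \<partial>lborel)"
      unfolding J_def by (intro Bochner_Integration.integral_cong refl integral_mult_right_zero)
    finally show ?thesis .
  qed
  from cint show "integrable lborel c" .
  from main show "(\<integral>w. complex_of_real ((N w * M w) * gauss \<eta> w) * cis (- (w \<bullet> u)) \<partial>lborel) =
      (\<integral>z. c z * J (u + fst z - snd z) \<partial>lborel)" .
qed

text \<open>Each factor N is expanded by \<open>autocorr_rep_fourier\<close>, with the product of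
  the remaining factors as M. Measurability and boundedness of that product belong to the same
  induction because the expansion presupposes them. With no factors left, the transform of the
  Gaussian is exactly the base function of the chain.\<close>

lemma autocorr_chain_bound:
  fixes As :: "('p \<Rightarrow> 'v::euclidean_space \<Rightarrow> ennreal) list"
  assumes \<eta>: "0 < \<eta>" and "list_all2 (\<lambda>A N. autocorr (A p) N) As Ns"
  shows "(\<lambda>w. \<Prod>N\<leftarrow>Ns. N w) \<in> borel_measurable borel"
    and "\<exists>B. \<forall>w. \<bar>\<Prod>N\<leftarrow>Ns. N w\<bar> \<le> B"
    and "ennreal (cmod (\<integral>w. complex_of_real ((\<Prod>N\<leftarrow>Ns. N w) * gauss \<eta> w) * cis (- (w \<bullet> u)) \<partial>lborel))
      \<le> chain (\<lambda>u. ennreal (gauss_ft \<eta> u)) As p u"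
proof -
  note [measurable] = borel_measurable_fst_snd
  have "(\<lambda>w. \<Prod>N\<leftarrow>Ns. N w) \<in> borel_measurable borel \<and>
    (\<exists>B. \<forall>w. \<bar>\<Prod>N\<leftarrow>Ns. N w\<bar> \<le> B) \<and>
    (\<forall>u. ennreal (cmod (\<integral>w. complex_of_real ((\<Prod>N\<leftarrow>Ns. N w) * gauss \<eta> w) * cis (- (w \<bullet> u)) \<partial>lborel))
      \<le> chain (\<lambda>u. ennreal (gauss_ft \<eta> u)) As p u)"
    using assms(2)
  proof (induction As Ns rule: list_all2_induct)
    case Nil
    then show ?case
      by (auto simp: gauss_fourier[OF \<eta>] gauss_ft_nonneg[OF \<eta>])
  next
    case (Cons A As N Ns)
    define M where "M = (\<lambda>w. \<Prod>N\<leftarrow>Ns. N w)"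
    have [measurable]: "M \<in> borel_measurable borel" using Cons by (simp add: M_def)
    obtain B where B: "\<And>w. \<bar>M w\<bar> \<le> B" using Cons by (auto simp: M_def)
    define J where "J u = (\<integral>w. complex_of_real (M w * gauss \<eta> w) * cis (- (w \<bullet> u)) \<partial>lborel)" for u
    have J: "ennreal (cmod (J u)) \<le> chain (\<lambda>u. ennreal (gauss_ft \<eta> u)) As p u" for u
      using Cons by (auto simp: M_def J_def)
    from Cons(1) obtain c where rep: "autocorr_rep (A p) N c" by (auto simp: autocorr_def)
    then have [measurable]: "A p \<in> borel_measurable borel" "c \<in> borel_measurable borel"
      and fin: "(\<integral>\<^sup>+s. A p s \<partial>lborel) < \<infinity>"
      and le: "\<And>z. ennreal (cmod (c z)) \<le> A p (fst z) * A p (snd z)"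
      by (auto simp: autocorr_def autocorr_rep_def)
    note autocorr_bounds[OF Cons(1)]
    then obtain B' where [measurable]: "N \<in> borel_measurable borel" and B': "\<And>w. \<bar>N w\<bar> \<le> B'" by auto
    note main = autocorr_rep_fourier(2)[OF \<eta> rep \<open>M \<in> borel_measurable borel\<close> B, folded J_def]
    have bound: "ennreal (cmod (\<integral>w. complex_of_real ((N w * M w) * gauss \<eta> w) * cis (- (w \<bullet> u)) \<partial>lborel))
      \<le> chain (\<lambda>u. ennreal (gauss_ft \<eta> u)) (A # As) p u" for u
    proof -
      let ?K = "\<lambda>s s'. A p s * A p s' * chain (\<lambda>u. ennreal (gauss_ft \<eta> u)) As p (u + s - s')"
      have [measurable]: "chain (\<lambda>u. ennreal (gauss_ft \<eta> u)) As p \<in> borel_measurable borel"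
      proof (rule chain_measurable_point)
        fix A' assume "A' \<in> set As"
        then show "A' p \<in> borel_measurable borel"
          using Cons(2) by (auto simp: list_all2_conv_all_nth in_set_conv_nth autocorr_def autocorr_rep_def)
      qed measurable
      have "ennreal (cmod (\<integral>z. c z * J (u + fst z - snd z) \<partial>lborel)) \<le> (\<integral>\<^sup>+z. norm (c z * J (u + fst z - snd z)) \<partial>lborel)"
        by (cases "integrable lborel (\<lambda>z. c z * J (u + fst z - snd z))")
           (auto simp: integral_norm_bound_ennreal not_integrable_integral_eq)
      also have "\<dots> \<le> (\<integral>\<^sup>+z. ?K (fst z) (snd z) \<partial>lborel)"
        by (intro nn_integral_mono) (auto simp: norm_mult ennreal_mult intro!: mult_mono le J)
      also have "\<dots> = chain (\<lambda>u. ennreal (gauss_ft \<eta> u)) (A # As) p u"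
        unfolding chain.simps by (rule nn_integral_lborel_pair(1)[symmetric]) measurable
      finally show ?thesis unfolding main .
    qed
    have "\<bar>N w * M w\<bar> \<le> B' * B" for w
      unfolding abs_mult using B[of w] B'[of w] by (intro mult_mono) auto
    then show ?case
      using bound by (auto simp: M_def) (use \<open>M \<in> borel_measurable borel\<close> in \<open>simp add: M_def\<close>)
  qed
  then show "(\<lambda>w. \<Prod>N\<leftarrow>Ns. N w) \<in> borel_measurable borel"
    and "\<exists>B. \<forall>w. \<bar>\<Prod>N\<leftarrow>Ns. N w\<bar> \<le> B"
    and "ennreal (cmod (\<integral>w. complex_of_real ((\<Prod>N\<leftarrow>Ns. N w) * gauss \<eta> w) * cis (- (w \<bullet> u)) \<partial>lborel))
      \<le> chain (\<lambda>u. ennreal (gauss_ft \<eta> u)) As p u" by auto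
qed

text \<open>At u = 0 the character is 1 and the integrand is nonnegative, so the modulus of the
  transform is the integral itself.\<close>

lemma nn_integral_autocorr_le_chain:
  fixes As :: "('p \<Rightarrow> 'v::euclidean_space \<Rightarrow> ennreal) list"
  assumes \<eta>: "0 < \<eta>" and autocorr: "list_all2 (\<lambda>A N. autocorr (A p) N) As Ns"
  shows "(\<integral>\<^sup>+w. (\<Prod>N\<leftarrow>Ns. ennreal (N w)) * ennreal (gauss \<eta> w) \<partial>lborel)
      \<le> chain (\<lambda>u. ennreal (gauss_ft \<eta> u)) As p 0"
proof -
  note b = autocorr_chain_bound[OF \<eta> autocorr]
  note [measurable] = b(1)
  obtain B where B: "\<And>w. \<bar>\<Prod>N\<leftarrow>Ns. N w\<bar> \<le> B" using b(2) by auto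
  have nn: "\<forall>N\<in>set Ns. \<forall>w. 0 \<le> N w"
    using autocorr by (auto simp: list_all2_conv_all_nth in_set_conv_nth autocorr_def autocorr_rep_def)
  then have pl: "(\<Prod>N\<leftarrow>Ns. ennreal (N w)) = ennreal (\<Prod>N\<leftarrow>Ns. N w) \<and> 0 \<le> (\<Prod>N\<leftarrow>Ns. N w)" for w
    by (induction Ns) (auto simp: ennreal_mult)
  have int: "integrable lborel (\<lambda>w. (\<Prod>N\<leftarrow>Ns. N w) * gauss \<eta> w)"
  proof (rule Bochner_Integration.integrable_bound)
    show "integrable lborel (\<lambda>w::'v. B * gauss \<eta> w)"
      by (intro integrable_mult_right gauss_integrable[OF \<eta>])
    show "AE w in lborel. norm ((\<Prod>N\<leftarrow>Ns. N w) * gauss \<eta> w) \<le> norm (B * gauss \<eta> w)"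
      using B by (auto simp: abs_mult intro!: mult_right_mono AE_I2) (meson abs_ge_self order_trans)
  qed measurable
  have "(\<integral>\<^sup>+w. (\<Prod>N\<leftarrow>Ns. ennreal (N w)) * ennreal (gauss \<eta> w) \<partial>lborel)
    = (\<integral>\<^sup>+w. ennreal ((\<Prod>N\<leftarrow>Ns. N w) * gauss \<eta> w) \<partial>lborel)"
    using pl by (simp add: ennreal_mult less_imp_le[OF gauss_pos])
  also have "\<dots> = ennreal (\<integral>w. (\<Prod>N\<leftarrow>Ns. N w) * gauss \<eta> w \<partial>lborel)"
    using pl by (intro nn_integral_eq_integral int) (auto simp: less_imp_le[OF gauss_pos])
  also have "\<dots> = ennreal (cmod (\<integral>w. complex_of_real ((\<Prod>N\<leftarrow>Ns. N w) * gauss \<eta> w) * cis (- (w \<bullet> 0)) \<partial>lborel))"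
  proof -
    have "(\<integral>w. complex_of_real ((\<Prod>N\<leftarrow>Ns. N w) * gauss \<eta> w) * cis (- (w \<bullet> 0)) \<partial>lborel)
      = complex_of_real (\<integral>w. (\<Prod>N\<leftarrow>Ns. N w) * gauss \<eta> w \<partial>lborel)"
      by (simp del: of_real_mult)
    moreover have "0 \<le> (\<integral>w. (\<Prod>N\<leftarrow>Ns. N w) * gauss \<eta> w \<partial>lborel)"
      using pl by (intro Bochner_Integration.integral_nonneg) (auto simp: less_imp_le[OF gauss_pos])
    ultimately show ?thesis by (simp add: norm_of_real del: of_real_mult)
  qed
  also note b(3)
  finally show ?thesis .
qed


section \<open>Continuity of translation in the square mean\<close>

lemma nn_integral_lborel_translate:
  fixes F :: "'v::euclidean_space \<Rightarrow> ennreal"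
  assumes "F \<in> borel_measurable borel"
  shows "(\<integral>\<^sup>+s. F (s + v) \<partial>lborel) = (\<integral>\<^sup>+s. F s \<partial>lborel)"
  using nn_integral_lborel_affine[OF assms, of 1 v] by (simp add: add.commute)

lemma tendsto_0_le_ennreal:
  fixes f g :: "nat \<Rightarrow> ennreal"
  assumes "g \<longlonglongrightarrow> 0" and "\<And>n. f n \<le> g n"
  shows "f \<longlonglongrightarrow> 0"
  by (rule tendsto_sandwich[where f="\<lambda>_. 0" and h=g]) (use assms in auto)

text \<open>A point of the open set T stays in T under all sufficiently small shifts, so the part
  leaving T vanishes in the limit by dominated convergence. That argument fails on the boundary for
  the part entering T; translation invariance gives it the same measure, after cancelling the common
  part \<open>?K\<close>, which is finite.\<close>

lemma open_indicator_translate: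
  fixes X :: "nat \<Rightarrow> 'v::euclidean_space"
  assumes "open T" and fin: "emeasure lborel T < \<infinity>" and X: "X \<longlonglongrightarrow> 0"
  shows "(\<lambda>n. \<integral>\<^sup>+s. ennreal \<bar>indicator T (s + X n) - indicator T s\<bar> \<partial>lborel) \<longlonglongrightarrow> 0"
proof -
  have [measurable]: "T \<in> sets borel" using assms by auto
  let ?I = "\<lambda>v s. indicator T s * (1 - indicator T (s + v)) :: real"
  have lim: "(\<lambda>n. \<integral>\<^sup>+s. ennreal (?I (X n) s) \<partial>lborel) \<longlonglongrightarrow> (\<integral>\<^sup>+(s::'v). 0 \<partial>lborel)"
  proof (rule nn_integral_dominated_convergence[where w="indicator T"])
    show "AE s in lborel. (\<lambda>n. ennreal (?I (X n) s)) \<longlonglongrightarrow> 0"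
    proof (intro AE_I2)
      fix s
      show "(\<lambda>n. ennreal (?I (X n) s)) \<longlonglongrightarrow> 0"
      proof (cases "s \<in> T")
        case True
        have "(\<lambda>n. s + X n) \<longlonglongrightarrow> s + 0" by (intro tendsto_intros X)
        then have "eventually (\<lambda>n. s + X n \<in> T) sequentially"
          using \<open>open T\<close> True by (intro topological_tendstoD) auto
        then show ?thesis
          by (intro tendsto_eventually, elim eventually_mono) (use True in auto)
      qed auto
    qed
    show "AE s in lborel. ennreal (?I (X n) s) \<le> indicator T s" for n
      by (auto simp: indicator_def)
    show "(\<integral>\<^sup>+s. indicator T s \<partial>lborel) < \<infinity>"
      using fin by simp
  qed auto
  have sym: "(\<integral>\<^sup>+s. ennreal (?I v s) \<partial>lborel) = (\<integral>\<^sup>+s. ennreal (indicator T (s + v) * (1 - indicator T s)) \<partial>lborel)" for v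
  proof -
    let ?K = "\<integral>\<^sup>+s. ennreal (indicator T s * indicator T (s + v)) \<partial>lborel"
    have "(\<integral>\<^sup>+s. ennreal (?I v s) \<partial>lborel) + ?K = (\<integral>\<^sup>+s. ennreal (indicator T s) \<partial>lborel)"
      by (subst nn_integral_add[symmetric]) (auto intro!: nn_integral_cong simp: indicator_def)
    moreover have "(\<integral>\<^sup>+s. ennreal (indicator T (s + v) * (1 - indicator T s)) \<partial>lborel) + ?K =
      (\<integral>\<^sup>+s. ennreal (indicator T (s + v)) \<partial>lborel)"
      by (subst nn_integral_add[symmetric]) (auto intro!: nn_integral_cong simp: indicator_def)
    moreover have "(\<integral>\<^sup>+s. ennreal (indicator T (s + v)) \<partial>lborel) = (\<integral>\<^sup>+s. ennreal (indicator T s) \<partial>lborel)"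
      by (rule nn_integral_lborel_translate) auto
    moreover have "?K < \<infinity>"
    proof -
      have "?K \<le> (\<integral>\<^sup>+s. indicator T s \<partial>lborel)"
        by (intro nn_integral_mono) (auto simp: indicator_def)
      then show ?thesis using fin by (simp add: le_less_trans)
    qed
    ultimately have "?K + (\<integral>\<^sup>+s. ennreal (?I v s) \<partial>lborel) = ?K + (\<integral>\<^sup>+s. ennreal (indicator T (s + v) * (1 - indicator T s)) \<partial>lborel)"
      and "?K \<noteq> \<infinity>"
      by (simp_all only: add.commute[of ?K])
    then show ?thesis
      by (simp only: ennreal_add_left_cancel) blast
  qed
  have "(\<integral>\<^sup>+s. ennreal \<bar>indicator T (s + v) - indicator T s\<bar> \<partial>lborel) = 2 * (\<integral>\<^sup>+s. ennreal (?I v s) \<partial>lborel)" for v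
  proof -
    have "(\<integral>\<^sup>+s. ennreal \<bar>indicator T (s + v) - indicator T s\<bar> \<partial>lborel) =
      (\<integral>\<^sup>+s. ennreal (?I v s) + ennreal (indicator T (s + v) * (1 - indicator T s)) \<partial>lborel)"
      by (intro nn_integral_cong) (auto simp: indicator_def)
    also have "\<dots> = 2 * (\<integral>\<^sup>+s. ennreal (?I v s) \<partial>lborel)"
      by (subst nn_integral_add) (auto simp: sym[symmetric] mult_2)
    finally show ?thesis .
  qed
  moreover have "(\<lambda>n. 2 * (\<integral>\<^sup>+s. ennreal (?I (X n) s) \<partial>lborel)) \<longlonglongrightarrow> 2 * 0"
    using lim by (intro ennreal_tendsto_cmult) auto
  ultimately show ?thesis by simp
qed

text \<open>Continuity under translation survives limits in the integral norm: f is compared with g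
  both at s and at s + X n, and translation invariance makes the two errors equal.\<close>

lemma L1_translate_approx:
  fixes f :: "'v::euclidean_space \<Rightarrow> 'b::{banach,second_countable_topology}"
  assumes [measurable]: "f \<in> borel_measurable borel"
    and X: "X \<longlonglongrightarrow> 0"
    and approx: "\<And>e::real. 0 < e \<Longrightarrow> \<exists>g. g \<in> borel_measurable borel \<and>
      (\<integral>\<^sup>+s. norm (f s - g s) \<partial>lborel) \<le> ennreal e \<and>
      (\<lambda>n. \<integral>\<^sup>+s. norm (g (s + X n) - g s) \<partial>lborel) \<longlonglongrightarrow> 0"
  shows "(\<lambda>n. \<integral>\<^sup>+s. norm (f (s + X n) - f s) \<partial>lborel) \<longlonglongrightarrow> 0"
proof (rule tendsto_zero_ennreal)
  fix e :: real assume "0 < e"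
  then obtain g where [measurable]: "g \<in> borel_measurable borel"
    and fg: "(\<integral>\<^sup>+s. norm (f s - g s) \<partial>lborel) \<le> ennreal (e / 4)"
    and g: "(\<lambda>n. \<integral>\<^sup>+s. norm (g (s + X n) - g s) \<partial>lborel) \<longlonglongrightarrow> 0"
    using approx[of "e / 4"] by auto
  have "eventually (\<lambda>n. (\<integral>\<^sup>+s. norm (g (s + X n) - g s) \<partial>lborel) < ennreal (e / 4)) sequentially"
    using g \<open>0 < e\<close> by (intro order_tendstoD(2)) auto
  then show "eventually (\<lambda>n. (\<integral>\<^sup>+s. norm (f (s + X n) - f s) \<partial>lborel) < ennreal e) sequentially"
  proof eventually_elim
    case (elim n)
    have "(\<integral>\<^sup>+s. norm (f (s + X n) - f s) \<partial>lborel) \<le>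
      (\<integral>\<^sup>+s. ennreal (norm (f (s + X n) - g (s + X n))) + (ennreal (norm (g (s + X n) - g s)) + ennreal (norm (f s - g s))) \<partial>lborel)"
    proof (intro nn_integral_mono)
      fix s
      have "norm (f (s + X n) - f s) \<le> norm (f (s + X n) - g (s + X n)) + (norm (g (s + X n) - g s) + norm (f s - g s))"
        using norm_triangle_ineq[of "f (s + X n) - g (s + X n)" "(g (s + X n) - g s) + (g s - f s)"]
          norm_triangle_ineq[of "g (s + X n) - g s" "g s - f s"] norm_minus_commute[of "g s" "f s"]
        by simp
      then show "ennreal (norm (f (s + X n) - f s)) \<le> ennreal (norm (f (s + X n) - g (s + X n))) + (ennreal (norm (g (s + X n) - g s)) + ennreal (norm (f s - g s)))"
        by (simp flip: ennreal_plus)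
    qed
    also have "\<dots> = (\<integral>\<^sup>+s. norm (f s - g s) \<partial>lborel) + ((\<integral>\<^sup>+s. norm (g (s + X n) - g s) \<partial>lborel) + (\<integral>\<^sup>+s. norm (f s - g s) \<partial>lborel))"
      using nn_integral_lborel_translate[of "\<lambda>s. ennreal (norm (f s - g s))" "X n"]
      by (simp add: nn_integral_add)
    also have "\<dots> \<le> ennreal (e / 4) + (ennreal (e / 4) + ennreal (e / 4))"
      using fg elim by (intro add_mono) auto
    also have "\<dots> = ennreal (e / 4 + (e / 4 + e / 4))"
      using \<open>0 < e\<close> by (simp flip: ennreal_plus)
    also have "\<dots> < ennreal e"
      using \<open>0 < e\<close> by (intro ennreal_lessI) auto
    finally show ?case .
  qed
qed

lemma L1_translate_tendsto:
  fixes f :: "'v::euclidean_space \<Rightarrow> 'b::{banach,second_countable_topology}"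
  assumes "integrable lborel f" and X: "X \<longlonglongrightarrow> 0"
  shows "(\<lambda>n. \<integral>\<^sup>+s. norm (f (s + X n) - f s) \<partial>lborel) \<longlonglongrightarrow> 0"
  using assms(1)
proof (induction rule: integrable_induct)
  case (base A c)
  then have [measurable]: "A \<in> sets borel" by simp
  show ?case
  proof (rule L1_translate_approx[OF _ X])
    fix e :: real assume "0 < e"
    \<comment> \<open>The summand 1 keeps the denominator positive when c = 0.\<close>
    define e' where "e' = e / (norm c + 1)"
    have e': "0 < e'" "e' * norm c \<le> e"
      using \<open>0 < e\<close> by (auto simp: e'_def field_simps add_pos_nonneg intro: add_pos_nonneg)
    obtain T where T: "open T" "A \<subseteq> T" "emeasure lborel (T - A) < ennreal e'"
      using outer_regular_lborel[of A e'] e' by auto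
    have [measurable]: "T \<in> sets borel" using T by auto
    have fin: "emeasure lborel T < \<infinity>"
    proof -
      have "emeasure lborel T \<le> emeasure lborel (T - A) + emeasure lborel A"
        using emeasure_subadditive[of "T - A" lborel A] T(2) by (simp add: Un_absorb2)
      then show ?thesis using T(3) base(2)
        by (metis ennreal_add_less_top ennreal_less_top infinity_ennreal_def le_less_trans order.strict_trans)
    qed
    let ?g = "\<lambda>s. indicator T s *\<^sub>R c"
    show "\<exists>g. g \<in> borel_measurable borel \<and>
      (\<integral>\<^sup>+s. norm (indicat_real A s *\<^sub>R c - g s) \<partial>lborel) \<le> ennreal e \<and>
      (\<lambda>n. \<integral>\<^sup>+s. norm (g (s + X n) - g s) \<partial>lborel) \<longlonglongrightarrow> 0"
    proof (intro exI[of _ ?g] conjI)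
      have "(\<integral>\<^sup>+s. norm (indicat_real A s *\<^sub>R c - ?g s) \<partial>lborel) = (\<integral>\<^sup>+s. ennreal (norm c) * indicator (T - A) s \<partial>lborel)"
        using T(2) by (intro nn_integral_cong) (auto simp: indicator_def)
      also have "\<dots> = ennreal (norm c) * emeasure lborel (T - A)"
        by (simp add: nn_integral_cmult)
      also have "\<dots> \<le> ennreal (norm c) * ennreal e'"
        using T by (intro mult_left_mono) auto
      also have "\<dots> \<le> ennreal e"
        using e' by (simp flip: ennreal_mult add: mult.commute ennreal_leI)
      finally show "(\<integral>\<^sup>+s. norm (indicat_real A s *\<^sub>R c - ?g s) \<partial>lborel) \<le> ennreal e" .
      have "(\<integral>\<^sup>+s. norm (?g (s + v) - ?g s) \<partial>lborel) = ennreal (norm c) * (\<integral>\<^sup>+s. ennreal \<bar>indicator T (s + v) - indicator T s\<bar> \<partial>lborel)" for v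
        by (subst nn_integral_cmult[symmetric], simp)
          (auto intro!: nn_integral_cong simp: indicator_def)
      moreover have "(\<lambda>n. ennreal (norm c) * (\<integral>\<^sup>+s. ennreal \<bar>indicator T (s + X n) - indicator T s\<bar> \<partial>lborel)) \<longlonglongrightarrow> ennreal (norm c) * 0"
        by (intro ennreal_tendsto_cmult open_indicator_translate T fin X) auto
      ultimately show "(\<lambda>n. \<integral>\<^sup>+s. norm (?g (s + X n) - ?g s) \<partial>lborel) \<longlonglongrightarrow> 0"
        by simp
    qed measurable
  qed measurable
next
  case (add f g)
  have [measurable]: "f \<in> borel_measurable borel" "g \<in> borel_measurable borel" using add by auto
  have le: "(\<integral>\<^sup>+s. norm (f (s + v) + g (s + v) - (f s + g s)) \<partial>lborel)
    \<le> (\<integral>\<^sup>+s. norm (f (s + v) - f s) \<partial>lborel) + (\<integral>\<^sup>+s. norm (g (s + v) - g s) \<partial>lborel)" for v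
  proof (subst nn_integral_add[symmetric], simp, simp, rule nn_integral_mono)
    fix s
    show "ennreal (norm (f (s + v) + g (s + v) - (f s + g s))) \<le> ennreal (norm (f (s + v) - f s)) + ennreal (norm (g (s + v) - g s))"
      using norm_triangle_ineq[of "f (s + v) - f s" "g (s + v) - g s"]
      by (simp flip: ennreal_plus add: algebra_simps)
  qed
  have "(\<lambda>n. (\<integral>\<^sup>+s. norm (f (s + X n) - f s) \<partial>lborel) + (\<integral>\<^sup>+s. norm (g (s + X n) - g s) \<partial>lborel)) \<longlonglongrightarrow> 0 + 0"
    by (intro tendsto_add add)
  then show ?case
    by (intro tendsto_0_le_ennreal[OF _ le]) simp
next
  case (lim f s)
  have [measurable]: "f \<in> borel_measurable borel" "s i \<in> borel_measurable borel" for i using lim by auto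
  show ?case
  proof (rule L1_translate_approx[OF _ X])
    fix e :: real assume "0 < e"
    have "(\<lambda>i. \<integral>\<^sup>+x. norm (f x - s i x) \<partial>lborel) \<longlonglongrightarrow> (\<integral>\<^sup>+(x::'v). 0 \<partial>lborel)"
    \<comment> \<open>The approximating simple functions satisfy
      \<open>norm (s i x) \<le> 2 * norm (f x)\<close>, whence the factor 3.\<close>
    proof (rule nn_integral_dominated_convergence[where w="\<lambda>x. ennreal (3 * norm (f x))"])
      show "AE x in lborel. ennreal (norm (f x - s i x)) \<le> ennreal (3 * norm (f x))" for i
      proof (intro AE_I2 ennreal_leI)
        fix x
        have "norm (s i x) \<le> 2 * norm (f x)" using lim by auto
        then show "norm (f x - s i x) \<le> 3 * norm (f x)"
          using norm_triangle_ineq4[of "f x" "s i x"] by linarith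
      qed
      have "integrable lborel (\<lambda>x. 3 * norm (f x))" using lim by auto
      then show "(\<integral>\<^sup>+x. ennreal (3 * norm (f x)) \<partial>lborel) < \<infinity>"
        by (subst nn_integral_eq_integral) auto
      show "AE x in lborel. (\<lambda>i. ennreal (norm (f x - s i x))) \<longlonglongrightarrow> 0"
      proof (intro AE_I2)
        fix x
        have "(\<lambda>i. s i x) \<longlonglongrightarrow> f x" using lim by auto
        then have "(\<lambda>i. norm (f x - s i x)) \<longlonglongrightarrow> norm (f x - f x)" by (intro tendsto_intros)
        then show "(\<lambda>i. ennreal (norm (f x - s i x))) \<longlonglongrightarrow> 0"
          using tendsto_ennrealI by fastforce
      qed
    qed auto
    then have "eventually (\<lambda>i. (\<integral>\<^sup>+x. norm (f x - s i x) \<partial>lborel) < ennreal e) sequentially"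
      using \<open>0 < e\<close> by (intro order_tendstoD(2)) auto
    then obtain i where "(\<integral>\<^sup>+x. norm (f x - s i x) \<partial>lborel) < ennreal e"
      by (auto simp: eventually_sequentially)
    then show "\<exists>g. g \<in> borel_measurable borel \<and>
      (\<integral>\<^sup>+s. norm (f s - g s) \<partial>lborel) \<le> ennreal e \<and>
      (\<lambda>n. \<integral>\<^sup>+s. norm (g (s + X n) - g s) \<partial>lborel) \<longlonglongrightarrow> 0"
      using lim by (intro exI[of _ "s i"]) auto
  qed measurable
qed

text \<open>Applied to \<open>|f| f\<close>, this reduces continuity of translation in the square mean to the integrable case.\<close>

lemma norm_diff_square_le:
  fixes a b :: "'a::real_inner"
  shows "(norm (a - b))\<^sup>2 \<le> 2 * norm (norm a *\<^sub>R a - norm b *\<^sub>R b)"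
proof (cases "a = b")
  case False
  let ?F = "norm a *\<^sub>R a - norm b *\<^sub>R b"
  have "norm (a - b) \<le> norm a + norm b"
    by (rule norm_triangle_ineq4)
  then have "norm (a - b) * (norm (a - b))\<^sup>2 \<le> (norm a + norm b) * (norm (a - b))\<^sup>2"
    by (rule mult_right_mono) simp
  \<comment> \<open>The added nonnegative term completes the expression to twice the inner product
    of \<open>?F\<close> with a - b. Cauchy-Schwarz and division by \<open>norm (a - b)\<close> then
    finish.\<close>
  also have "\<dots> \<le> (norm a + norm b) * (norm a - norm b)\<^sup>2 + (norm a + norm b) * (norm (a - b))\<^sup>2"
    by simp
  also have "\<dots> = 2 * (?F \<bullet> (a - b))"
  proof -
    have ab: "(norm (a - b))\<^sup>2 = (norm a)\<^sup>2 + (norm b)\<^sup>2 - 2 * (a \<bullet> b)"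
      by (simp add: power2_norm_eq_inner inner_diff_left inner_diff_right inner_commute[of b a])
    have "?F \<bullet> (a - b) = norm a * (norm a)\<^sup>2 - (norm a + norm b) * (a \<bullet> b) + norm b * (norm b)\<^sup>2"
      by (simp add: power2_norm_eq_inner inner_diff_left inner_diff_right inner_commute[of b a] distrib_right)
    then show ?thesis unfolding ab by algebra
  qed
  also have "\<dots> \<le> 2 * (norm ?F * norm (a - b))"
    using norm_cauchy_schwarz[of ?F "a - b"] by simp
  finally have "norm (a - b) * (norm (a - b))\<^sup>2 \<le> norm (a - b) * (2 * norm ?F)"
    by (simp add: mult_ac)
  then show ?thesis
    using False by (simp add: mult_le_cancel_left_pos)
qed simp

lemma L2_translate_tendsto:
  fixes f :: "'v::euclidean_space \<Rightarrow> 'b::{real_inner,banach,second_countable_topology}"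
  assumes [measurable]: "f \<in> borel_measurable borel"
    and fin: "(\<integral>\<^sup>+s. ennreal ((norm (f s))\<^sup>2) \<partial>lborel) < \<infinity>" and X: "X \<longlonglongrightarrow> 0"
  shows "(\<lambda>n. \<integral>\<^sup>+s. ennreal ((norm (f (s + X n) - f s))\<^sup>2) \<partial>lborel) \<longlonglongrightarrow> 0"
proof -
  let ?F = "\<lambda>s. norm (f s) *\<^sub>R f s"
  have "integrable lborel ?F"
    using fin by (intro integrableI_bounded) (auto simp: power2_eq_square)
  then have "(\<lambda>n. 2 * (\<integral>\<^sup>+s. norm (?F (s + X n) - ?F s) \<partial>lborel)) \<longlonglongrightarrow> 2 * 0"
    by (intro ennreal_tendsto_cmult L1_translate_tendsto X) auto
  moreover have "(\<integral>\<^sup>+s. ennreal ((norm (f (s + v) - f s))\<^sup>2) \<partial>lborel) \<le> 2 * (\<integral>\<^sup>+s. norm (?F (s + v) - ?F s) \<partial>lborel)" for v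
  proof -
    have "(\<integral>\<^sup>+s. ennreal ((norm (f (s + v) - f s))\<^sup>2) \<partial>lborel) \<le> (\<integral>\<^sup>+s. ennreal (2 * norm (?F (s + v) - ?F s)) \<partial>lborel)"
      by (intro nn_integral_mono ennreal_leI norm_diff_square_le)
    also have "\<dots> = 2 * (\<integral>\<^sup>+s. norm (?F (s + v) - ?F s) \<partial>lborel)"
      by (subst nn_integral_cmult[symmetric]) (auto simp: ennreal_mult')
    finally show ?thesis .
  qed
  ultimately show ?thesis
    by (intro tendsto_0_le_ennreal[where f="\<lambda>n. \<integral>\<^sup>+s. ennreal ((norm (f (s + X n) - f s))\<^sup>2) \<partial>lborel"
      and g="\<lambda>n. 2 * (\<integral>\<^sup>+s. norm (?F (s + X n) - ?F s) \<partial>lborel)"]) auto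
qed


section \<open>Plancherel's theorem\<close>

text \<open>The function f may change sign, so f + g = h cannot be integrated termwise in
  \<open>ennreal\<close>. Nonnegativity of the total integral of f is enough to state the result
  there without a subtraction.\<close>

lemma integrable_nn_integral_split:
  fixes f g h :: "'a \<Rightarrow> real"
  assumes "integrable M f" "integrable M h" "\<And>x. f x + g x = h x" "\<And>x. 0 \<le> g x" "\<And>x. 0 \<le> h x" "0 \<le> integral\<^sup>L M f"
  shows "ennreal (integral\<^sup>L M f) + (\<integral>\<^sup>+x. ennreal (g x) \<partial>M) = (\<integral>\<^sup>+x. ennreal (h x) \<partial>M)"
proof -
  have g: "g = (\<lambda>x. h x - f x)" using assms(3) by (auto simp: fun_eq_iff algebra_simps)
  have int: "integrable M g" unfolding g using assms by auto
  have "integral\<^sup>L M f + integral\<^sup>L M g = integral\<^sup>L M h"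
    using assms int by (simp flip: Bochner_Integration.integral_add)
  moreover have "0 \<le> integral\<^sup>L M g" using assms by (intro Bochner_Integration.integral_nonneg) auto
  ultimately show ?thesis
    using assms int by (simp add: nn_integral_eq_integral flip: ennreal_plus)
qed

lemma gauss_ft_le:
  assumes "0 < \<eta>"
  shows "gauss_ft \<eta> (u :: 'v::euclidean_space) \<le> (sqrt (2 * pi) / \<eta>) ^ DIM('v)"
  using assms by (auto simp: gauss_ft_def intro!: mult_left_le)

lemma gauss_ft_diff_commute: "gauss_ft \<eta> (s - s') = gauss_ft \<eta> (s' - s)"
  using gauss_ft_uminus[of \<eta> "s - s'"] by (simp del: gauss_ft_uminus)

text \<open>Rescaling s = s' + \<eta> v turns the error into an average of D(\<eta> v) against the
  fixed kernel \<open>gauss_ft 1\<close>. Since D is bounded by four times the square integral and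
  D(\<eta> v) tends to 0 by continuity of translation, dominated convergence applies.\<close>

lemma plancherel_translate_error:
  fixes b :: "'v::euclidean_space \<Rightarrow> 'b::{real_inner,banach,second_countable_topology}"
  assumes [measurable]: "b \<in> borel_measurable borel"
    and fin: "(\<integral>\<^sup>+s. ennreal ((norm (b s))\<^sup>2) \<partial>lborel) < \<infinity>"
  shows "(\<lambda>n. \<integral>\<^sup>+s'. \<integral>\<^sup>+s. ennreal ((norm (b s - b s'))\<^sup>2 * gauss_ft (1 / real (Suc n)) (s - s')) \<partial>lborel \<partial>lborel) \<longlonglongrightarrow> 0"
proof -
  define D where "D v = (\<integral>\<^sup>+s. ennreal ((norm (b (s + v) - b s))\<^sup>2) \<partial>lborel)" for v
  have [measurable]: "D \<in> borel_measurable borel"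
    unfolding D_def by measurable
  let ?S = "\<integral>\<^sup>+s. ennreal ((norm (b s))\<^sup>2) \<partial>lborel"
  have Dle: "D v \<le> 4 * ?S" for v
  proof -
    have "D v \<le> (\<integral>\<^sup>+s. 2 * ennreal ((norm (b (s + v)))\<^sup>2) + 2 * ennreal ((norm (b s))\<^sup>2) \<partial>lborel)"
      unfolding D_def
    proof (rule nn_integral_mono)
      fix s
      have "(norm (b (s + v) - b s))\<^sup>2 \<le> (norm (b (s + v)) + norm (b s))\<^sup>2"
        by (intro power_mono norm_triangle_ineq4) simp
      also have "\<dots> \<le> 2 * (norm (b (s + v)))\<^sup>2 + 2 * (norm (b s))\<^sup>2"
        using sum_squares_bound[of "norm (b (s + v))" "norm (b s)"] by (simp add: power2_sum)
      finally show "ennreal ((norm (b (s + v) - b s))\<^sup>2) \<le> 2 * ennreal ((norm (b (s + v)))\<^sup>2) + 2 * ennreal ((norm (b s))\<^sup>2)"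
        by (simp flip: ennreal_plus ennreal_mult' ennreal_numeral add: ennreal_leI del: ennreal_numeral)
    qed
    also have "\<dots> = 2 * ?S + 2 * ?S"
      using nn_integral_lborel_translate[of "\<lambda>s. ennreal ((norm (b s))\<^sup>2)" v]
      by (simp add: nn_integral_add nn_integral_cmult)
    also have "\<dots> = 4 * ?S" by (simp flip: distrib_right)
    finally show ?thesis .
  qed
  have eq: "(\<integral>\<^sup>+s'. \<integral>\<^sup>+s. ennreal ((norm (b s - b s'))\<^sup>2 * gauss_ft \<eta> (s - s')) \<partial>lborel \<partial>lborel) =
    (\<integral>\<^sup>+v. ennreal (gauss_ft 1 v) * D (\<eta> *\<^sub>R v) \<partial>lborel)" if "0 < \<eta>" for \<eta>
  proof -
    have "(\<integral>\<^sup>+s. ennreal ((norm (b s - b s'))\<^sup>2 * gauss_ft \<eta> (s - s')) \<partial>lborel) =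
      (\<integral>\<^sup>+v. ennreal ((norm (b (s' + \<eta> *\<^sub>R v) - b s'))\<^sup>2) * ennreal (gauss_ft 1 v) \<partial>lborel)" for s'
    proof -
      let ?F = "\<lambda>s. ennreal ((norm (b s - b s'))\<^sup>2 * gauss_ft \<eta> (s - s'))"
      have G: "gauss_ft \<eta> (\<eta> *\<^sub>R v) = (1 / \<eta> ^ DIM('v)) * gauss_ft 1 v" for v :: 'v
        using that by (simp add: gauss_ft_def power_mult_distrib power_divide)
      have "(\<integral>\<^sup>+v. ennreal ((norm (b (s' + \<eta> *\<^sub>R v) - b s'))\<^sup>2) * ennreal (gauss_ft 1 v) \<partial>lborel)
        = (\<integral>\<^sup>+v. ennreal (\<eta> ^ DIM('v)) * ?F (s' + \<eta> *\<^sub>R v) \<partial>lborel)"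
        using that by (intro nn_integral_cong) (auto simp: G gauss_ft_nonneg simp flip: ennreal_mult)
      also have "\<dots> = ennreal (\<eta> ^ DIM('v)) * (\<integral>\<^sup>+v. ?F (s' + \<eta> *\<^sub>R v) \<partial>lborel)"
        by (rule nn_integral_cmult) measurable
      also have "\<dots> = (\<integral>\<^sup>+s. ?F s \<partial>lborel)"
        using that by (subst nn_integral_lborel_affine) (auto simp: mult.assoc[symmetric] simp flip: ennreal_mult)
      finally show ?thesis ..
    qed
    then have "(\<integral>\<^sup>+s'. \<integral>\<^sup>+s. ennreal ((norm (b s - b s'))\<^sup>2 * gauss_ft \<eta> (s - s')) \<partial>lborel \<partial>lborel) =
      (\<integral>\<^sup>+s'. \<integral>\<^sup>+v. ennreal ((norm (b (s' + \<eta> *\<^sub>R v) - b s'))\<^sup>2) * ennreal (gauss_ft 1 v) \<partial>lborel \<partial>lborel)"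
      by simp
    also have "\<dots> = (\<integral>\<^sup>+v. \<integral>\<^sup>+s'. ennreal ((norm (b (s' + \<eta> *\<^sub>R v) - b s'))\<^sup>2) * ennreal (gauss_ft 1 v) \<partial>lborel \<partial>lborel)"
      by (rule nn_integral_lborel_pair(2)) measurable
    also have "\<dots> = (\<integral>\<^sup>+v. ennreal (gauss_ft 1 v) * D (\<eta> *\<^sub>R v) \<partial>lborel)"
      unfolding D_def by (simp add: nn_integral_multc) (simp add: mult.commute)
    finally show ?thesis .
  qed
  have "(\<lambda>n. \<integral>\<^sup>+v. ennreal (gauss_ft 1 v) * D ((1 / real (Suc n)) *\<^sub>R v) \<partial>lborel) \<longlonglongrightarrow> (\<integral>\<^sup>+(v::'v). 0 \<partial>lborel)"
  proof (rule nn_integral_dominated_convergence[where w="\<lambda>v. ennreal (gauss_ft 1 v) * (4 * ?S)"])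
    show "AE v in lborel. ennreal (gauss_ft 1 v) * D ((1 / real (Suc n)) *\<^sub>R v) \<le> ennreal (gauss_ft 1 v) * (4 * ?S)" for n
      by (intro AE_I2 mult_left_mono Dle) simp
    show "(\<integral>\<^sup>+v. ennreal (gauss_ft 1 (v::'v)) * (4 * ?S) \<partial>lborel) < \<infinity>"
      using fin by (subst nn_integral_multc) (auto simp: nn_integral_gauss_ft ennreal_mult_less_top)
    show "AE v in lborel. (\<lambda>n. ennreal (gauss_ft 1 v) * D ((1 / real (Suc n)) *\<^sub>R v)) \<longlonglongrightarrow> 0"
    proof (intro AE_I2)
      fix v :: 'v
      have "(\<lambda>n. (1 / real (Suc n)) *\<^sub>R v) \<longlonglongrightarrow> 0 *\<^sub>R v"
        by (intro tendsto_intros LIMSEQ_Suc[OF lim_1_over_n])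
      then have "(\<lambda>n. D ((1 / real (Suc n)) *\<^sub>R v)) \<longlonglongrightarrow> 0"
        unfolding D_def by (intro L2_translate_tendsto fin) auto
      then have "(\<lambda>n. ennreal (gauss_ft 1 v) * D ((1 / real (Suc n)) *\<^sub>R v)) \<longlonglongrightarrow> ennreal (gauss_ft 1 v) * 0"
        by (intro ennreal_tendsto_cmult) auto
      then show "(\<lambda>n. ennreal (gauss_ft 1 v) * D ((1 / real (Suc n)) *\<^sub>R v)) \<longlonglongrightarrow> 0" by simp
    qed
  qed measurable
  then show ?thesis by (subst eq) auto
qed

text \<open>The weighted integral of N equals the integral of c against
  \<open>gauss_ft \<eta>\<close> at s - s'. Both N and the kernel are real, so only Re c matters,
  and polarisation writes 2 b(s) \<bullet> b(s') as |b(s)|^2 + |b(s')|^2 - |b(s) - b(s')|^2. The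
  first two terms are computed exactly for every \<eta>; the last one is the translation error and
  vanishes in the limit. No Fourier inversion enters.\<close>

lemma plancherel_autocorr:
  fixes b :: "'v::euclidean_space \<Rightarrow> 'b::{real_inner,banach,second_countable_topology}"
  assumes [measurable]: "b \<in> borel_measurable borel"
    and autocorr: "autocorr_rep A N c"
    and re: "\<And>z. Re (c z) = b (fst z) \<bullet> b (snd z)"
    and fin: "(\<integral>\<^sup>+s. ennreal ((norm (b s))\<^sup>2) \<partial>lborel) < \<infinity>"
  shows "(\<integral>\<^sup>+w. ennreal (N w) \<partial>lborel) = ennreal ((2 * pi) ^ DIM('v)) * (\<integral>\<^sup>+s. ennreal ((norm (b s))\<^sup>2) \<partial>lborel)"
proof -
  note [measurable] = borel_measurable_fst_snd
  let ?S = "\<integral>\<^sup>+s. ennreal ((norm (b s))\<^sup>2) \<partial>lborel"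
  let ?P = "ennreal ((2 * pi) ^ DIM('v))"
  let ?E = "\<lambda>\<eta>. \<integral>\<^sup>+s'. \<integral>\<^sup>+s. ennreal ((norm (b s - b s'))\<^sup>2 * gauss_ft \<eta> (s - s')) \<partial>lborel \<partial>lborel"
  have corr': "autocorr A N" using autocorr by (auto simp: autocorr_def)
  note cb = autocorr_bounds[OF corr']
  have [measurable]: "N \<in> borel_measurable borel" "c \<in> borel_measurable borel"
    using cb autocorr by (auto simp: autocorr_rep_def)
  have N0: "0 \<le> N w" for w using autocorr by (auto simp: autocorr_rep_def)
  obtain B where B: "\<And>w. \<bar>N w\<bar> \<le> B" using cb by auto
  have key: "2 * (\<integral>\<^sup>+w. ennreal (N w * gauss \<eta> w) \<partial>lborel) + ?E \<eta> = 2 * (?P * ?S)" if \<eta>: "0 < \<eta>" for \<eta>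
  proof -
    let ?G = "\<lambda>z. gauss_ft \<eta> (fst z - snd z :: 'v)"
    have cint: "integrable lborel c"
      by (rule autocorr_rep_fourier(1)[OF \<eta> autocorr, of "\<lambda>_. 1" 1]) auto
    have "(\<integral>w. complex_of_real ((N w * 1) * gauss \<eta> w) * cis (- (w \<bullet> 0)) \<partial>lborel) =
      (\<integral>z. c z * (\<integral>w. complex_of_real (1 * gauss \<eta> w) * cis (- (w \<bullet> (0 + fst z - snd z))) \<partial>lborel) \<partial>lborel)"
      by (rule autocorr_rep_fourier(2)[OF \<eta> autocorr]) auto
    then have eq1: "complex_of_real (\<integral>w. N w * gauss \<eta> w \<partial>lborel) = (\<integral>z. c z * complex_of_real (?G z) \<partial>lborel)"
      by (simp add: gauss_fourier[OF \<eta>] del: of_real_mult)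
    have G: "0 \<le> ?G z" "?G z \<le> (sqrt (2 * pi) / \<eta>) ^ DIM('v)" for z
      using gauss_ft_nonneg[OF \<eta>] gauss_ft_le[OF \<eta>] by auto
    have cG: "integrable lborel (\<lambda>z. c z * complex_of_real (?G z))"
    proof (rule Bochner_Integration.integrable_bound)
      show "integrable lborel (\<lambda>z. norm (c z) * (sqrt (2 * pi) / \<eta>) ^ DIM('v))"
        using cint by (intro integrable_mult_left integrable_norm)
      show "AE z in lborel. norm (c z * complex_of_real (?G z)) \<le> norm (norm (c z) * (sqrt (2 * pi) / \<eta>) ^ DIM('v))"
        using G \<eta> by (intro AE_I2) (auto simp: norm_mult intro!: mult_left_mono)
    qed measurable
    let ?f = "\<lambda>z. 2 * ((b (fst z) \<bullet> b (snd z)) * ?G z)"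
    let ?g = "\<lambda>z. (norm (b (fst z) - b (snd z)))\<^sup>2 * ?G z"
    let ?h = "\<lambda>z. (norm (b (fst z)))\<^sup>2 * ?G z + (norm (b (snd z)))\<^sup>2 * ?G z"
    have f_eq: "?f z = 2 * Re (c z * complex_of_real (?G z))" for z
      by (simp add: re)
    have fint: "integrable lborel ?f"
      unfolding f_eq by (intro integrable_mult_right integrable_Re cG)
    have fval: "integral\<^sup>L lborel ?f = 2 * (\<integral>w. N w * gauss \<eta> w \<partial>lborel)"
      unfolding f_eq integral_mult_right_zero integral_Re[OF cG] eq1[symmetric] by simp
    have I: "(\<integral>\<^sup>+z. ennreal ((norm (b (fst z)))\<^sup>2 * ?G z) \<partial>lborel) = ?P * ?S"
    proof -
      have "(\<integral>\<^sup>+z. ennreal ((norm (b (fst z)))\<^sup>2 * ?G z) \<partial>lborel) = (\<integral>\<^sup>+s. \<integral>\<^sup>+s'. ennreal ((norm (b s))\<^sup>2) * ennreal (gauss_ft \<eta> (s - s')) \<partial>lborel \<partial>lborel)"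
        using G by (subst nn_integral_lborel_pair(1)) (auto simp: ennreal_mult)
      also have "\<dots> = (\<integral>\<^sup>+s. ennreal ((norm (b s))\<^sup>2) * ?P \<partial>lborel)"
      proof (rule nn_integral_cong)
        fix s :: 'v
        have "(\<integral>\<^sup>+s'. ennreal (gauss_ft \<eta> (s - s')) \<partial>lborel) = ?P"
          using nn_integral_lborel_affine[of "\<lambda>s'. ennreal (gauss_ft \<eta> s')" "-1" s] by (simp add: nn_integral_gauss_ft[OF \<eta>])
        then show "(\<integral>\<^sup>+s'. ennreal ((norm (b s))\<^sup>2) * ennreal (gauss_ft \<eta> (s - s')) \<partial>lborel) = ennreal ((norm (b s))\<^sup>2) * ?P"
          by (simp add: nn_integral_cmult)
      qed
      finally show ?thesis by (simp add: nn_integral_multc mult.commute)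
    qed
    have I': "(\<integral>\<^sup>+z. ennreal ((norm (b (snd z)))\<^sup>2 * ?G z) \<partial>lborel) = ?P * ?S"
    proof -
      have "(\<integral>\<^sup>+z. ennreal ((norm (b (snd z)))\<^sup>2 * ?G z) \<partial>lborel) = (\<integral>\<^sup>+s. \<integral>\<^sup>+s'. ennreal ((norm (b s'))\<^sup>2 * gauss_ft \<eta> (s - s')) \<partial>lborel \<partial>lborel)"
        by (subst nn_integral_lborel_pair(1)) auto
      also have "\<dots> = (\<integral>\<^sup>+s'. \<integral>\<^sup>+s. ennreal ((norm (b s'))\<^sup>2 * gauss_ft \<eta> (s - s')) \<partial>lborel \<partial>lborel)"
        by (rule nn_integral_lborel_pair(2)) measurable
      also have "\<dots> = (\<integral>\<^sup>+s'. \<integral>\<^sup>+s. ennreal ((norm (b s'))\<^sup>2 * gauss_ft \<eta> (s' - s)) \<partial>lborel \<partial>lborel)"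
        by (intro nn_integral_cong) (simp only: gauss_ft_diff_commute)
      also have "\<dots> = (\<integral>\<^sup>+z. ennreal ((norm (b (fst z)))\<^sup>2 * ?G z) \<partial>lborel)"
        by (subst nn_integral_lborel_pair(1)) auto
      finally show ?thesis using I by simp
    qed
    have h: "(\<integral>\<^sup>+z. ennreal (?h z) \<partial>lborel) = 2 * (?P * ?S)"
    proof -
      have "(\<integral>\<^sup>+z. ennreal (?h z) \<partial>lborel) =
        (\<integral>\<^sup>+z. ennreal ((norm (b (fst z)))\<^sup>2 * ?G z) + ennreal ((norm (b (snd z)))\<^sup>2 * ?G z) \<partial>lborel)"
        by (intro nn_integral_cong ennreal_plus mult_nonneg_nonneg G) auto
      also have "\<dots> = ?P * ?S + ?P * ?S"
        by (subst nn_integral_add) (simp_all only: I I', measurable)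
      finally show ?thesis by (simp only: mult_2)
    qed
    have hint: "integrable lborel ?h"
      using G h fin by (intro integrableI_nonneg) (auto simp: ennreal_mult_less_top)
    have Npos: "0 \<le> (\<integral>w. N w * gauss \<eta> w \<partial>lborel)"
      by (intro Bochner_Integration.integral_nonneg) (auto simp: N0 less_imp_le[OF gauss_pos])
    have "ennreal (integral\<^sup>L lborel ?f) + (\<integral>\<^sup>+z. ennreal (?g z) \<partial>lborel) = (\<integral>\<^sup>+z. ennreal (?h z) \<partial>lborel)"
    proof (rule integrable_nn_integral_split[OF fint hint])
      show "?f z + ?g z = ?h z" for z
      proof -
        have sq: "(norm (x - y))\<^sup>2 = (norm x)\<^sup>2 + (norm y)\<^sup>2 - 2 * (x \<bullet> y)" for x y :: 'b
          by (simp add: power2_norm_eq_inner inner_diff_left inner_diff_right inner_commute[of y x])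
        show ?thesis unfolding sq[of "b (fst z)" "b (snd z)"] by algebra
      qed
    qed (use G Npos fval in auto)
    moreover have "integrable lborel (\<lambda>w. N w * gauss \<eta> w)"
    proof (rule Bochner_Integration.integrable_bound)
      show "integrable lborel (\<lambda>w::'v. B * gauss \<eta> w)"
        by (intro integrable_mult_right gauss_integrable[OF \<eta>])
      show "AE w in lborel. norm (N w * gauss \<eta> w) \<le> norm (B * gauss \<eta> w)"
        using B by (auto simp: abs_mult intro!: mult_right_mono AE_I2) (meson abs_ge_self order_trans)
    qed measurable
    then have "ennreal (integral\<^sup>L lborel ?f) = 2 * (\<integral>\<^sup>+w. ennreal (N w * gauss \<eta> w) \<partial>lborel)"
      unfolding fval by (subst nn_integral_eq_integral) (auto simp: N0 less_imp_le[OF gauss_pos] ennreal_mult')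
    moreover have "(\<integral>\<^sup>+z. ennreal (?g z) \<partial>lborel) = ?E \<eta>"
    proof -
      have "(\<integral>\<^sup>+z. ennreal (?g z) \<partial>lborel) = (\<integral>\<^sup>+s. \<integral>\<^sup>+s'. ennreal ((norm (b s - b s'))\<^sup>2 * gauss_ft \<eta> (s - s')) \<partial>lborel \<partial>lborel)"
        by (subst nn_integral_lborel_pair(1)) auto
      also have "\<dots> = ?E \<eta>"
        by (rule nn_integral_lborel_pair(2)) measurable
      finally show ?thesis .
    qed
    ultimately show ?thesis using h by simp
  qed
  have N_SUP: "(\<integral>\<^sup>+w. ennreal (N w) \<partial>lborel) = (SUP n. \<integral>\<^sup>+w. ennreal (N w * gauss (1 / real (Suc n)) w) \<partial>lborel)"
    and N_inc: "incseq (\<lambda>n. \<integral>\<^sup>+w. ennreal (N w * gauss (1 / real (Suc n)) w) \<partial>lborel)"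
  proof -
    have inc: "incseq (\<lambda>n w. ennreal (N w * gauss (1 / real (Suc n)) w))"
      using gauss_incseq N0 by (auto simp: incseq_def le_fun_def intro!: ennreal_leI mult_left_mono)
    have "(SUP n. ennreal (N w * gauss (1 / real (Suc n)) w)) = ennreal (N w)" for w
    proof -
      have "(SUP n. ennreal (N w * gauss (1 / real (Suc n)) w)) = (SUP n. ennreal (N w) * ennreal (gauss (1 / real (Suc n)) w))"
        by (simp add: ennreal_mult N0 less_imp_le[OF gauss_pos])
      also have "\<dots> = ennreal (N w) * (SUP n. ennreal (gauss (1 / real (Suc n)) w))"
        by (rule SUP_mult_left_ennreal[symmetric])
      also have "\<dots> = ennreal (N w)"
        by (simp only: gauss_SUP mult_1_right)
      finally show ?thesis .
    qed
    then show "(\<integral>\<^sup>+w. ennreal (N w) \<partial>lborel) = (SUP n. \<integral>\<^sup>+w. ennreal (N w * gauss (1 / real (Suc n)) w) \<partial>lborel)"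
      by (subst nn_integral_monotone_convergence_SUP[OF inc, symmetric]) auto
    show "incseq (\<lambda>n. \<integral>\<^sup>+w. ennreal (N w * gauss (1 / real (Suc n)) w) \<partial>lborel)"
      using inc by (auto simp: incseq_def le_fun_def intro!: nn_integral_mono)
  qed
  have "(\<lambda>n. 2 * (\<integral>\<^sup>+w. ennreal (N w * gauss (1 / real (Suc n)) w) \<partial>lborel) + ?E (1 / real (Suc n)))
    \<longlonglongrightarrow> 2 * (\<integral>\<^sup>+w. ennreal (N w) \<partial>lborel) + 0"
    unfolding N_SUP
    by (intro tendsto_add ennreal_tendsto_cmult LIMSEQ_SUP N_inc plancherel_translate_error fin) auto
  then have "(\<lambda>n::nat. 2 * (?P * ?S)) \<longlonglongrightarrow> 2 * (\<integral>\<^sup>+w. ennreal (N w) \<partial>lborel) + 0"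
    by (subst (asm) key) auto
  then have "2 * (?P * ?S) = 2 * (\<integral>\<^sup>+w. ennreal (N w) \<partial>lborel) + 0"
    by (intro LIMSEQ_unique[OF tendsto_const])
  then show ?thesis
    by (simp add: ennreal_mult_cancel_left)
qed


section \<open>One-sided quaternion Fourier transforms\<close>

text \<open>As u squares to -1, sending z to Re z + (Im z) u is a bounded algebra homomorphism from
  the complex numbers. It commutes with the exponential series and transports Euler's
  formula.\<close>

lemma exp_scaleR_imaginary_unit:
  fixes u :: "'a::{real_normed_algebra_1,banach}"
  assumes u: "u * u = - 1"
  shows "exp (\<theta> *\<^sub>R u) = cos \<theta> *\<^sub>R 1 + sin \<theta> *\<^sub>R u"
proof -
  define h where "h z = Re z *\<^sub>R 1 + Im z *\<^sub>R u" for z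
  have bl: "bounded_linear h"
    unfolding h_def by (intro bounded_linear_add bounded_linear_scaleR_const bounded_linear_Re bounded_linear_Im)
  have mult: "h (x * y) = h x * h y" for x y
    by (simp add: h_def algebra_simps u)
  have pow: "h (z ^ n) = h z ^ n" for z n
    by (induction n) (simp_all add: mult, simp add: h_def)
  have "h (exp z) = exp (h z)" for z
  proof -
    have "h (exp z) = (\<Sum>n. h (z ^ n /\<^sub>R fact n))"
      unfolding exp_def by (rule bounded_linear.suminf[OF bl summable_exp_generic])
    also have "\<dots> = exp (h z)"
      unfolding exp_def by (simp add: linear_scale[OF bounded_linear.linear[OF bl]] pow)
    finally show ?thesis .
  qed
  from this[of "\<i> * complex_of_real \<theta>"] show ?thesis
    by (simp add: h_def flip: cis_conv_exp)
qed

definition ei :: "real \<Rightarrow> quat" where "ei \<theta> = Quat (cos \<theta>) (- sin \<theta>) 0 0"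
definition ej :: "real \<Rightarrow> quat" where "ej \<theta> = Quat (cos \<theta>) 0 (- sin \<theta>) 0"

lemma exp_quat_i: "exp (- (\<theta> *\<^sub>R quat_i)) = ei \<theta>"
  using exp_scaleR_imaginary_unit[of quat_i "- \<theta>"]
  by (simp add: quat_units ei_def quat_eq_iff) (simp add: quat_i_def)

lemma exp_quat_j: "exp (- (\<theta> *\<^sub>R quat_j)) = ej \<theta>"
  using exp_scaleR_imaginary_unit[of quat_j "- \<theta>"]
  by (simp add: quat_units ej_def quat_eq_iff) (simp add: quat_j_def)

lemma norm_ei [simp]: "norm (ei \<theta>) = 1" and norm_ej [simp]: "norm (ej \<theta>) = 1"
  by (simp_all add: ei_def ej_def norm_quat_eq)

lemma norm_quat_cnj [simp]: "norm (quat_cnj q) = norm q"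
  by (simp add: quat_cnj_def norm_quat_eq)

lemma bounded_linear_quat_sel: "bounded_linear qRe" "bounded_linear qI" "bounded_linear qJ" "bounded_linear qK"
proof -
  have "\<bar>qRe x\<bar> \<le> norm x" "\<bar>qI x\<bar> \<le> norm x" "\<bar>qJ x\<bar> \<le> norm x" "\<bar>qK x\<bar> \<le> norm x" for x
    unfolding norm_quat_eq by (rule real_le_rsqrt, simp)+
  then show "bounded_linear qRe" "bounded_linear qI" "bounded_linear qJ" "bounded_linear qK"
    by (auto intro!: bounded_linear_intro[where K=1])
qed

lemma quat_cnj_conv: "quat_cnj q = qRe q *\<^sub>R 1 - qI q *\<^sub>R quat_i - qJ q *\<^sub>R quat_j - qK q *\<^sub>R quat_k"
  by (simp add: quat_eq_iff quat_cnj_def quat_i_def quat_j_def quat_k_def)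

lemma bounded_linear_quat_cnj: "bounded_linear quat_cnj"
  unfolding quat_cnj_conv[abs_def]
  by (intro bounded_linear_sub bounded_linear_scaleR_const bounded_linear_quat_sel)

text \<open>Orthogonal projections onto the planes of 1, i and of 1, j, each identified with the
  complex numbers; in \<open>cj\<close> the quaternion j becomes the complex imaginary unit.\<close>

definition ci :: "quat \<Rightarrow> complex" where "ci q = Complex (qRe q) (qI q)"
definition cj :: "quat \<Rightarrow> complex" where "cj q = Complex (qRe q) (qJ q)"

lemma cmod_ci_le: "cmod (ci q) \<le> norm q" and cmod_cj_le: "cmod (cj q) \<le> norm q"
  unfolding ci_def cj_def complex_norm norm_quat_eq by (rule real_sqrt_le_mono, simp)+

lemma bounded_linear_ci: "bounded_linear ci" and bounded_linear_cj: "bounded_linear cj"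
  by (auto intro!: bounded_linear_intro[where K=1] simp: cmod_ci_le cmod_cj_le)
    (simp_all add: ci_def cj_def complex_eq_iff)

lemma quat_measurable [measurable]:
  "ei \<in> borel_measurable borel" "ej \<in> borel_measurable borel"
  "quat_cnj \<in> borel_measurable borel" "ci \<in> borel_measurable borel" "cj \<in> borel_measurable borel"
proof -
  have eqs: "ei = (\<lambda>\<theta>. cos \<theta> *\<^sub>R 1 - sin \<theta> *\<^sub>R quat_i)" "ej = (\<lambda>\<theta>. cos \<theta> *\<^sub>R 1 - sin \<theta> *\<^sub>R quat_j)"
    by (auto simp: fun_eq_iff ei_def ej_def quat_eq_iff quat_i_def quat_j_def)
  show "ei \<in> borel_measurable borel" "ej \<in> borel_measurable borel"
    unfolding eqs by (auto intro!: borel_measurable_continuous_onI continuous_intros)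
  show "quat_cnj \<in> borel_measurable borel" "ci \<in> borel_measurable borel" "cj \<in> borel_measurable borel"
    by (auto intro!: borel_measurable_continuous_onI linear_continuous_on bounded_linear_quat_cnj bounded_linear_ci bounded_linear_cj)
qed

text \<open>Multiplication by the plane of 1 and i, from either side, maps the span of j and k to
  itself, so the projection is linear over this plane on both sides. The two exponentials stand at
  the ends of the product, leave the projection there, and combine in the commutative plane; the
  factors between them are never commuted.\<close>

lemma ci_conj: "ci ((ei a * p) * quat_cnj (ei b * q)) = cis (- (a - b)) * ci (p * quat_cnj q)"
proof -
  have c: "cis (- (a - b)) = Complex (cos a * cos b + sin a * sin b) (cos a * sin b - sin a * cos b)"
    by (simp add: complex_eq_iff cos_diff sin_diff)
  show ?thesis
    unfolding c ci_def quat_cnj_def ei_def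
    by (simp only: complex_eq_iff complex.sel times_complex.sel quat_mult_sel quat.sel) (intro conjI; algebra)
qed

text \<open>The exponentials now stand to the right of p and q, so the conjugated factor has to come
  first for them to be at the two ends.\<close>

lemma cj_conj: "cj (quat_cnj (q * ej b) * (p * ej a)) = cis (- (a - b)) * cj (quat_cnj q * p)"
proof -
  have c: "cis (- (a - b)) = Complex (cos a * cos b + sin a * sin b) (cos a * sin b - sin a * cos b)"
    by (simp add: complex_eq_iff cos_diff sin_diff)
  show ?thesis
    unfolding c cj_def quat_cnj_def ej_def
    by (simp only: complex_eq_iff complex.sel times_complex.sel quat_mult_sel quat.sel) (intro conjI; algebra)
qed

lemma ci_norm: "ci (q * quat_cnj q) = complex_of_real ((norm q)\<^sup>2)"
  and cj_norm: "cj (quat_cnj q * q) = complex_of_real ((norm q)\<^sup>2)"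
  by (simp_all add: ci_def cj_def complex_eq_iff quat_cnj_def norm_quat_eq power2_eq_square algebra_simps)

lemma Re_ci: "Re (ci (p * quat_cnj q)) = p \<bullet> q"
  and Re_cj: "Re (cj (quat_cnj q * p)) = p \<bullet> q"
  by (simp_all add: ci_def cj_def quat_cnj_def inner_quat_def algebra_simps)

text \<open>Used to write a squared modulus, a projected product of two quaternion-valued integrals,
  as one integral over pairs of points.\<close>

lemma integral_bilinear_pair:
  fixes h :: "'a::{banach,second_countable_topology} \<Rightarrow> 'b::{banach,second_countable_topology} \<Rightarrow> 'c::{banach,second_countable_topology}"
    and F :: "'v::euclidean_space \<Rightarrow> 'a" and G :: "'w::euclidean_space \<Rightarrow> 'b"
  assumes h: "bounded_bilinear h" and F: "integrable lborel F" and G: "integrable lborel G"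
    and [measurable]: "(\<lambda>(x, y). h x y) \<in> borel_measurable (borel \<Otimes>\<^sub>M borel)"
  shows "(\<integral>z. h (F (fst z)) (G (snd z)) \<partial>lborel) = h (integral\<^sup>L lborel F) (integral\<^sup>L lborel G)"
proof -
  have [measurable]: "F \<in> borel_measurable borel" "G \<in> borel_measurable borel"
    using F G by auto
  obtain K where K: "\<And>a b. norm (h a b) \<le> norm a * norm b * K" and "0 \<le> K"
    using bounded_bilinear.nonneg_bounded[OF h] by blast
  have "(\<integral>z. h (F (fst z)) (G (snd z)) \<partial>(lborel \<Otimes>\<^sub>M lborel)) = (\<integral>s. \<integral>s'. h (F s) (G s') \<partial>lborel \<partial>lborel)"
  proof -
    have "integrable (lborel \<Otimes>\<^sub>M lborel) (\<lambda>z. h (F (fst z)) (G (snd z)))"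
    proof (rule integrableI_bounded)
      have "(\<integral>\<^sup>+z. norm (h (F (fst z)) (G (snd z))) \<partial>(lborel \<Otimes>\<^sub>M lborel)) \<le>
        (\<integral>\<^sup>+z. ennreal K * (ennreal (norm (F (fst z))) * ennreal (norm (G (snd z)))) \<partial>(lborel \<Otimes>\<^sub>M lborel))"
        using K \<open>0 \<le> K\<close> by (intro nn_integral_mono) (auto simp flip: ennreal_mult simp: mult_ac intro!: ennreal_leI)
      also have "\<dots> = ennreal K * (\<integral>\<^sup>+s. \<integral>\<^sup>+s'. ennreal (norm (F s)) * ennreal (norm (G s')) \<partial>lborel \<partial>lborel)"
        by (subst nn_integral_cmult, measurable) (subst lborel.nn_integral_fst[symmetric], auto)
      also have "\<dots> < \<infinity>"
        using F G by (simp add: nn_integral_cmult nn_integral_multc ennreal_mult_less_top integrable_iff_bounded)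
      finally show "(\<integral>\<^sup>+z. norm (h (F (fst z)) (G (snd z))) \<partial>(lborel \<Otimes>\<^sub>M lborel)) < \<infinity>" .
    qed measurable
    from lborel_pair.integral_fst'[OF this] show ?thesis by simp
  qed
  also have "\<dots> = (\<integral>s. h (F s) (integral\<^sup>L lborel G) \<partial>lborel)"
    by (intro Bochner_Integration.integral_cong refl integral_bounded_linear[OF bounded_bilinear.bounded_linear_right[OF h] G])
  also have "\<dots> = h (integral\<^sup>L lborel F) (integral\<^sup>L lborel G)"
    by (rule integral_bounded_linear[OF bounded_bilinear.bounded_linear_left[OF h] F])
  finally show ?thesis by (simp add: lborel_prod)
qed

text \<open>Taken with respect to Lebesgue measure without normalisation; the powers of 2 pi return
  together with \<open>mu\<close>.\<close>

definition left_fourier :: "('v::euclidean_space \<Rightarrow> quat) \<Rightarrow> 'v \<Rightarrow> quat" where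
  "left_fourier b w = (\<integral>s. ei (w \<bullet> s) * b s \<partial>lborel)"

definition right_fourier :: "('v::euclidean_space \<Rightarrow> quat) \<Rightarrow> 'v \<Rightarrow> quat" where
  "right_fourier b w = (\<integral>s. b s * ej (w \<bullet> s) \<partial>lborel)"

lemma autocorr_rep_left_fourier:
  fixes b :: "'v::euclidean_space \<Rightarrow> quat"
  assumes b: "integrable lborel b"
  shows "autocorr_rep (\<lambda>s. ennreal (norm (b s))) (\<lambda>w. (norm (left_fourier b w))\<^sup>2) (\<lambda>z. ci (b (fst z) * quat_cnj (b (snd z))))"
proof -
  note [measurable] = borel_measurable_fst_snd
  have [measurable]: "b \<in> borel_measurable borel" using b by auto
  have int: "integrable lborel (\<lambda>s. ei (w \<bullet> s) * b s)" for w
    by (rule Bochner_Integration.integrable_bound[OF b]) (auto simp: norm_quat_mult)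
  have bil: "bounded_bilinear (\<lambda>p q. ci (p * quat_cnj q))"
    by (rule bounded_bilinear.intro; simp add: algebra_simps linear_simps[OF bounded_linear_quat_cnj] linear_simps[OF bounded_linear_ci];
       intro exI[of _ 1] allI order_trans[OF cmod_ci_le]; simp add: norm_quat_mult)
  show ?thesis
    unfolding autocorr_rep_def
  proof (intro conjI allI)
    show "(\<integral>\<^sup>+s. ennreal (norm (b s)) \<partial>lborel) < \<infinity>"
      using b by (simp add: integrable_iff_bounded)
    show "ennreal (cmod (ci (b (fst z) * quat_cnj (b (snd z))))) \<le> ennreal (norm (b (fst z))) * ennreal (norm (b (snd z)))" for z
      using cmod_ci_le[of "b (fst z) * quat_cnj (b (snd z))"]
      by (simp add: norm_quat_mult ennreal_leI flip: ennreal_mult)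
    show "complex_of_real ((norm (left_fourier b w))\<^sup>2) = (\<integral>z. cis (- (w \<bullet> (fst z - snd z))) * ci (b (fst z) * quat_cnj (b (snd z))) \<partial>lborel)" for w
    proof -
      have "(\<integral>z. ci ((ei (w \<bullet> fst z) * b (fst z)) * quat_cnj (ei (w \<bullet> snd z) * b (snd z))) \<partial>lborel)
        = ci (left_fourier b w * quat_cnj (left_fourier b w))"
        unfolding left_fourier_def by (rule integral_bilinear_pair[OF bil int int]) measurable
      then show ?thesis
        unfolding ci_conj ci_norm by (simp add: inner_diff_right)
    qed
  qed auto
qed

lemma autocorr_rep_right_fourier:
  fixes b :: "'v::euclidean_space \<Rightarrow> quat"
  assumes b: "integrable lborel b"
  shows "autocorr_rep (\<lambda>s. ennreal (norm (b s))) (\<lambda>w. (norm (right_fourier b w))\<^sup>2) (\<lambda>z. cj (quat_cnj (b (snd z)) * b (fst z)))"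
proof -
  note [measurable] = borel_measurable_fst_snd
  have [measurable]: "b \<in> borel_measurable borel" using b by auto
  have int: "integrable lborel (\<lambda>s. b s * ej (w \<bullet> s))" for w
    by (rule Bochner_Integration.integrable_bound[OF b]) (auto simp: norm_quat_mult)
  have bil: "bounded_bilinear (\<lambda>p q. cj (quat_cnj q * p))"
    by (rule bounded_bilinear.intro; simp add: algebra_simps linear_simps[OF bounded_linear_quat_cnj] linear_simps[OF bounded_linear_cj];
       intro exI[of _ 1] allI order_trans[OF cmod_cj_le]; simp add: norm_quat_mult)
  show ?thesis
    unfolding autocorr_rep_def
  proof (intro conjI allI)
    show "(\<integral>\<^sup>+s. ennreal (norm (b s)) \<partial>lborel) < \<infinity>"
      using b by (simp add: integrable_iff_bounded)
    show "ennreal (cmod (cj (quat_cnj (b (snd z)) * b (fst z)))) \<le> ennreal (norm (b (fst z))) * ennreal (norm (b (snd z)))" for z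
      using cmod_cj_le[of "quat_cnj (b (snd z)) * b (fst z)"]
      by (simp add: norm_quat_mult ennreal_leI mult.commute flip: ennreal_mult)
    show "complex_of_real ((norm (right_fourier b w))\<^sup>2) = (\<integral>z. cis (- (w \<bullet> (fst z - snd z))) * cj (quat_cnj (b (snd z)) * b (fst z)) \<partial>lborel)" for w
    proof -
      have "(\<integral>z. cj (quat_cnj (b (snd z) * ej (w \<bullet> snd z)) * (b (fst z) * ej (w \<bullet> fst z))) \<partial>lborel)
        = cj (quat_cnj (right_fourier b w) * right_fourier b w)"
        unfolding right_fourier_def by (rule integral_bilinear_pair[OF bil int int]) measurable
      then show ?thesis
        unfolding cj_conj cj_norm by (simp add: inner_diff_right)
    qed
  qed auto
qed

lemma plancherel_left_fourier:
  assumes "integrable lborel b" and "(\<integral>\<^sup>+s. ennreal ((norm (b s))\<^sup>2) \<partial>lborel) < \<infinity>"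
  shows "(\<integral>\<^sup>+w. ennreal ((norm (left_fourier b w))\<^sup>2) \<partial>lborel) =
    ennreal ((2 * pi) ^ DIM('v::euclidean_space)) * (\<integral>\<^sup>+s. ennreal ((norm (b (s::'v)))\<^sup>2) \<partial>lborel)"
  using assms by (intro plancherel_autocorr[OF _ autocorr_rep_left_fourier]) (auto simp: Re_ci)

lemma plancherel_right_fourier:
  assumes "integrable lborel b" and "(\<integral>\<^sup>+s. ennreal ((norm (b s))\<^sup>2) \<partial>lborel) < \<infinity>"
  shows "(\<integral>\<^sup>+w. ennreal ((norm (right_fourier b w))\<^sup>2) \<partial>lborel) =
    ennreal ((2 * pi) ^ DIM('v::euclidean_space)) * (\<integral>\<^sup>+s. ennreal ((norm (b (s::'v)))\<^sup>2) \<partial>lborel)"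
  using assms by (intro plancherel_autocorr[OF _ autocorr_rep_right_fourier]) (auto simp: Re_cj)


section \<open>The Lieb inequality for even exponents\<close>

definition square_integral :: "('v::euclidean_space \<Rightarrow> quat) \<Rightarrow> ennreal" where
  "square_integral a = (\<integral>\<^sup>+s. ennreal ((norm (a s))\<^sup>2) \<partial>lborel)"

definition sq_int :: "('v::euclidean_space \<Rightarrow> quat) \<Rightarrow> bool" where
  "sq_int a \<longleftrightarrow> a \<in> borel_measurable borel \<and> square_integral a < \<infinity>"

text \<open>Not a vector product: this is the function of s whose two-sided transform is the Wigner
  transform at x.\<close>

definition cross_product :: "('v::euclidean_space \<Rightarrow> quat) \<times> ('v \<Rightarrow> quat) \<Rightarrow> 'v \<Rightarrow> 'v \<Rightarrow> quat" where
  "cross_product p x s = fst p (x + s /\<^sub>R 2) * quat_cnj (snd p (x - s /\<^sub>R 2))"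

definition norm_pair :: "('v::euclidean_space \<Rightarrow> quat) \<times> ('v \<Rightarrow> quat) \<Rightarrow> ('v \<Rightarrow> ennreal) \<times> ('v \<Rightarrow> ennreal)" where
  "norm_pair p = ((\<lambda>u. ennreal (norm (fst p u))), (\<lambda>u. ennreal (norm (snd p u))))"

lemma norm_cross_product: "ennreal (norm (cross_product p x s)) = wprod (norm_pair p) x s"
  by (simp add: cross_product_def wprod_def norm_pair_def norm_quat_mult ennreal_mult)

lemma square_integral_norm: "(\<integral>\<^sup>+s. (ennreal (norm (a s)))\<^sup>2 \<partial>lborel) = square_integral a"
  by (simp add: square_integral_def ennreal_power)

lemma cross_product_integrable:
  fixes p :: "('v::euclidean_space \<Rightarrow> quat) \<times> ('v \<Rightarrow> quat)"
  assumes "sq_int (fst p)" "sq_int (snd p)"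
  shows "integrable lborel (cross_product p x)"
proof (rule integrableI_bounded)
  have [measurable]: "fst p \<in> borel_measurable borel" "snd p \<in> borel_measurable borel"
    using assms by (auto simp: sq_int_def)
  show "cross_product p x \<in> borel_measurable lborel"
    unfolding cross_product_def by measurable
  let ?u = "\<lambda>s. ennreal (norm (fst p (x + s /\<^sub>R 2)))" and ?v = "\<lambda>s. ennreal (norm (snd p (x - s /\<^sub>R 2)))"
  have u: "(\<integral>\<^sup>+s. (?u s)\<^sup>2 \<partial>lborel) < \<infinity>"
  proof -
    have "(\<integral>\<^sup>+s. (?u s)\<^sup>2 \<partial>lborel) = (\<integral>\<^sup>+s. (ennreal (norm (fst p (x + (1/2) *\<^sub>R s))))\<^sup>2 \<partial>lborel)" by simp
    also have "\<dots> = ennreal (1 / \<bar>1/2\<bar> ^ DIM('v)) * square_integral (fst p)"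
      unfolding square_integral_norm[symmetric] by (rule nn_integral_lborel_affine) auto
    finally show ?thesis using assms by (simp add: sq_int_def ennreal_mult_less_top)
  qed
  have v: "(\<integral>\<^sup>+s. (?v s)\<^sup>2 \<partial>lborel) < \<infinity>"
  proof -
    have "(\<integral>\<^sup>+s. (?v s)\<^sup>2 \<partial>lborel) = (\<integral>\<^sup>+s. (ennreal (norm (snd p (x + (- 1/2) *\<^sub>R s))))\<^sup>2 \<partial>lborel)" by simp
    also have "\<dots> = ennreal (1 / \<bar>- 1/2\<bar> ^ DIM('v)) * square_integral (snd p)"
      unfolding square_integral_norm[symmetric] by (rule nn_integral_lborel_affine) auto
    finally show ?thesis using assms by (simp add: sq_int_def ennreal_mult_less_top)
  qed
  have "(\<integral>\<^sup>+s. ennreal (norm (cross_product p x s)) \<partial>lborel)\<^sup>2 = (\<integral>\<^sup>+s. ?u s * ?v s \<partial>lborel)\<^sup>2"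
    by (simp add: norm_cross_product wprod_def norm_pair_def)
  also have "\<dots> \<le> (\<integral>\<^sup>+s. (?u s)\<^sup>2 \<partial>lborel) * (\<integral>\<^sup>+s. (?v s)\<^sup>2 \<partial>lborel)"
    by (rule Cauchy_Schwarz_nn_integral) auto
  also have "\<dots> < \<infinity>" using u v by (simp add: ennreal_mult_less_top)
  finally show "(\<integral>\<^sup>+s. ennreal (norm (cross_product p x s)) \<partial>lborel) < \<infinity>"
    by (simp add: power_less_top_ennreal)
qed

text \<open>The pairs in the list may differ, because the lemma is applied to slices of f and g at k
  different points. Each squared transform has the modulus of its kernel as autocorrelation bound,
  so the chain estimate and the separation of variables apply directly.\<close>

lemma right_fourier_multi:
  fixes ps :: "(('v::euclidean_space \<Rightarrow> quat) \<times> ('v \<Rightarrow> quat)) list"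
  assumes ps: "\<forall>p\<in>set ps. sq_int (fst p) \<and> sq_int (snd p)" and "ps \<noteq> []" and \<eta>: "0 < \<eta>"
  shows "(\<integral>\<^sup>+x. \<integral>\<^sup>+w. (\<Prod>p\<leftarrow>ps. ennreal ((norm (right_fourier (cross_product p x) w))\<^sup>2)) * ennreal (gauss \<eta> w) \<partial>lborel \<partial>lborel)
    \<le> (\<Prod>p\<leftarrow>ps. 4 ^ DIM('v) * square_integral (fst p) * square_integral (snd p)) * ennreal ((2 * pi) ^ DIM('v)) *
      ennreal (1 / (4 * real (length ps)) ^ DIM('v))"
proof -
  let ?G = "\<lambda>u::'v. ennreal (gauss_ft \<eta> u)"
  let ?L = "map norm_pair ps"
  have "(\<integral>\<^sup>+w. (\<Prod>p\<leftarrow>ps. ennreal ((norm (right_fourier (cross_product p x) w))\<^sup>2)) * ennreal (gauss \<eta> w) \<partial>lborel)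
    \<le> chain ?G (map wprod ?L) x 0" for x
  proof -
    have "list_all2 (\<lambda>A N. autocorr (A x) N) (map wprod ?L) (map (\<lambda>p w. (norm (right_fourier (cross_product p x) w))\<^sup>2) ps)"
      unfolding list_all2_map1 list_all2_map2 list.rel_refl_strong
    proof (rule list.rel_refl_strong)
      fix p assume "p \<in> set ps"
      then have "autocorr (\<lambda>s. ennreal (norm (cross_product p x s))) (\<lambda>w. (norm (right_fourier (cross_product p x) w))\<^sup>2)"
        using ps autocorr_rep_right_fourier[OF cross_product_integrable] unfolding autocorr_def by blast
      then show "autocorr (wprod (norm_pair p) x) (\<lambda>w. (norm (right_fourier (cross_product p x) w))\<^sup>2)"
        by (simp add: norm_cross_product eta_contract_eq)
    qed
    from nn_integral_autocorr_le_chain[OF \<eta> this] show ?thesis by (simp add: o_def)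
  qed
  then have "(\<integral>\<^sup>+x. \<integral>\<^sup>+w. (\<Prod>p\<leftarrow>ps. ennreal ((norm (right_fourier (cross_product p x) w))\<^sup>2)) * ennreal (gauss \<eta> w) \<partial>lborel \<partial>lborel)
    \<le> (\<integral>\<^sup>+x. chain ?G (map wprod ?L) x 0 \<partial>lborel)"
    by (intro nn_integral_mono) auto
  also have "\<dots> \<le> (\<Prod>q\<leftarrow>?L. 4 ^ DIM('v) * (\<integral>\<^sup>+y. (fst q y)\<^sup>2 \<partial>lborel) * (\<integral>\<^sup>+z. (snd q z)\<^sup>2 \<partial>lborel)) *
    (\<integral>\<^sup>+x. ?G x \<partial>lborel) * ennreal (1 / (4 * real (length ?L)) ^ DIM('v))"
    using ps \<open>ps \<noteq> []\<close> by (intro nn_integral_chain_wprod_le) (auto simp: borel_pair_def norm_pair_def sq_int_def)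
  finally show ?thesis
    by (simp add: o_def norm_pair_def square_integral_norm nn_integral_gauss_ft[OF \<eta>])
qed

section \<open>Integration over the parameter of a chain\<close>

lemma prod_list_measurable:
  fixes F :: "'i \<Rightarrow> 'a \<Rightarrow> ennreal"
  assumes "\<And>t. t \<in> set ts \<Longrightarrow> F t \<in> borel_measurable M"
  shows "(\<lambda>\<omega>. \<Prod>t\<leftarrow>ts. F t \<omega>) \<in> borel_measurable M"
  using assms by (induction ts) auto

text \<open>By Tonelli the integral over p moves inside the 2k integrations of the chain, where the
  product of the factors at fixed points is controlled by \<open>base\<close>. In the induction
  \<open>ts\<close> collects the points already fixed and j counts the levels left, so
  \<open>base\<close> is invoked only for lists of full length k.\<close>

lemma nn_integral_chain_replicate_le:
  fixes A :: "'p::euclidean_space \<Rightarrow> 'v::euclidean_space \<Rightarrow> ennreal" and B :: "'q \<Rightarrow> 'v \<Rightarrow> ennreal"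
  assumes [measurable]: "(\<lambda>(p, t). A p t) \<in> borel_measurable (borel \<Otimes>\<^sub>M borel)" "Z \<in> borel_measurable borel"
    "G \<in> borel_measurable borel" and B: "B q \<in> borel_measurable borel"
    and base: "\<And>ts. length ts = k \<Longrightarrow>
      (\<integral>\<^sup>+p. Z p * (\<Prod>(t, t')\<leftarrow>ts. A p t * A p t') \<partial>lborel) \<le> D * (\<Prod>(t, t')\<leftarrow>ts. B q t * B q t')"
  shows "(\<integral>\<^sup>+p. Z p * chain G (replicate k A) p u \<partial>lborel) \<le> D * chain G (replicate k B) q u"
proof -
  have "(\<integral>\<^sup>+p. (Z p * (\<Prod>(t, t')\<leftarrow>ts. A p t * A p t')) * chain G (replicate j A) p u \<partial>lborel)
    \<le> (D * (\<Prod>(t, t')\<leftarrow>ts. B q t * B q t')) * chain G (replicate j B) q u" if "length ts + j = k" for ts j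
    using that
  proof (induction j arbitrary: ts u)
    case 0
    have [measurable]: "(\<lambda>p. \<Prod>(t, t')\<leftarrow>ts. A p t * A p t') \<in> borel_measurable borel"
      unfolding split_beta by (rule prod_list_measurable) measurable
    have "(\<integral>\<^sup>+p. (Z p * (\<Prod>(t, t')\<leftarrow>ts. A p t * A p t')) * G u \<partial>lborel) = (\<integral>\<^sup>+p. Z p * (\<Prod>(t, t')\<leftarrow>ts. A p t * A p t') \<partial>lborel) * G u"
      by (rule nn_integral_multc) measurable
    also have "\<dots> \<le> (D * (\<Prod>(t, t')\<leftarrow>ts. B q t * B q t')) * G u"
      using 0 by (intro mult_right_mono base) auto
    finally show ?case by simp
  next
    case (Suc j)
    have [measurable]: "(\<lambda>p. \<Prod>(t, t')\<leftarrow>ts. A p t * A p t') \<in> borel_measurable borel"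
      unfolding split_beta by (rule prod_list_measurable) measurable
    have [measurable]: "(\<lambda>(p, u). chain G (replicate j A) p u) \<in> borel_measurable (borel \<Otimes>\<^sub>M borel)"
      by (rule chain_measurable) auto
    have [measurable]: "chain G (replicate j B) q \<in> borel_measurable borel"
      by (rule chain_measurable_point) (auto simp: B)
    note [measurable] = B
    let ?P = "\<lambda>p. Z p * (\<Prod>(t, t')\<leftarrow>ts. A p t * A p t')"
    let ?C = "\<lambda>p s s'. chain G (replicate j A) p (u + s - s')"
    have "(\<integral>\<^sup>+p. ?P p * chain G (replicate (Suc j) A) p u \<partial>lborel)
      = (\<integral>\<^sup>+p. \<integral>\<^sup>+s. \<integral>\<^sup>+s'. ?P p * (A p s * A p s' * ?C p s s') \<partial>lborel \<partial>lborel \<partial>lborel)"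
      by (simp add: nn_integral_cmult)
    also have "\<dots> = (\<integral>\<^sup>+s. \<integral>\<^sup>+p. \<integral>\<^sup>+s'. ?P p * (A p s * A p s' * ?C p s s') \<partial>lborel \<partial>lborel \<partial>lborel)"
      by (rule nn_integral_lborel_pair(2)) measurable
    also have "\<dots> = (\<integral>\<^sup>+s. \<integral>\<^sup>+s'. \<integral>\<^sup>+p. ?P p * (A p s * A p s' * ?C p s s') \<partial>lborel \<partial>lborel \<partial>lborel)"
      by (intro nn_integral_cong nn_integral_lborel_pair(2)) measurable
    also have "\<dots> \<le> (\<integral>\<^sup>+s. \<integral>\<^sup>+s'. D * (\<Prod>(t, t')\<leftarrow>ts. B q t * B q t') * (B q s * B q s' * chain G (replicate j B) q (u + s - s')) \<partial>lborel \<partial>lborel)"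
    proof (intro nn_integral_mono)
      fix s s'
      show "(\<integral>\<^sup>+p. ?P p * (A p s * A p s' * ?C p s s') \<partial>lborel)
        \<le> D * (\<Prod>(t, t')\<leftarrow>ts. B q t * B q t') * (B q s * B q s' * chain G (replicate j B) q (u + s - s'))"
        using Suc.IH[of "(s, s') # ts" "u + s - s'"] Suc.prems by (simp add: mult_ac)
    qed
    also have "\<dots> = (D * (\<Prod>(t, t')\<leftarrow>ts. B q t * B q t')) * chain G (replicate (Suc j) B) q u"
      by (simp add: nn_integral_cmult)
    finally show ?case .
  qed
  from this[of "[]" k] show ?thesis by simp
qed

text \<open>Junk value: \<open>ennsqrt \<infinity> = 0\<close>.\<close>

definition ennsqrt :: "ennreal \<Rightarrow> ennreal" where
  "ennsqrt y = ennreal (sqrt (enn2real y))"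

lemma ennsqrt_square: "y < \<infinity> \<Longrightarrow> (ennsqrt y)\<^sup>2 = y"
  by (cases y) (auto simp: ennsqrt_def ennreal_power)

lemma ennsqrt_measurable [measurable]: "ennsqrt \<in> borel_measurable borel"
  unfolding ennsqrt_def by measurable

section \<open>The two blocks of variables\<close>

definition slice :: "('u \<times> 'v \<Rightarrow> quat) \<Rightarrow> 'u \<Rightarrow> 'v \<Rightarrow> quat" where
  "slice f y = (\<lambda>u. f (y, u))"

text \<open>All slices, not merely almost all, are required to be square-integrable. This is no restriction, since the
  transform does not see changes on null sets, and it makes every inner integral below converge.\<close>

locale wigner_pair =
  fixes f g :: "'v::euclidean_space \<times> 'v \<Rightarrow> quat"
  assumes f: "sq_int f" and g: "sq_int g"
    and fs: "\<And>y. sq_int (slice f y)" and gs: "\<And>y. sq_int (slice g y)"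
begin

text \<open>The right transform of the second block while the first is still untransformed: x and t
  stand for x1 and t1, and p bundles (x2, w2), the variables that are integrated together under the
  chain in t1.\<close>

definition partial_wigner :: "'v \<Rightarrow> 'v \<times> 'v \<Rightarrow> 'v \<Rightarrow> quat" where
  "partial_wigner x p t = right_fourier (cross_product (slice f (x + t /\<^sub>R 2), slice g (x - t /\<^sub>R 2)) (fst p)) (snd p)"

lemma fg_measurable [measurable]:
  "f \<in> borel_measurable (borel \<Otimes>\<^sub>M borel)" "g \<in> borel_measurable (borel \<Otimes>\<^sub>M borel)"
  using f g by (auto simp: sq_int_def borel_prod)

lemma partial_wigner_measurable [measurable]:
  "(\<lambda>(x, (p, t)). partial_wigner x p t) \<in> borel_measurable (borel \<Otimes>\<^sub>M (borel \<Otimes>\<^sub>M borel))"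
proof -
  have "(\<lambda>(x, (p, t)). partial_wigner x p t) \<in> borel_measurable (borel \<Otimes>\<^sub>M ((borel \<Otimes>\<^sub>M borel) \<Otimes>\<^sub>M borel))"
    unfolding partial_wigner_def right_fourier_def cross_product_def slice_def fst_conv snd_conv by measurable
  then show ?thesis by (simp add: borel_prod)
qed

lemma cross_product_slice: "cross_product (slice f (x1 + t1 /\<^sub>R 2), slice g (x1 - t1 /\<^sub>R 2)) x2 t2 = cross_product (f, g) (x1, x2) (t1, t2)"
  by (simp add: cross_product_def slice_def)

lemma partial_wigner_integrand_integrable:
  "integrable lborel (\<lambda>s. cross_product (slice f y, slice g z) x2 s * ej (w \<bullet> s))"
proof -
  have int: "integrable lborel (cross_product (slice f y, slice g z) x2)"
    using fs gs by (intro cross_product_integrable) auto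
  then have [measurable]: "cross_product (slice f y, slice g z) x2 \<in> borel_measurable borel"
    by auto
  show ?thesis
    by (rule Bochner_Integration.integrable_bound[OF int]) (auto simp: norm_quat_mult)
qed

lemma partial_wigner_integrable: "integrable lborel (partial_wigner x p)"
proof (rule integrableI_bounded)
  have [measurable]: "(\<lambda>(x, (p, t)). partial_wigner x p t) \<in> borel_measurable (borel \<Otimes>\<^sub>M (borel \<Otimes>\<^sub>M borel))"
    by (rule partial_wigner_measurable)
  show "partial_wigner x p \<in> borel_measurable lborel" by measurable
  have int: "integrable lborel (cross_product (f, g) (x, fst p))"
    using f g by (intro cross_product_integrable) auto
  have le: "ennreal (norm (partial_wigner x p t)) \<le> (\<integral>\<^sup>+t2. ennreal (norm (cross_product (f, g) (x, fst p) (t, t2))) \<partial>lborel)" for t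
  proof -
    from integral_norm_bound_ennreal[OF partial_wigner_integrand_integrable[of "x + t /\<^sub>R 2" "x - t /\<^sub>R 2" "fst p" "snd p"]]
    show ?thesis
      unfolding partial_wigner_def right_fourier_def by (simp only: norm_quat_mult norm_ej mult_1_right cross_product_slice)
  qed
  have [measurable]: "(\<lambda>(t1, t2). cross_product (f, g) (x, fst p) (t1, t2)) \<in> borel_measurable (borel \<Otimes>\<^sub>M borel)"
    using int by (simp add: borel_prod case_prod_eta)
  have "(\<integral>\<^sup>+t. ennreal (norm (partial_wigner x p t)) \<partial>lborel) \<le> (\<integral>\<^sup>+t. \<integral>\<^sup>+t2. ennreal (norm (cross_product (f, g) (x, fst p) (t, t2))) \<partial>lborel \<partial>lborel)"
    by (intro nn_integral_mono le)
  also have "\<dots> = (\<integral>\<^sup>+z. ennreal (norm (cross_product (f, g) (x, fst p) z)) \<partial>lborel)"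
    by (subst nn_integral_lborel_pair(1)) auto
  also have "\<dots> < \<infinity>" using int by (simp add: integrable_iff_bounded)
  finally show "(\<integral>\<^sup>+t. ennreal (norm (partial_wigner x p t)) \<partial>lborel) < \<infinity>" .
qed

text \<open>Associativity is enough: \<open>ei\<close> depends on t1 only and leaves the inner
  integral on the left, while \<open>ej\<close> stays inside on the right.\<close>

lemma left_fourier_partial_wigner:
  "left_fourier (partial_wigner x1 (x2, w2)) w1 =
    (\<integral>t. ei (w1 \<bullet> fst t) * cross_product (f, g) (x1, x2) t * ej (w2 \<bullet> snd t) \<partial>lborel)"
proof -
  have int: "integrable lborel (cross_product (f, g) (x1, x2))"
    using f g by (intro cross_product_integrable) auto
  note [measurable] = borel_measurable_fst_snd
  have "integrable lborel (\<lambda>t. ei (w1 \<bullet> fst t) * cross_product (f, g) (x1, x2) t * ej (w2 \<bullet> snd t))"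
    by (rule Bochner_Integration.integrable_bound[OF int]) (use int in \<open>auto simp: norm_quat_mult\<close>)
  then have int2: "integrable (lborel \<Otimes>\<^sub>M lborel) (\<lambda>t. ei (w1 \<bullet> fst t) * cross_product (f, g) (x1, x2) t * ej (w2 \<bullet> snd t))"
    by (simp add: lborel_prod)
  have "(\<integral>t. ei (w1 \<bullet> fst t) * cross_product (f, g) (x1, x2) t * ej (w2 \<bullet> snd t) \<partial>lborel)
    = (\<integral>t1. \<integral>t2. ei (w1 \<bullet> t1) * cross_product (f, g) (x1, x2) (t1, t2) * ej (w2 \<bullet> t2) \<partial>lborel \<partial>lborel)"
    using lborel_pair.integral_fst'[OF int2] by (simp add: lborel_prod)
  also have "\<dots> = (\<integral>t1. ei (w1 \<bullet> t1) * partial_wigner x1 (x2, w2) t1 \<partial>lborel)"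
  proof (rule Bochner_Integration.integral_cong[OF refl])
    fix t1
    show "(\<integral>t2. ei (w1 \<bullet> t1) * cross_product (f, g) (x1, x2) (t1, t2) * ej (w2 \<bullet> t2) \<partial>lborel) = ei (w1 \<bullet> t1) * partial_wigner x1 (x2, w2) t1"
      unfolding partial_wigner_def right_fourier_def fst_conv snd_conv
      by (subst Bochner_Integration.integral_mult_right[OF partial_wigner_integrand_integrable, symmetric])
        (simp only: cross_product_slice mult.assoc)
  qed
  finally show ?thesis by (simp add: left_fourier_def)
qed

text \<open>The share of one block of dimension n: a Jacobian 4^n for each of the k pairs, the mass
  (2 pi)^n of \<open>gauss_ft\<close>, and the scaling (4k)^(-n) of the last integration. Two blocks
  contribute its square.\<close>

definition Lieb_const :: "nat \<Rightarrow> ennreal" where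
  "Lieb_const k = (4 ^ DIM('v)) ^ k * ennreal ((2 * pi) ^ DIM('v)) * ennreal (1 / (4 * real k) ^ DIM('v))"

text \<open>What is left of f and g once the second block is integrated out: the unnormalised L2
  norms of their slices, finite by the assumptions of the locale.\<close>

definition slice_pair :: "('v \<Rightarrow> ennreal) \<times> ('v \<Rightarrow> ennreal)" where
  "slice_pair = ((\<lambda>y. ennsqrt (square_integral (slice f y))), (\<lambda>y. ennsqrt (square_integral (slice g y))))"

lemma square_integral_slice_measurable [measurable]:
  "(\<lambda>y. square_integral (slice f y)) \<in> borel_measurable borel" "(\<lambda>y. square_integral (slice g y)) \<in> borel_measurable borel"
  unfolding square_integral_def slice_def by measurable

lemma slice_pair_square:
  "(fst slice_pair y)\<^sup>2 = square_integral (slice f y)" "(snd slice_pair y)\<^sup>2 = square_integral (slice g y)"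
  using fs gs by (simp_all add: slice_pair_def ennsqrt_square sq_int_def)

lemma nn_integral_square_integral_slice:
  "(\<integral>\<^sup>+y. square_integral (slice f y) \<partial>lborel) = square_integral f" "(\<integral>\<^sup>+y. square_integral (slice g y) \<partial>lborel) = square_integral g"
  unfolding square_integral_def slice_def by (subst nn_integral_lborel_pair(1); simp)+

text \<open>Fixing the points of the list fixes k pairs of slices, to which
  \<open>right_fourier_multi\<close> applies; their square integrals reassemble into the squares of
  \<open>slice_pair\<close>.\<close>

lemma partial_wigner_square_multi:
  assumes \<eta>: "0 < \<eta>" and us: "length us = k" "0 < k"
  shows "(\<integral>\<^sup>+p. ennreal (gauss \<eta> (snd p)) * (\<Prod>u\<leftarrow>us. (ennreal (norm (partial_wigner x p u)))\<^sup>2) \<partial>lborel)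
    \<le> Lieb_const k * (\<Prod>u\<leftarrow>us. (wprod slice_pair x u)\<^sup>2)"
proof -
  let ?ps = "map (\<lambda>u. (slice f (x + u /\<^sub>R 2), slice g (x - u /\<^sub>R 2))) us"
  have [measurable]: "(\<lambda>(x, (p, t)). partial_wigner x p t) \<in> borel_measurable (borel \<Otimes>\<^sub>M (borel \<Otimes>\<^sub>M borel))"
    by (rule partial_wigner_measurable)
  have m: "(\<lambda>(x2, w). (\<Prod>p\<leftarrow>?ps. ennreal ((norm (right_fourier (cross_product p x2) w))\<^sup>2)) * ennreal (gauss \<eta> w)) \<in> borel_measurable (borel \<Otimes>\<^sub>M borel)"
  proof -
    have "(\<lambda>p. (\<Prod>u\<leftarrow>us. ennreal ((norm (partial_wigner x p u))\<^sup>2))) \<in> borel_measurable borel"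
      by (rule prod_list_measurable) measurable
    then have [measurable]: "(\<lambda>p. (\<Prod>u\<leftarrow>us. ennreal ((norm (partial_wigner x p u))\<^sup>2))) \<in> borel_measurable (borel \<Otimes>\<^sub>M borel)"
      by (simp add: borel_prod)
    have "(\<lambda>p. (\<Prod>u\<leftarrow>us. ennreal ((norm (partial_wigner x p u))\<^sup>2)) * ennreal (gauss \<eta> (snd p))) \<in> borel_measurable (borel \<Otimes>\<^sub>M borel)"
      by measurable
    then show ?thesis
      by (simp add: split_beta partial_wigner_def o_def)
  qed
  have "(\<integral>\<^sup>+p. ennreal (gauss \<eta> (snd p)) * (\<Prod>u\<leftarrow>us. (ennreal (norm (partial_wigner x p u)))\<^sup>2) \<partial>lborel)
    = (\<integral>\<^sup>+x2. \<integral>\<^sup>+w. (\<Prod>p\<leftarrow>?ps. ennreal ((norm (right_fourier (cross_product p x2) w))\<^sup>2)) * ennreal (gauss \<eta> w) \<partial>lborel \<partial>lborel)"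
    by (subst nn_integral_lborel_pair(1)[OF m]) (simp add: partial_wigner_def o_def ennreal_power mult.commute)
  also have "\<dots> \<le> (\<Prod>p\<leftarrow>?ps. 4 ^ DIM('v) * square_integral (fst p) * square_integral (snd p)) * ennreal ((2 * pi) ^ DIM('v)) *
      ennreal (1 / (4 * real (length ?ps)) ^ DIM('v))"
    using us fs gs by (intro right_fourier_multi \<eta>) auto
  also have "(\<Prod>p\<leftarrow>?ps. 4 ^ DIM('v) * square_integral (fst p) * square_integral (snd p)) = (4 ^ DIM('v)) ^ length us * (\<Prod>u\<leftarrow>us. (wprod slice_pair x u)\<^sup>2)"
    by (induction us) (auto simp: wprod_def power_mult_distrib slice_pair_square mult_ac)
  finally show ?thesis
    using us by (simp add: Lieb_const_def mult_ac)
qed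

text \<open>A chain in t1 carries 2k moduli in the first power, at unrelated points. Cauchy-Schwarz
  separates the points t from the points t' and leaves two integrals of k squares each. Both have
  the constant \<open>Lieb_const k\<close>, so it is reproduced after the square root.\<close>

lemma partial_wigner_multi:
  assumes \<eta>: "0 < \<eta>" and ts: "length ts = k" "0 < k"
  shows "(\<integral>\<^sup>+p. ennreal (gauss \<eta> (snd p)) * (\<Prod>(t, t')\<leftarrow>ts. ennreal (norm (partial_wigner x p t)) * ennreal (norm (partial_wigner x p t'))) \<partial>lborel)
    \<le> Lieb_const k * (\<Prod>(t, t')\<leftarrow>ts. wprod slice_pair x t * wprod slice_pair x t')"
proof (rule ennreal_power2_le_cancel)
  note [measurable] = borel_measurable_fst_snd
  have [measurable]: "(\<lambda>(x, (p, t)). partial_wigner x p t) \<in> borel_measurable (borel \<Otimes>\<^sub>M (borel \<Otimes>\<^sub>M borel))"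
    by (rule partial_wigner_measurable)
  let ?A = "\<lambda>p t. ennreal (norm (partial_wigner x p t))"
  have sq: "(\<Prod>(t, t')\<leftarrow>ts. h t * h t')\<^sup>2 = (\<Prod>t\<leftarrow>map fst ts. (h t)\<^sup>2) * (\<Prod>t\<leftarrow>map snd ts. (h t)\<^sup>2)" for h :: "'v \<Rightarrow> ennreal"
    by (induction ts) (auto simp: power_mult_distrib mult_ac)
  have m: "(\<lambda>p. \<Prod>t\<leftarrow>us. (?A p t)\<^sup>2) \<in> borel_measurable borel" for us
    by (rule prod_list_measurable) measurable
  have m': "(\<lambda>p. \<Prod>(t, t')\<leftarrow>ts. ?A p t * ?A p t') \<in> borel_measurable borel"
    unfolding split_beta by (rule prod_list_measurable) measurable
  note [measurable] = m m'
  have "(\<integral>\<^sup>+p. ennreal (gauss \<eta> (snd p)) * (\<Prod>(t, t')\<leftarrow>ts. ?A p t * ?A p t') \<partial>lborel)\<^sup>2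
    \<le> (\<integral>\<^sup>+p. ennreal (gauss \<eta> (snd p)) * (\<Prod>t\<leftarrow>map fst ts. (?A p t)\<^sup>2) \<partial>lborel) *
      (\<integral>\<^sup>+p. ennreal (gauss \<eta> (snd p)) * (\<Prod>t\<leftarrow>map snd ts. (?A p t)\<^sup>2) \<partial>lborel)"
  proof (rule nn_integral_Cauchy_Schwarz_le)
    fix p :: "'v \<times> 'v"
    show "(ennreal (gauss \<eta> (snd p)) * (\<Prod>(t, t')\<leftarrow>ts. ?A p t * ?A p t'))\<^sup>2 \<le>
      (ennreal (gauss \<eta> (snd p)) * (\<Prod>t\<leftarrow>map fst ts. (?A p t)\<^sup>2)) * (ennreal (gauss \<eta> (snd p)) * (\<Prod>t\<leftarrow>map snd ts. (?A p t)\<^sup>2))"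
      unfolding power_mult_distrib sq by (simp add: mult_ac power2_eq_square)
  qed measurable
  also have "\<dots> \<le> (Lieb_const k * (\<Prod>t\<leftarrow>map fst ts. (wprod slice_pair x t)\<^sup>2)) * (Lieb_const k * (\<Prod>t\<leftarrow>map snd ts. (wprod slice_pair x t)\<^sup>2))"
    by (intro mult_mono partial_wigner_square_multi \<eta>) (use ts in auto)
  also have "\<dots> = (Lieb_const k * (\<Prod>(t, t')\<leftarrow>ts. wprod slice_pair x t * wprod slice_pair x t'))\<^sup>2"
    unfolding power_mult_distrib sq by (simp add: mult_ac power2_eq_square)
  finally show "(\<integral>\<^sup>+p. ennreal (gauss \<eta> (snd p)) * (\<Prod>(t, t')\<leftarrow>ts. ?A p t * ?A p t') \<partial>lborel)\<^sup>2 \<le> \<dots>" .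
qed

lemma left_fourier_power_le:
  assumes \<eta>: "0 < \<eta>" and k: "0 < k"
  shows "(\<integral>\<^sup>+x. \<integral>\<^sup>+p. \<integral>\<^sup>+w. ennreal (gauss \<eta> (snd p)) * ((ennreal ((norm (left_fourier (partial_wigner x p) w))\<^sup>2)) ^ k * ennreal (gauss \<eta> w)) \<partial>lborel \<partial>lborel \<partial>lborel)
    \<le> (Lieb_const k)\<^sup>2 * (square_integral f * square_integral g) ^ k"
proof -
  have [measurable]: "(\<lambda>(x, (p, t)). partial_wigner x p t) \<in> borel_measurable (borel \<Otimes>\<^sub>M (borel \<Otimes>\<^sub>M borel))"
    by (rule partial_wigner_measurable)
  note [measurable] = borel_measurable_fst_snd
  let ?G = "\<lambda>u::'v. ennreal (gauss_ft \<eta> u)"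
  let ?A = "\<lambda>x p t. ennreal (norm (partial_wigner x p t))"
  have bp: "borel_pair slice_pair"
    by (auto simp: borel_pair_def slice_pair_def)
  have inner: "(\<integral>\<^sup>+p. \<integral>\<^sup>+w. ennreal (gauss \<eta> (snd p)) * ((ennreal ((norm (left_fourier (partial_wigner x p) w))\<^sup>2)) ^ k * ennreal (gauss \<eta> w)) \<partial>lborel \<partial>lborel)
    \<le> Lieb_const k * chain ?G (map wprod (replicate k slice_pair)) x 0" for x
  proof -
    have "(\<integral>\<^sup>+p. \<integral>\<^sup>+w. ennreal (gauss \<eta> (snd p)) * ((ennreal ((norm (left_fourier (partial_wigner x p) w))\<^sup>2)) ^ k * ennreal (gauss \<eta> w)) \<partial>lborel \<partial>lborel)
      \<le> (\<integral>\<^sup>+p. ennreal (gauss \<eta> (snd p)) * chain ?G (replicate k (?A x)) p 0 \<partial>lborel)"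
    proof (rule nn_integral_mono)
      fix p :: "'v \<times> 'v"
      have "autocorr (?A x p) (\<lambda>w. (norm (left_fourier (partial_wigner x p) w))\<^sup>2)"
        using autocorr_rep_left_fourier[OF partial_wigner_integrable] unfolding autocorr_def by blast
      then have "list_all2 (\<lambda>A N. autocorr (A p) N) (replicate k (?A x)) (replicate k (\<lambda>w. (norm (left_fourier (partial_wigner x p) w))\<^sup>2))"
        by (simp add: list_all2_conv_all_nth)
      from nn_integral_autocorr_le_chain[OF \<eta> this]
      have *: "(\<integral>\<^sup>+w. (ennreal ((norm (left_fourier (partial_wigner x p) w))\<^sup>2)) ^ k * ennreal (gauss \<eta> w) \<partial>lborel) \<le> chain ?G (replicate k (?A x)) p 0"
        by (simp add: map_replicate prod_list_replicate)
      have [measurable]: "(\<lambda>w. left_fourier (partial_wigner x p) w) \<in> borel_measurable borel"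
        unfolding left_fourier_def by measurable
      have "(\<integral>\<^sup>+w. ennreal (gauss \<eta> (snd p)) * ((ennreal ((norm (left_fourier (partial_wigner x p) w))\<^sup>2)) ^ k * ennreal (gauss \<eta> w)) \<partial>lborel)
        = ennreal (gauss \<eta> (snd p)) * (\<integral>\<^sup>+w. (ennreal ((norm (left_fourier (partial_wigner x p) w))\<^sup>2)) ^ k * ennreal (gauss \<eta> w) \<partial>lborel)"
        by (rule nn_integral_cmult) measurable
      also have "\<dots> \<le> ennreal (gauss \<eta> (snd p)) * chain ?G (replicate k (?A x)) p 0"
        by (intro mult_left_mono *) auto
      finally show "(\<integral>\<^sup>+w. ennreal (gauss \<eta> (snd p)) * ((ennreal ((norm (left_fourier (partial_wigner x p) w))\<^sup>2)) ^ k * ennreal (gauss \<eta> w)) \<partial>lborel) \<le> \<dots>" .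
    qed
    \<comment> \<open>Moduli of the partial transform give way to products of slice norms at x + t/2
      and x - t/2. The new chain has the shape of the one for a single block, so the separation of
      variables can be used a second time.\<close>
    also have "\<dots> \<le> Lieb_const k * chain ?G (replicate k (wprod slice_pair)) x 0"
    proof (rule nn_integral_chain_replicate_le)
      show "(\<lambda>(p, t). ?A x p t) \<in> borel_measurable (borel \<Otimes>\<^sub>M borel)" by measurable
      show "wprod slice_pair x \<in> borel_measurable borel" by (rule wprod_measurable_point[OF bp])
    qed (use partial_wigner_multi[OF \<eta> _ k] in auto)
    finally show ?thesis by (simp add: map_replicate)
  qed
  have "(\<integral>\<^sup>+x. \<integral>\<^sup>+p. \<integral>\<^sup>+w. ennreal (gauss \<eta> (snd p)) * ((ennreal ((norm (left_fourier (partial_wigner x p) w))\<^sup>2)) ^ k * ennreal (gauss \<eta> w)) \<partial>lborel \<partial>lborel \<partial>lborel)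
    \<le> (\<integral>\<^sup>+x. Lieb_const k * chain ?G (map wprod (replicate k slice_pair)) x 0 \<partial>lborel)"
    by (intro nn_integral_mono inner)
  also have "\<dots> = Lieb_const k * (\<integral>\<^sup>+x. chain ?G (map wprod (replicate k slice_pair)) x 0 \<partial>lborel)"
  proof (rule nn_integral_cmult)
    have [measurable]: "(\<lambda>(x, u). chain ?G (map wprod (replicate k slice_pair)) x u) \<in> borel_measurable (borel \<Otimes>\<^sub>M borel)"
      by (rule chain_measurable) (use wprod_measurable[OF bp] in auto)
    show "(\<lambda>x. chain ?G (map wprod (replicate k slice_pair)) x 0) \<in> borel_measurable lborel" by measurable
  qed
  also have "\<dots> \<le> Lieb_const k * ((\<Prod>q\<leftarrow>replicate k slice_pair. 4 ^ DIM('v) * (\<integral>\<^sup>+y. (fst q y)\<^sup>2 \<partial>lborel) * (\<integral>\<^sup>+z. (snd q z)\<^sup>2 \<partial>lborel)) *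
    (\<integral>\<^sup>+x. ?G x \<partial>lborel) * ennreal (1 / (4 * real (length (replicate k slice_pair))) ^ DIM('v)))"
    using bp k by (intro mult_left_mono nn_integral_chain_wprod_le) auto
  also have "(\<Prod>q\<leftarrow>replicate k slice_pair. 4 ^ DIM('v) * (\<integral>\<^sup>+y. (fst q y)\<^sup>2 \<partial>lborel) * (\<integral>\<^sup>+z. (snd q z)\<^sup>2 \<partial>lborel))
    = (4 ^ DIM('v) * square_integral f * square_integral g) ^ k"
    by (simp only: map_replicate prod_list_replicate slice_pair_square nn_integral_square_integral_slice)
  also have "Lieb_const k * ((4 ^ DIM('v) * square_integral f * square_integral g) ^ k *
    (\<integral>\<^sup>+x. ?G x \<partial>lborel) * ennreal (1 / (4 * real (length (replicate k slice_pair))) ^ DIM('v))) = (Lieb_const k)\<^sup>2 * (square_integral f * square_integral g) ^ k"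
    unfolding nn_integral_gauss_ft[OF \<eta>] length_replicate Lieb_const_def power2_eq_square power_mult_distrib
    by (simp only: mult_ac)
  finally show ?thesis .
qed

end


section \<open>The Wigner transform of a Borel pair\<close>

text \<open>The map from (x, s) to (x + s/2, x - s/2) preserves volume: the factor 2^n from the
  substitution in s cancels against the one in x.\<close>

lemma nn_integral_half_shift:
  fixes u v :: "'v::euclidean_space \<Rightarrow> ennreal"
  assumes [measurable]: "u \<in> borel_measurable borel" "v \<in> borel_measurable borel"
  shows "(\<integral>\<^sup>+x. \<integral>\<^sup>+s. u (x + s /\<^sub>R 2) * v (x - s /\<^sub>R 2) \<partial>lborel \<partial>lborel) =
    (\<integral>\<^sup>+y. u y \<partial>lborel) * (\<integral>\<^sup>+z. v z \<partial>lborel)"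
proof -
  have "(\<integral>\<^sup>+s. u (x + s /\<^sub>R 2) * v (x - s /\<^sub>R 2) \<partial>lborel) = 2 ^ DIM('v) * (\<integral>\<^sup>+y. u y * v (- y + 2 *\<^sub>R x) \<partial>lborel)" for x
  proof -
    have "(- 2 *\<^sub>R x + 2 *\<^sub>R y) /\<^sub>R 2 = y - x" for y
      by (simp add: scaleR_right_distrib scaleR_right_diff_distrib)
    then have "x + (- 2 *\<^sub>R x + 2 *\<^sub>R y) /\<^sub>R 2 = y" "x - (- 2 *\<^sub>R x + 2 *\<^sub>R y) /\<^sub>R 2 = - y + 2 *\<^sub>R x" for y
      by (simp_all only:) (simp_all add: scaleR_2)
    then show ?thesis
      by (subst nn_integral_lborel_affine2[of "\<lambda>s. u (x + s /\<^sub>R 2) * v (x - s /\<^sub>R 2)" 2 "- 2 *\<^sub>R x"]) (simp_all only:, auto)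
  qed
  then have "(\<integral>\<^sup>+x. \<integral>\<^sup>+s. u (x + s /\<^sub>R 2) * v (x - s /\<^sub>R 2) \<partial>lborel \<partial>lborel) =
    2 ^ DIM('v) * (\<integral>\<^sup>+x. \<integral>\<^sup>+y. u y * v (- y + 2 *\<^sub>R x) \<partial>lborel \<partial>lborel)"
    by (simp add: nn_integral_cmult)
  also have "(\<integral>\<^sup>+x. \<integral>\<^sup>+y. u y * v (- y + 2 *\<^sub>R x) \<partial>lborel \<partial>lborel) = (\<integral>\<^sup>+y. \<integral>\<^sup>+x. u y * v (- y + 2 *\<^sub>R x) \<partial>lborel \<partial>lborel)"
    by (rule nn_integral_lborel_pair(2)) measurable
  also have "2 ^ DIM('v) * \<dots> = (\<integral>\<^sup>+y. u y * (2 ^ DIM('v) * (\<integral>\<^sup>+x. v (- y + 2 *\<^sub>R x) \<partial>lborel)) \<partial>lborel)"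
    by (simp add: nn_integral_cmult[symmetric] mult_ac)
  also have "\<dots> = (\<integral>\<^sup>+y. u y * (\<integral>\<^sup>+z. v z \<partial>lborel) \<partial>lborel)"
    by (subst nn_integral_lborel_affine2[of v 2, symmetric]) auto
  finally show ?thesis by (simp add: nn_integral_multc)
qed

lemma nn_integral_cross_product_square:
  fixes p :: "('v::euclidean_space \<Rightarrow> quat) \<times> ('v \<Rightarrow> quat)"
  assumes "sq_int (fst p)" "sq_int (snd p)"
  shows "(\<integral>\<^sup>+x. \<integral>\<^sup>+s. ennreal ((norm (cross_product p x s))\<^sup>2) \<partial>lborel \<partial>lborel) = square_integral (fst p) * square_integral (snd p)"
proof -
  have [measurable]: "fst p \<in> borel_measurable borel" "snd p \<in> borel_measurable borel"
    using assms by (auto simp: sq_int_def)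
  show ?thesis
    unfolding square_integral_def by (subst nn_integral_half_shift[symmetric])
      (auto simp: cross_product_def norm_quat_mult power_mult_distrib ennreal_mult)
qed

text \<open>Plancherel at a given x requires a kernel square-integrable in s. Finiteness of the
  double integral supplies this for almost every x, which suffices under the outer integral.\<close>

lemma right_fourier_cross_product_square:
  fixes p :: "('v::euclidean_space \<Rightarrow> quat) \<times> ('v \<Rightarrow> quat)"
  assumes p: "sq_int (fst p)" "sq_int (snd p)"
  shows "(\<integral>\<^sup>+x. \<integral>\<^sup>+w. ennreal ((norm (right_fourier (cross_product p x) w))\<^sup>2) \<partial>lborel \<partial>lborel) =
    ennreal ((2 * pi) ^ DIM('v)) * (square_integral (fst p) * square_integral (snd p))"
proof -
  have [measurable]: "fst p \<in> borel_measurable borel" "snd p \<in> borel_measurable borel"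
    using assms by (auto simp: sq_int_def)
  let ?S = "\<lambda>x. \<integral>\<^sup>+s. ennreal ((norm (cross_product p x s))\<^sup>2) \<partial>lborel"
  have [measurable]: "?S \<in> borel_measurable borel"
    unfolding cross_product_def by measurable
  have "(\<integral>\<^sup>+x. ?S x \<partial>lborel) \<noteq> \<infinity>"
    unfolding nn_integral_cross_product_square[OF p] using p by (auto simp: sq_int_def ennreal_mult_eq_top_iff)
  then have "AE x in lborel. ?S x \<noteq> \<infinity>"
    by (intro nn_integral_PInf_AE) auto
  then have "AE x in lborel. (\<integral>\<^sup>+w. ennreal ((norm (right_fourier (cross_product p x) w))\<^sup>2) \<partial>lborel) = ennreal ((2 * pi) ^ DIM('v)) * ?S x"
    by eventually_elim (intro plancherel_right_fourier cross_product_integrable p, simp add: less_top)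
  then have "(\<integral>\<^sup>+x. \<integral>\<^sup>+w. ennreal ((norm (right_fourier (cross_product p x) w))\<^sup>2) \<partial>lborel \<partial>lborel) = (\<integral>\<^sup>+x. ennreal ((2 * pi) ^ DIM('v)) * ?S x \<partial>lborel)"
    by (rule nn_integral_cong_AE)
  also have "\<dots> = ennreal ((2 * pi) ^ DIM('v)) * (\<integral>\<^sup>+x. ?S x \<partial>lborel)"
    by (rule nn_integral_cmult) simp
  finally show ?thesis unfolding nn_integral_cross_product_square[OF p] .
qed

text \<open>The grouping follows the order in which the blocks are treated: x1 outermost, then (x2,
  w2) as one variable p, and w1 innermost.\<close>

lemma nn_integral_lborel_quad:
  fixes F :: "('v::euclidean_space \<times> 'v) \<times> ('v \<times> 'v) \<Rightarrow> ennreal"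
  assumes "F \<in> borel_measurable borel"
  shows "(\<integral>\<^sup>+z. F z \<partial>lborel) = (\<integral>\<^sup>+x. \<integral>\<^sup>+p. \<integral>\<^sup>+w. F ((x, fst p), (w, snd p)) \<partial>lborel \<partial>lborel \<partial>lborel)"
proof -
  have F: "F \<in> borel_measurable ((borel \<Otimes>\<^sub>M borel) \<Otimes>\<^sub>M (borel \<Otimes>\<^sub>M borel))"
    using assms by (simp add: borel_prod)
  note F[measurable]
  have F1: "(\<lambda>(x, w). F (x, w)) \<in> borel_measurable (borel \<Otimes>\<^sub>M borel)"
    using assms by (simp add: borel_prod case_prod_eta)
  have F2: "(\<lambda>(x1, x2). \<integral>\<^sup>+w. F ((x1, x2), w) \<partial>lborel) \<in> borel_measurable (borel \<Otimes>\<^sub>M borel)"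
  proof -
    have "(\<lambda>x. \<integral>\<^sup>+w. F (x, w) \<partial>lborel) \<in> borel_measurable borel"
      using F1 by simp
    then show ?thesis by (simp add: borel_prod case_prod_unfold)
  qed
  have "(\<integral>\<^sup>+z. F z \<partial>lborel) = (\<integral>\<^sup>+x. \<integral>\<^sup>+w. F (x, w) \<partial>lborel \<partial>lborel)"
    by (subst nn_integral_lborel_pair(1)[OF F1]) simp
  also have "\<dots> = (\<integral>\<^sup>+x1. \<integral>\<^sup>+x2. \<integral>\<^sup>+w. F ((x1, x2), w) \<partial>lborel \<partial>lborel \<partial>lborel)"
    by (subst nn_integral_lborel_pair(1)[OF F2]) simp
  also have "\<dots> = (\<integral>\<^sup>+x1. \<integral>\<^sup>+x2. \<integral>\<^sup>+w1. \<integral>\<^sup>+w2. F ((x1, x2), (w1, w2)) \<partial>lborel \<partial>lborel \<partial>lborel \<partial>lborel)"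
  proof (intro nn_integral_cong)
    fix x1 x2
    have "(\<lambda>w. F ((x1, x2), w)) \<in> borel_measurable (borel \<Otimes>\<^sub>M borel)" by measurable
    then have "(\<lambda>(w1, w2). F ((x1, x2), (w1, w2))) \<in> borel_measurable (borel \<Otimes>\<^sub>M borel)"
      by (simp add: case_prod_unfold)
    from nn_integral_lborel_pair(1)[OF this]
    show "(\<integral>\<^sup>+w. F ((x1, x2), w) \<partial>lborel) = (\<integral>\<^sup>+w1. \<integral>\<^sup>+w2. F ((x1, x2), (w1, w2)) \<partial>lborel \<partial>lborel)"
      by simp
  qed
  also have "\<dots> = (\<integral>\<^sup>+x1. \<integral>\<^sup>+x2. \<integral>\<^sup>+w2. \<integral>\<^sup>+w1. F ((x1, x2), (w1, w2)) \<partial>lborel \<partial>lborel \<partial>lborel \<partial>lborel)"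
    by (intro nn_integral_cong nn_integral_lborel_pair(2)) measurable
  also have "\<dots> = (\<integral>\<^sup>+x1. \<integral>\<^sup>+p. \<integral>\<^sup>+w. F ((x1, fst p), (w, snd p)) \<partial>lborel \<partial>lborel \<partial>lborel)"
    by (intro nn_integral_cong nn_integral_lborel_pair(1)) measurable
  finally show ?thesis .
qed

section \<open>Removal of the Gaussian weight\<close>

lemma gauss_Pair: "gauss \<eta> (a, b) = gauss \<eta> a * gauss \<eta> b"
  by (simp add: gauss_def norm_Pair distrib_left add_divide_distrib flip: exp_add)

lemma nn_integral_le_gauss_limit:
  fixes F :: "'a::euclidean_space \<times> 'b::euclidean_space \<Rightarrow> ennreal"
  assumes [measurable]: "F \<in> borel_measurable borel"
    and le: "\<And>\<eta>. 0 < \<eta> \<Longrightarrow> (\<integral>\<^sup>+z. F z * ennreal (gauss \<eta> (snd z)) \<partial>lborel) \<le> C"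
  shows "(\<integral>\<^sup>+z. F z \<partial>lborel) \<le> C"
proof -
  note [measurable] = borel_measurable_fst_snd
  have inc: "incseq (\<lambda>n z. F z * ennreal (gauss (1 / real (Suc n)) (snd z)))"
    using gauss_incseq by (auto simp: incseq_def le_fun_def intro!: mult_left_mono ennreal_leI)
  have "F z = (SUP n. F z * ennreal (gauss (1 / real (Suc n)) (snd z)))" for z
    by (simp only: SUP_mult_left_ennreal[symmetric] gauss_SUP mult_1_right)
  then have "(\<integral>\<^sup>+z. F z \<partial>lborel) = (\<integral>\<^sup>+z. (SUP n. F z * ennreal (gauss (1 / real (Suc n)) (snd z))) \<partial>lborel)"
    by presburger
  also have "\<dots> = (SUP n. \<integral>\<^sup>+z. F z * ennreal (gauss (1 / real (Suc n)) (snd z)) \<partial>lborel)"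
    by (rule nn_integral_monotone_convergence_SUP[OF inc]) measurable
  also have "\<dots> \<le> C"
    by (rule SUP_least) (rule le, simp)
  finally show ?thesis .
qed

context wigner_pair
begin

text \<open>The Wigner transform without the normalisation of its measure, written as an iterated
  transform so that the one-sided results apply.\<close>

definition W :: "('v \<times> 'v) \<times> ('v \<times> 'v) \<Rightarrow> quat" where
  "W z = left_fourier (partial_wigner (fst (fst z)) (snd (fst z), snd (snd z))) (fst (snd z))"

lemma W_measurable: "W \<in> borel_measurable borel"
proof -
  have k: "(\<lambda>(x, (p, t)). partial_wigner x p t) \<in> borel_measurable (borel \<Otimes>\<^sub>M ((borel \<Otimes>\<^sub>M borel) \<Otimes>\<^sub>M borel))"
    using partial_wigner_measurable by (simp add: borel_prod)
  have [measurable]: "(\<lambda>z. partial_wigner (fst (fst (fst z))) (snd (fst (fst z)), snd (snd (fst z))) (snd z))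
    \<in> borel_measurable (((borel \<Otimes>\<^sub>M borel) \<Otimes>\<^sub>M (borel \<Otimes>\<^sub>M borel)) \<Otimes>\<^sub>M borel)"
  proof -
    have "(\<lambda>z. (fst (fst (fst z)), ((snd (fst (fst z)), snd (snd (fst z))), snd z)))
      \<in> measurable (((borel \<Otimes>\<^sub>M borel) \<Otimes>\<^sub>M (borel \<Otimes>\<^sub>M borel)) \<Otimes>\<^sub>M borel) (borel \<Otimes>\<^sub>M ((borel \<Otimes>\<^sub>M borel) \<Otimes>\<^sub>M borel))"
      by measurable
    from measurable_compose[OF this k] show ?thesis by simp
  qed
  have "W \<in> borel_measurable ((borel \<Otimes>\<^sub>M borel) \<Otimes>\<^sub>M (borel \<Otimes>\<^sub>M borel))"
    unfolding W_def[abs_def] left_fourier_def by measurable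
  then show ?thesis by (simp add: borel_prod)
qed

lemma W_power_le:
  assumes "0 < k"
  shows "(\<integral>\<^sup>+z. (ennreal ((norm (W z))\<^sup>2)) ^ k \<partial>lborel) \<le> (Lieb_const k)\<^sup>2 * (square_integral f * square_integral g) ^ k"
proof (rule nn_integral_le_gauss_limit)
  note [measurable] = borel_measurable_fst_snd W_measurable
  show "(\<lambda>z. (ennreal ((norm (W z))\<^sup>2)) ^ k) \<in> borel_measurable borel"
    by measurable
  fix \<eta> :: real assume \<eta>: "0 < \<eta>"
  have "(\<integral>\<^sup>+z. (ennreal ((norm (W z))\<^sup>2)) ^ k * ennreal (gauss \<eta> (snd z)) \<partial>lborel) =
    (\<integral>\<^sup>+x. \<integral>\<^sup>+p. \<integral>\<^sup>+w. (ennreal ((norm (W ((x, fst p), (w, snd p))))\<^sup>2)) ^ k * ennreal (gauss \<eta> (snd ((x, fst p), (w, snd p)))) \<partial>lborel \<partial>lborel \<partial>lborel)"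
    by (rule nn_integral_lborel_quad) measurable
  also have "\<dots> = (\<integral>\<^sup>+x. \<integral>\<^sup>+p. \<integral>\<^sup>+w. ennreal (gauss \<eta> (snd p)) * ((ennreal ((norm (left_fourier (partial_wigner x p) w))\<^sup>2)) ^ k * ennreal (gauss \<eta> w)) \<partial>lborel \<partial>lborel \<partial>lborel)"
    by (intro nn_integral_cong) (simp add: W_def gauss_Pair ennreal_mult less_imp_le[OF gauss_pos] mult_ac)
  also have "\<dots> \<le> (Lieb_const k)\<^sup>2 * (square_integral f * square_integral g) ^ k"
    by (rule left_fourier_power_le[OF \<eta> assms])
  finally show "(\<integral>\<^sup>+z. (ennreal ((norm (W z))\<^sup>2)) ^ k * ennreal (gauss \<eta> (snd z)) \<partial>lborel) \<le> \<dots>" .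
qed

text \<open>Plancherel for the left transform removes w1, Plancherel for the right transform removes
  w2, and the remaining integral factorises by the half shift. Square-integrability of
  \<open>partial_wigner x p\<close> follows for almost every x and then almost every p, hence the
  two nested almost-everywhere arguments.\<close>

lemma W_square:
  "(\<integral>\<^sup>+z. ennreal ((norm (W z))\<^sup>2) \<partial>lborel) = (ennreal ((2 * pi) ^ DIM('v)))\<^sup>2 * (square_integral f * square_integral g)"
proof -
  note [measurable] = borel_measurable_fst_snd W_measurable
  note partial_wigner_measurable [measurable]
  have [measurable]: "(\<lambda>z. partial_wigner (fst (fst z)) (snd (fst z)) (snd z)) \<in> borel_measurable ((borel \<Otimes>\<^sub>M borel) \<Otimes>\<^sub>M borel)"
  proof -
    have "(\<lambda>z. (fst (fst z), (snd (fst z), snd z))) \<in> measurable ((borel \<Otimes>\<^sub>M borel) \<Otimes>\<^sub>M borel) (borel \<Otimes>\<^sub>M (borel \<Otimes>\<^sub>M borel))"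
      by measurable
    from measurable_compose[OF this partial_wigner_measurable] show ?thesis by simp
  qed
  let ?c = "ennreal ((2 * pi) ^ DIM('v))"
  let ?S = "\<lambda>x p. \<integral>\<^sup>+t. ennreal ((norm (partial_wigner x p t))\<^sup>2) \<partial>lborel"
  have S: "(\<integral>\<^sup>+x. \<integral>\<^sup>+p. ?S x p \<partial>lborel \<partial>lborel) = ?c * (square_integral f * square_integral g)"
  proof -
    have "(\<integral>\<^sup>+x. \<integral>\<^sup>+p. ?S x p \<partial>lborel \<partial>lborel) = (\<integral>\<^sup>+x. \<integral>\<^sup>+t. \<integral>\<^sup>+p. ennreal ((norm (partial_wigner x p t))\<^sup>2) \<partial>lborel \<partial>lborel \<partial>lborel)"
      by (intro nn_integral_cong nn_integral_lborel_pair(2)) measurable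
    also have "\<dots> = (\<integral>\<^sup>+x. \<integral>\<^sup>+t. ?c * (square_integral (slice f (x + t /\<^sub>R 2)) * square_integral (slice g (x - t /\<^sub>R 2))) \<partial>lborel \<partial>lborel)"
    proof (intro nn_integral_cong)
      fix x t
      let ?p = "(slice f (x + t /\<^sub>R 2), slice g (x - t /\<^sub>R 2))"
      have m: "(\<lambda>(x2, w). ennreal ((norm (right_fourier (cross_product ?p x2) w))\<^sup>2)) \<in> borel_measurable (borel \<Otimes>\<^sub>M borel)"
      proof -
        have "(\<lambda>p. ennreal ((norm (partial_wigner x p t))\<^sup>2)) \<in> borel_measurable borel" by measurable
        then show ?thesis by (simp add: partial_wigner_def borel_prod split_beta)
      qed
      have "(\<integral>\<^sup>+p. ennreal ((norm (partial_wigner x p t))\<^sup>2) \<partial>lborel) = (\<integral>\<^sup>+x2. \<integral>\<^sup>+w. ennreal ((norm (right_fourier (cross_product ?p x2) w))\<^sup>2) \<partial>lborel \<partial>lborel)"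
        by (subst nn_integral_lborel_pair(1)[OF m]) (simp add: partial_wigner_def)
      also have "\<dots> = ?c * (square_integral (fst ?p) * square_integral (snd ?p))"
        using fs gs by (intro right_fourier_cross_product_square) auto
      finally show "(\<integral>\<^sup>+p. ennreal ((norm (partial_wigner x p t))\<^sup>2) \<partial>lborel) = ?c * (square_integral (slice f (x + t /\<^sub>R 2)) * square_integral (slice g (x - t /\<^sub>R 2)))"
        by simp
    qed
    also have "\<dots> = ?c * (\<integral>\<^sup>+x. \<integral>\<^sup>+t. square_integral (slice f (x + t /\<^sub>R 2)) * square_integral (slice g (x - t /\<^sub>R 2)) \<partial>lborel \<partial>lborel)"
    proof -
      have 1: "(\<lambda>y. square_integral (slice f y)) \<in> borel_measurable borel" "(\<lambda>y. square_integral (slice g y)) \<in> borel_measurable borel"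
        by (rule square_integral_slice_measurable)+
      note [measurable] = 1[THEN measurable_compose_rev]
      show ?thesis
        by (simp add: nn_integral_cmult)
    qed
    also have "\<dots> = ?c * (square_integral f * square_integral g)"
      by (subst nn_integral_half_shift) (auto simp: nn_integral_square_integral_slice)
    finally show ?thesis .
  qed
  have "(\<integral>\<^sup>+x. \<integral>\<^sup>+p. ?S x p \<partial>lborel \<partial>lborel) \<noteq> \<infinity>"
    unfolding S using f g by (auto simp: sq_int_def ennreal_mult_eq_top_iff)
  then have "AE x in lborel. (\<integral>\<^sup>+p. ?S x p \<partial>lborel) \<noteq> \<infinity>"
    by (rule nn_integral_PInf_AE[rotated]) measurable
  then have AE: "AE x in lborel. (\<integral>\<^sup>+p. \<integral>\<^sup>+w. ennreal ((norm (left_fourier (partial_wigner x p) w))\<^sup>2) \<partial>lborel \<partial>lborel) = ?c * (\<integral>\<^sup>+p. ?S x p \<partial>lborel)"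
  proof eventually_elim
    case (elim x)
    then have "AE p in lborel. ?S x p \<noteq> \<infinity>"
      by (rule nn_integral_PInf_AE[rotated]) measurable
    then have "AE p in lborel. (\<integral>\<^sup>+w. ennreal ((norm (left_fourier (partial_wigner x p) w))\<^sup>2) \<partial>lborel) = ?c * ?S x p"
      by eventually_elim (intro plancherel_left_fourier partial_wigner_integrable, simp add: less_top)
    then have "(\<integral>\<^sup>+p. \<integral>\<^sup>+w. ennreal ((norm (left_fourier (partial_wigner x p) w))\<^sup>2) \<partial>lborel \<partial>lborel) = (\<integral>\<^sup>+p. ?c * ?S x p \<partial>lborel)"
      by (rule nn_integral_cong_AE)
    also have "\<dots> = ?c * (\<integral>\<^sup>+p. ?S x p \<partial>lborel)"
      by (rule nn_integral_cmult) measurable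
    finally show ?case .
  qed
  have "(\<integral>\<^sup>+z. ennreal ((norm (W z))\<^sup>2) \<partial>lborel) =
    (\<integral>\<^sup>+x. \<integral>\<^sup>+p. \<integral>\<^sup>+w. ennreal ((norm (W ((x, fst p), (w, snd p))))\<^sup>2) \<partial>lborel \<partial>lborel \<partial>lborel)"
    by (rule nn_integral_lborel_quad) measurable
  also have "\<dots> = (\<integral>\<^sup>+x. \<integral>\<^sup>+p. \<integral>\<^sup>+w. ennreal ((norm (left_fourier (partial_wigner x p) w))\<^sup>2) \<partial>lborel \<partial>lborel \<partial>lborel)"
    by (simp add: W_def)
  also have "\<dots> = (\<integral>\<^sup>+x. ?c * (\<integral>\<^sup>+p. ?S x p \<partial>lborel) \<partial>lborel)"
    by (rule nn_integral_cong_AE[OF AE])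
  also have "\<dots> = ?c * (\<integral>\<^sup>+x. \<integral>\<^sup>+p. ?S x p \<partial>lborel \<partial>lborel)"
    by (rule nn_integral_cmult) measurable
  finally show ?thesis unfolding S by (simp add: power2_eq_square mult_ac)
qed

end


section \<open>Passage to Borel functions and to the normalised measure\<close>

text \<open>The exceptional set is null, so in the completion every subset of it is measurable and
  the values of h there are harmless.\<close>

lemma borel_measurable_completion_AE:
  fixes h :: "'a \<Rightarrow> 'b::topological_space"
  assumes [measurable]: "g \<in> borel_measurable M" and eq: "AE x in M. h x = g x"
  shows "h \<in> borel_measurable (completion M)"
proof (rule measurableI)
  fix A :: "'b set" assume [measurable]: "A \<in> sets borel"
  have [measurable]: "g \<in> borel_measurable (completion M)" by (rule measurable_completion) simp
  have [measurable]: "Measurable.pred (completion M) (\<lambda>x. h x \<in> A \<and> h x \<noteq> g x)"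
    "Measurable.pred (completion M) (\<lambda>x. h x \<noteq> g x)"
    by (rule sets_completion_AE, use eq in eventually_elim, simp)+
  have "Measurable.pred (completion M) (\<lambda>x. (g x \<in> A \<and> \<not> h x \<noteq> g x) \<or> (h x \<in> A \<and> h x \<noteq> g x))"
    by measurable
  also have "(\<lambda>x. (g x \<in> A \<and> \<not> h x \<noteq> g x) \<or> (h x \<in> A \<and> h x \<noteq> g x)) = (\<lambda>x. h x \<in> A)"
    by auto
  finally show "h -` A \<inter> space (completion M) \<in> sets (completion M)"
    by (simp add: pred_def vimage_def Int_def conj_commute)
qed simp

section \<open>Comparison of \<open>mu\<close> with Lebesgue measure on Borel sets\<close>

definition mu_const :: "'a::euclidean_space itself \<Rightarrow> real" where
  "mu_const _ = 1 / (2 * pi) powr (DIM('a) / 2)"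

lemma mu_const_pos: "0 < mu_const TYPE('a::euclidean_space)"
  by (simp add: mu_const_def)

lemma sets_mu [simp]: "sets (mu :: 'a::euclidean_space measure) = sets lebesgue"
  by (simp add: mu_def)

lemma measurable_mu: "borel_measurable (mu :: 'a::euclidean_space measure) = borel_measurable lebesgue"
  by (rule measurable_cong_sets) simp_all

lemma nn_integral_mu:
  fixes F :: "'a::euclidean_space \<Rightarrow> ennreal"
  assumes "F \<in> borel_measurable lebesgue"
  shows "(\<integral>\<^sup>+x. F x \<partial>mu) = ennreal (mu_const TYPE('a)) * (\<integral>\<^sup>+x. F x \<partial>lborel)"
proof -
  have "(\<integral>\<^sup>+x. F x \<partial>mu) = (\<integral>\<^sup>+x. ennreal (mu_const TYPE('a)) * F x \<partial>lebesgue)"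
    unfolding mu_def mu_const_def using assms by (intro nn_integral_density) auto
  also have "\<dots> = ennreal (mu_const TYPE('a)) * (\<integral>\<^sup>+x. F x \<partial>lebesgue)"
    by (rule nn_integral_cmult[OF assms])
  finally show ?thesis by (simp only: nn_integral_completion)
qed

lemma integral_mu_AE:
  fixes F G :: "'a::euclidean_space \<Rightarrow> 'b::{banach,second_countable_topology}"
  assumes "G \<in> borel_measurable borel" "AE x in lborel. F x = G x"
  shows "integral\<^sup>L mu F = mu_const TYPE('a) *\<^sub>R integral\<^sup>L lborel G"
proof -
  have G: "G \<in> borel_measurable lborel" using assms by simp
  have F: "F \<in> borel_measurable lebesgue"
    by (rule borel_measurable_completion_AE[OF G assms(2)])
  have "integral\<^sup>L mu F = (\<integral>x. mu_const TYPE('a) *\<^sub>R F x \<partial>lebesgue)"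
    unfolding mu_def mu_const_def using F by (subst integral_density) auto
  also have "\<dots> = mu_const TYPE('a) *\<^sub>R integral\<^sup>L lebesgue F"
    by simp
  also have "integral\<^sup>L lebesgue F = integral\<^sup>L lebesgue G"
    using F measurable_completion[OF G] AE_completion[OF assms(2)] by (intro integral_cong_AE) auto
  also have "\<dots> = integral\<^sup>L lborel G" by (rule integral_completion[OF G])
  finally show ?thesis .
qed

lemma AE_mu_iff: "(AE x in (mu :: 'a::euclidean_space measure). P x) \<longleftrightarrow> (AE x in lborel. P x)"
  unfolding mu_def by (subst AE_density) (simp_all add: AE_completion_iff)

lemma AE_lborel_affine:
  fixes a :: "'a::euclidean_space"
  assumes "AE y in lborel. P y" and "c \<noteq> 0"
  shows "AE t in lborel. P (a + c *\<^sub>R t)"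
proof -
  obtain N where N: "{y. \<not> P y} \<subseteq> N" "emeasure lborel N = 0" "N \<in> sets borel"
    using AE_E[OF assms(1)] by auto
  note [measurable] = N(3)
  have "(\<integral>\<^sup>+t. indicator N (a + c *\<^sub>R t) \<partial>lborel) = 0"
    using N assms(2) by (subst nn_integral_lborel_affine) auto
  then have "AE t in lborel. indicator N (a + c *\<^sub>R t) = (0::ennreal)"
    by (subst (asm) nn_integral_0_iff_AE) auto
  then show ?thesis
    by eventually_elim (use N in \<open>auto simp: indicator_def split: if_splits\<close>)
qed

text \<open>Equality holds at every z although f and g equal their representatives only almost
  everywhere: for fixed x the arguments x + t/2 and x - t/2 are affine in t, and null sets pull back
  to null sets. Measurability of the Wigner transform is thereby inherited from
  \<open>W\<close>.\<close>

lemma wigner_eq_W: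
  fixes f g :: "(real^'d) \<times> (real^'d) \<Rightarrow> quat"
  assumes wp: "wigner_pair f' g'" and ff': "AE y in lborel. f y = f' y" and gg': "AE y in lborel. g y = g' y"
  shows "wigner f g z = (1 / (2 * pi) ^ CARD('d)) *\<^sub>R wigner_pair.W f' g' z"
proof -
  interpret wigner_pair f' g' by (rule wp)
  note [measurable] = borel_measurable_fst_snd
  obtain x1 x2 w1 w2 where z: "z = ((x1, x2), (w1, w2))" by (metis surj_pair)
  let ?x = "(x1, x2)"
  have m: "cross_product (f', g') ?x \<in> borel_measurable borel"
    using cross_product_integrable[of "(f', g')" ?x] f g by auto
  note [measurable] = m
  let ?F = "\<lambda>t. exp (- ((w1 \<bullet> fst t) *\<^sub>R quat_i)) * f (?x + t /\<^sub>R 2) * quat_cnj (g (?x - t /\<^sub>R 2)) * exp (- ((w2 \<bullet> snd t) *\<^sub>R quat_j))"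
  let ?G = "\<lambda>t. ei (w1 \<bullet> fst t) * cross_product (f', g') ?x t * ej (w2 \<bullet> snd t)"
  have "AE t in lborel. f (?x + (1/2) *\<^sub>R t) = f' (?x + (1/2) *\<^sub>R t)"
    by (rule AE_lborel_affine[OF ff']) simp
  moreover have "AE t in lborel. g (?x + (-1/2) *\<^sub>R t) = g' (?x + (-1/2) *\<^sub>R t)"
    by (rule AE_lborel_affine[OF gg']) simp
  ultimately have AE: "AE t in lborel. ?F t = ?G t"
    by eventually_elim (simp add: cross_product_def exp_quat_i exp_quat_j mult.assoc)
  have "?G \<in> borel_measurable borel" by measurable
  from integral_mu_AE[OF this AE]
  have "wigner f g z = mu_const TYPE((real^'d) \<times> (real^'d)) *\<^sub>R integral\<^sup>L lborel ?G"
    by (simp add: wigner_def z)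
  also have "integral\<^sup>L lborel ?G = W z"
    by (simp add: W_def z left_fourier_partial_wigner)
  also have "mu_const TYPE((real^'d) \<times> (real^'d)) = 1 / (2 * pi) ^ CARD('d)"
    by (simp add: mu_const_def powr_realpow)
  finally show ?thesis .
qed

text \<open>Two corrections on null sets: each real component is replaced by a Borel function, and
  then the function is set to 0 on slices of infinite square integral. By Tonelli these slices lie
  over a null set of first coordinates.\<close>

lemma L2_borel_representative:
  fixes f :: "'v::euclidean_space \<times> 'v \<Rightarrow> quat"
  assumes "f \<in> L2"
  shows "\<exists>f'. sq_int f' \<and> (\<forall>y. sq_int (slice f' y)) \<and> (AE y in lborel. f y = f' y)"
proof -
  have f: "f \<in> borel_measurable lebesgue" and fi: "integrable mu (\<lambda>x. (norm (f x))\<^sup>2)"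
    using assms by (auto simp: L2_def measurable_mu)
  have sel: "\<exists>h\<in>borel_measurable lborel. AE y in lborel. s (f y) = h y" if "bounded_linear s" for s :: "quat \<Rightarrow> real"
  proof -
    have "s \<in> borel_measurable borel"
      using that by (intro borel_measurable_continuous_onI linear_continuous_on)
    then have "(\<lambda>y. s (f y)) \<in> borel_measurable lebesgue"
      by (rule measurable_compose[OF f])
    then show ?thesis by (rule completion_ex_borel_measurable_real)
  qed
  obtain a b c e where m[measurable]: "a \<in> borel_measurable borel" "b \<in> borel_measurable borel"
      "c \<in> borel_measurable borel" "e \<in> borel_measurable borel"
    and ae: "AE y in lborel. qRe (f y) = a y" "AE y in lborel. qI (f y) = b y"
      "AE y in lborel. qJ (f y) = c y" "AE y in lborel. qK (f y) = e y"
    using sel[OF bounded_linear_quat_sel(1)] sel[OF bounded_linear_quat_sel(2)]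
      sel[OF bounded_linear_quat_sel(3)] sel[OF bounded_linear_quat_sel(4)] by auto
  define f1 where "f1 y = a y *\<^sub>R 1 + b y *\<^sub>R quat_i + c y *\<^sub>R quat_j + e y *\<^sub>R quat_k" for y
  have [measurable]: "f1 \<in> borel_measurable borel" unfolding f1_def by measurable
  have eq1: "AE y in lborel. f y = f1 y"
    using ae by eventually_elim (simp add: f1_def quat_eq_iff quat_i_def quat_j_def quat_k_def)
  have "square_integral f1 < \<infinity>"
  proof -
    have "(\<integral>\<^sup>+y. ennreal ((norm (f y))\<^sup>2) \<partial>mu) < \<infinity>"
      using fi by (simp add: integrable_iff_bounded)
    then have "ennreal (mu_const TYPE('v \<times> 'v)) * (\<integral>\<^sup>+y. ennreal ((norm (f y))\<^sup>2) \<partial>lborel) < \<infinity>"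
      using f by (subst (asm) nn_integral_mu) auto
    then have "(\<integral>\<^sup>+y. ennreal ((norm (f y))\<^sup>2) \<partial>lborel) < \<infinity>"
      using mu_const_pos[where 'a="'v \<times> 'v"] by (auto simp: ennreal_mult_less_top)
    also have "(\<integral>\<^sup>+y. ennreal ((norm (f y))\<^sup>2) \<partial>lborel) = square_integral f1"
      unfolding square_integral_def using eq1 by (intro nn_integral_cong_AE) auto
    finally show ?thesis .
  qed
  have f1p[measurable]: "f1 \<in> borel_measurable (borel \<Otimes>\<^sub>M borel)"
    by (simp add: borel_prod)
  have sm[measurable]: "(\<lambda>y. square_integral (slice f1 y)) \<in> borel_measurable borel"
    unfolding square_integral_def slice_def by measurable
  have "(\<integral>\<^sup>+y. square_integral (slice f1 y) \<partial>lborel) = square_integral f1"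
    unfolding square_integral_def slice_def by (subst nn_integral_lborel_pair(1)) simp_all
  then have "AE y in lborel. square_integral (slice f1 y) \<noteq> \<infinity>"
    using \<open>square_integral f1 < \<infinity>\<close> by (intro nn_integral_PInf_AE) auto
  then have slices: "AE x in lborel. AE y in (lborel :: 'v measure). square_integral (slice f1 (fst (x, y))) \<noteq> \<infinity>"
    by eventually_elim simp
  have "AE z in lborel \<Otimes>\<^sub>M (lborel :: 'v measure). square_integral (slice f1 (fst z)) \<noteq> \<infinity>"
  proof (intro lborel_pair.AE_pair_measure)
    show "{z \<in> space (lborel \<Otimes>\<^sub>M lborel). square_integral (slice f1 (fst z)) \<noteq> \<infinity>} \<in> sets (lborel \<Otimes>\<^sub>M lborel)"
      by measurable
  qed (rule slices)
  then have fin: "AE z in (lborel :: ('v \<times> 'v) measure). square_integral (slice f1 (fst z)) \<noteq> \<infinity>"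
    by (simp only: lborel_prod)
  define f' where "f' z = (if square_integral (slice f1 (fst z)) \<noteq> \<infinity> then f1 z else 0)" for z
  have eq: "AE z in lborel. f z = f' z"
    using eq1 fin by eventually_elim (simp add: f'_def)
  note [measurable] = borel_measurable_fst_snd
  have "f' \<in> borel_measurable borel" unfolding f'_def by measurable
  moreover have "square_integral f' \<le> square_integral f1"
    unfolding square_integral_def f'_def by (intro nn_integral_mono) auto
  moreover have "sq_int (slice f' y)" for y
  proof (cases "square_integral (slice f1 y) = \<infinity>")
    case True
    then have "slice f' y = (\<lambda>_. 0)" by (auto simp: slice_def f'_def)
    then show ?thesis by (simp add: sq_int_def square_integral_def)
  next
    case False
    then have "slice f' y = slice f1 y" by (auto simp: slice_def f'_def)
    moreover have "slice f1 y \<in> borel_measurable borel" unfolding slice_def by measurable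
    ultimately show ?thesis using False by (simp add: sq_int_def less_top)
  qed
  ultimately show ?thesis
    using eq \<open>square_integral f1 < \<infinity>\<close> unfolding sq_int_def by (intro exI[of _ f']) (auto intro: le_less_trans)
qed


section \<open>From even exponents to all exponents\<close>

lemma measure_lower_bound_of_concentration:
  fixes F :: "'a \<Rightarrow> real"
  assumes U: "U \<in> sets M" "emeasure M U < \<infinity>"
    and F: "integrable M F" "integrable M (\<lambda>x. F x ^ k)" "\<And>x. 0 \<le> F x"
    and S: "0 < S" "(\<integral>x. F x ^ k \<partial>M) \<le> K * S ^ k"
    and \<delta>: "0 < \<delta>" "\<delta> * S \<le> (LINT x:U|M. F x)" and k: "1 \<le> k"
  shows "0 < measure M U" and "\<delta> ^ k \<le> K * measure M U ^ (k - 1)"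
proof -
  let ?m = "measure M U"
  have "0 < \<delta> * S" using \<delta> S by simp
  show m: "0 < ?m"
  proof (rule ccontr)
    assume "\<not> 0 < ?m"
    then have "?m = 0" using measure_nonneg[of M U] by linarith
    moreover have "emeasure M U = ennreal ?m"
      using U by (intro emeasure_eq_ennreal_measure) auto
    ultimately have "U \<in> null_sets M"
      using U by (intro null_setsI) auto
    then have "(LINT x:U|M. F x) = 0"
      unfolding set_lebesgue_integral_def
      by (intro integral_eq_zero_AE) (auto dest!: AE_not_in elim!: eventually_mono)
    with \<open>0 < \<delta> * S\<close> \<delta> show False by simp
  qed
  \<comment> \<open>The height of a function constant on U with integral
    \<open>\<delta> * S\<close>. For the tangent at this height the constant term integrates over U
    to \<open>\<delta> * S * (1 - 1 / k)\<close>, leaving \<open>\<delta> * S / k\<close> to be paid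
    by the k-th power.\<close>
  define l where "l = \<delta> * S / ?m"
  have l: "0 < l" using m \<open>0 < \<delta> * S\<close> by (simp add: l_def)
  have k0: "0 < real k" using k by simp
  have tangent: "F x \<le> l * (1 - 1 / k) + F x ^ k / (k * l ^ (k - 1))" for x
  proof -
    have lk: "l ^ k = l * l ^ (k - 1)" using k by (simp flip: power_Suc)
    have "1 + k * (F x / l - 1) \<le> (1 + (F x / l - 1)) ^ k"
      using F(3)[of x] l by (intro Bernoulli_inequality) simp
    then have "l * (1 + k * (F x / l - 1)) \<le> l * (F x / l) ^ k"
      using l by simp
    then have "l + k * F x - k * l \<le> F x ^ k / l ^ (k - 1)"
      using l by (simp add: power_divide lk algebra_simps)
    then have "(l + k * F x - k * l) / k \<le> F x ^ k / l ^ (k - 1) / k"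
      using k0 by (intro divide_right_mono) auto
    then show ?thesis using k0 by (simp add: field_simps)
  qed
  have int1: "integrable M (\<lambda>x. indicator U x * (l * (1 - 1 / k)))"
    using U by (intro integrable_mult_left) (auto simp: less_top)
  have int2: "integrable M (\<lambda>x. F x ^ k / (k * l ^ (k - 1)))"
    using F(2) by simp
  have "\<delta> * S \<le> (\<integral>x. indicator U x * F x \<partial>M)"
    using \<delta> by (simp add: set_lebesgue_integral_def)
  also have "\<dots> \<le> (\<integral>x. indicator U x * (l * (1 - 1 / k)) + F x ^ k / (k * l ^ (k - 1)) \<partial>M)"
  proof (rule integral_mono)
    show "integrable M (\<lambda>x. indicator U x * F x)"
      using integrable_mult_indicator[OF U(1) F(1)] by simp
    show "indicator U x * F x \<le> indicator U x * (l * (1 - 1 / k)) + F x ^ k / (k * l ^ (k - 1))" for x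
      using tangent[of x] F(3)[of x] l by (auto simp: indicator_def)
  qed (intro Bochner_Integration.integrable_add int1 int2)
  also have "\<dots> = ?m * (l * (1 - 1 / k)) + (\<integral>x. F x ^ k \<partial>M) / (k * l ^ (k - 1))"
    using int1 int2 U by (simp add: Bochner_Integration.integral_add)
  also have "\<dots> \<le> ?m * (l * (1 - 1 / k)) + K * S ^ k / (k * l ^ (k - 1))"
    using S l by (intro add_left_mono divide_right_mono) auto
  also have "?m * (l * (1 - 1 / k)) = \<delta> * S * (1 - 1 / k)"
    using m by (simp add: l_def)
  finally have "\<delta> * S / k \<le> K * S ^ k / (k * l ^ (k - 1))"
    by (simp add: algebra_simps)
  then have "\<delta> * S * l ^ (k - 1) \<le> K * S ^ k"
    using k0 l by (simp add: field_simps)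
  then have "\<delta> * S * (\<delta> * S) ^ (k - 1) \<le> K * S ^ k * ?m ^ (k - 1)"
    using m by (simp add: l_def power_divide field_simps)
  moreover have "\<delta> * S * (\<delta> * S) ^ (k - 1) = \<delta> ^ k * S ^ k"
    using k by (simp flip: power_Suc power_mult_distrib)
  ultimately have "\<delta> ^ k * S ^ k \<le> (K * ?m ^ (k - 1)) * S ^ k"
    by (simp add: mult_ac)
  then show "\<delta> ^ k \<le> K * ?m ^ (k - 1)"
    using S by (simp add: mult_le_cancel_right_pos)
qed

text \<open>Up to the factor 2d, the two sides are the logarithms of the constant in the asserted
  bound and of k^(2d/(k-1)), its counterpart for the exponent 2k. As p tends to 2 the left side
  tends to ln 2, which is the right side for k = 2, so the estimate must be exact there. For large p
  the left side is about half of the right, and crude estimates suffice.\<close>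

lemma Lieb_exponent_le:
  fixes p :: real
  assumes "2 < p"
  shows "\<exists>k\<ge>2. p \<le> 2 * real k \<and> (ln (p / 4) + (p - 1) * ln (p / (p - 1))) / (p - 2) \<le> ln (real k) / (real k - 1)"
proof (cases "p \<le> 4")
  case True
  \<comment> \<open>The two arguments at which ln x \<le> x - 1 is used, p/2 and p/(2(p-1)), both
    equal 1 at p = 2, so nothing is lost in that limit, and the two upper bounds cancel.\<close>
  have "ln (p / 2) \<le> p / 2 - 1"
    using assms by (intro ln_le_minus_one) simp
  moreover have "(p - 1) * ln (p / (2 * (p - 1))) \<le> (p - 1) * (p / (2 * (p - 1)) - 1)"
    using assms by (intro mult_left_mono ln_le_minus_one) auto
  moreover have "(p - 1) * (p / (2 * (p - 1)) - 1) = 1 - p / 2"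
    using assms by (simp add: field_simps)
  ultimately have "ln (p / 2) + (p - 1) * ln (p / (2 * (p - 1))) \<le> 0"
    by linarith
  moreover have "ln (p / 4) = ln (p / 2) - ln 2"
    using assms ln_div[of "p / 2" 2] by simp
  moreover have "ln (p / (p - 1)) = ln (p / (2 * (p - 1))) + ln 2"
    using assms ln_mult[of 2 "p - 1"] by (simp add: ln_div del: ln_mult)
  ultimately have "ln (p / 4) + (p - 1) * ln (p / (p - 1)) \<le> ln 2 * (p - 2)"
    by (simp add: algebra_simps)
  then have "(ln (p / 4) + (p - 1) * ln (p / (p - 1))) / (p - 2) \<le> ln (real 2) / (real 2 - 1)"
    using assms by (simp add: divide_le_eq)
  then show ?thesis using True by (intro exI[of _ 2]) auto
next
  case False
  define k where "k = nat \<lceil>p / 2\<rceil>"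
  have k: "p / 2 \<le> real k" "real k < p / 2 + 1"
    using False by (auto simp: k_def) linarith+
  have "(p - 1) * ln (p / (p - 1)) \<le> (p - 1) * (p / (p - 1) - 1)"
    using assms by (intro mult_left_mono ln_le_minus_one) auto
  also have "\<dots> = 1" using assms by (simp add: field_simps)
  finally have num: "ln (p / 4) + (p - 1) * ln (p / (p - 1)) \<le> ln (p / 4) + 1" by simp
  have ln3: "1 \<le> ln (3::real)"
    using exp_le by (subst ln_ge_iff) auto
  have "(ln (p / 4) + 1) / (p - 2) \<le> ln (real k) / (real k - 1)"
  proof (cases "p \<le> 6")
    case True
    have "k = 3" using k False True by linarith
    have "(ln (p / 4) + 1) / (p - 2) \<le> (p / 4) / (p - 2)"
      using False ln_le_minus_one[of "p / 4"] by (intro divide_right_mono) auto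
    also have "\<dots> \<le> 1 / 2" using False by (simp add: field_simps)
    also have "\<dots> \<le> ln (real k) / (real k - 1)" using ln3 \<open>k = 3\<close> by simp
    finally show ?thesis .
  next
    case False
    define y where "y = p / 2"
    have y: "3 < y" "p = 2 * y" using False by (auto simp: y_def)
    have "1 \<le> ln y" using ln3 y ln_le_cancel_iff[of 3 y] by linarith
    have "y * (1 - ln 2) \<le> (y - 2) * 1"
    proof -
      \<comment> \<open>The case distinction at p = 6 is what lets y ln 2 \<ge> 2 follow from ln 2
        \<ge> 2/3.\<close>
      have "3 * (2 / 3) \<le> y * ln 2" using ln2_ge_two_thirds y by (intro mult_mono) auto
      then show ?thesis using y by (simp add: algebra_simps)
    qed
    also have "\<dots> \<le> (y - 2) * ln y" using y \<open>1 \<le> ln y\<close> by (intro mult_left_mono) auto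
    finally have "y * (ln y - ln 2 + 1) \<le> 2 * (y - 1) * ln y" by (simp add: algebra_simps)
    then have "(ln y - ln 2 + 1) / (2 * (y - 1)) \<le> ln y / y"
      using y by (simp add: field_simps)
    \<comment> \<open>Rounding up is harmless since k - 1 \<le> y \<le> k: the numerator grows and
      the denominator shrinks.\<close>
    also have "\<dots> \<le> ln (real k) / (real k - 1)"
    proof (rule frac_le)
      have "y \<le> real k" using k(1) by (simp add: y_def)
      then show "ln y \<le> ln (real k)" "0 \<le> ln (real k)" "0 < real k - 1"
        using y(1) by simp_all
      show "real k - 1 \<le> y" using k(2) by (simp add: y_def)
    qed
    finally have "(ln y - ln 2 + 1) / (2 * (y - 1)) \<le> ln (real k) / (real k - 1)" .
    moreover have "ln (p / 4) = ln y - ln 2"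
      using y by (simp add: ln_div)
    moreover have "p - 2 = 2 * (y - 1)" using y by simp
    ultimately show ?thesis by (simp only:)
  qed
  moreover have "(ln (p / 4) + (p - 1) * ln (p / (p - 1))) / (p - 2) \<le> (ln (p / 4) + 1) / (p - 2)"
    using num assms by (intro divide_right_mono) auto
  ultimately show ?thesis
    using k False by (intro exI[of _ k]) auto
qed

text \<open>In logarithms, \<open>bound\<close> says that ln m is at least k/(k-1) ln \<delta> + 2d
  ln k/(k-1). Since p \<le> 2k, the exponent p/(p-2) is at least k/(k-1), and with ln \<delta> \<le>
  0 this only lowers the first term; the second is handled by
  \<open>Lieb_exponent_le\<close>.\<close>

lemma C_const_bound:
  fixes m \<delta> p q :: real
  assumes p: "2 < p" and q: "1 / p + 1 / q = 1" and \<delta>: "0 < \<delta>" "\<delta> \<le> 1" and m: "0 < m"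
    and bound: "\<And>k. 2 \<le> k \<Longrightarrow> \<delta> ^ k * real k ^ (2 * d) \<le> m ^ (k - 1)"
  shows "\<delta> powr (p / (p - 2)) * C_const d p q powr (2 * p / (2 - p)) \<le> m"
proof -
  obtain k where k: "2 \<le> k" "p \<le> 2 * real k"
    and le: "(ln (p / 4) + (p - 1) * ln (p / (p - 1))) / (p - 2) \<le> ln (real k) / (real k - 1)"
    using Lieb_exponent_le[OF p] by auto
  have q1: "1 / q = (p - 1) / p" using q p by (simp add: field_simps)
  have C: "0 < C_const d p q" unfolding C_const_def q1 using p by simp
  have lnC: "ln (C_const d p q) = - (d / p * (ln (p / 4) + (p - 1) * ln (p / (p - 1))))"
  proof -
    have "ln (C_const d p q) = d / p * ln (4 / p) + d * ((p - 1) / p) * ln ((p - 1) / p)"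
      using p q1 by (simp add: C_const_def ln_mult ln_powr divide_inverse)
    moreover have "ln (4 / p) = - ln (p / 4)" "ln ((p - 1) / p) = - ln (p / (p - 1))"
      using p by (simp_all add: ln_div)
    ultimately have "ln (C_const d p q) = d / p * - ln (p / 4) + d * ((p - 1) / p) * - ln (p / (p - 1))"
      by (simp only:)
    then show ?thesis using p by (simp add: algebra_simps diff_divide_distrib add_divide_distrib)
  qed
  have "2 * p / (2 - p) * ln (C_const d p q) = 2 * d * ((ln (p / 4) + (p - 1) * ln (p / (p - 1))) / (p - 2))"
  proof -
    have "2 * p / (2 - p) = - (2 * p / (p - 2))" using p by (simp add: field_simps)
    then show ?thesis unfolding lnC using p by (simp add: field_simps)
  qed
  also have "\<dots> \<le> 2 * d * (ln (real k) / (real k - 1))"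
    using le by (intro mult_left_mono) auto
  finally have 1: "2 * p / (2 - p) * ln (C_const d p q) \<le> 2 * d * (ln (real k) / (real k - 1))" .
  have 2: "p / (p - 2) * ln \<delta> \<le> real k / (real k - 1) * ln \<delta>"
  proof (rule mult_right_mono_neg)
    show "real k / (real k - 1) \<le> p / (p - 2)" using k p by (simp add: field_simps)
    show "ln \<delta> \<le> 0" using \<delta> by simp
  qed
  have "ln (\<delta> ^ k * real k ^ (2 * d)) \<le> ln (m ^ (k - 1))"
    using bound[OF k(1)] \<delta> k m by (subst ln_le_cancel_iff) auto
  then have "real k * ln \<delta> + 2 * d * ln (real k) \<le> (real k - 1) * ln m"
    using \<delta> k m by (simp add: ln_mult ln_realpow of_nat_diff)
  then have "(real k * ln \<delta> + 2 * d * ln (real k)) / (real k - 1) \<le> ln m"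
    using k by (simp add: divide_le_eq mult.commute)
  then have 3: "real k / (real k - 1) * ln \<delta> + 2 * d * (ln (real k) / (real k - 1)) \<le> ln m"
    by (simp add: add_divide_distrib)
  have "ln (\<delta> powr (p / (p - 2)) * C_const d p q powr (2 * p / (2 - p))) =
    p / (p - 2) * ln \<delta> + 2 * p / (2 - p) * ln (C_const d p q)"
    using \<delta> C by (simp add: ln_mult ln_powr)
  also have "\<dots> \<le> ln m" using 1 2 3 by linarith
  finally show ?thesis
    using \<delta> C m by (subst (asm) ln_le_cancel_iff) auto
qed


section \<open>The concentration bound\<close>

lemma Lieb_const_eq:
  fixes d k :: nat and P N :: real
  assumes "0 < P"
  shows "1 / P ^ (2 * d) * ((1 / P ^ (2 * d)) ^ k * ((((4 ^ d) ^ k * P ^ d * (1 / (4 * real k) ^ d)))\<^sup>2 * N ^ k)) =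
    (4 ^ d) ^ (2 * k) / (4 * real k) ^ (2 * d) * (N / P ^ (2 * d)) ^ k"
  using assms by (simp add: power_divide power_mult_distrib power_mult[symmetric] mult_ac)

lemma ennreal_mult3:
  assumes "0 \<le> a" "0 \<le> b" "0 \<le> c"
  shows "ennreal (a * b * c) = ennreal a * ennreal b * ennreal c"
  using assms by (simp add: ennreal_mult)

lemma ennreal_mult_power4:
  assumes "0 \<le> a" "0 \<le> b" "0 \<le> c" "0 \<le> e"
  shows "ennreal a * (ennreal b * ((ennreal c) ^ j * (ennreal e) ^ l)) = ennreal (a * (b * (c ^ j * e ^ l)))"
  using assms by (simp add: ennreal_mult ennreal_power)

text \<open>Being nonzero is meant up to null sets, as for elements of L2. The bound \<epsilon>
  \<le> 1 makes the base of the real power nonnegative, and \<open>emeasure\<close> admits sets of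
  infinite measure.\<close>

theorem corollary4:
  fixes f g :: "(real^'d) \<times> (real^'d) \<Rightarrow> quat"
    and U :: "(((real^'d) \<times> (real^'d)) \<times> ((real^'d) \<times> (real^'d))) set"
    and \<epsilon> :: real
  assumes "f \<in> L2" and "g \<in> L2"
    and "\<not> (AE x in mu. f x = 0)" and "\<not> (AE x in mu. g x = 0)"
    and "U \<in> sets mu"
    and "0 \<le> \<epsilon>" and "\<epsilon> \<le> 1"
    and "eps_concentrated \<epsilon> U (wigner f g)"
  shows "\<forall>p>2. \<forall>q. 1 / p + 1 / q = 1 \<longrightarrow>
    emeasure mu U \<ge> ennreal (1 / 2 ^ (4 * CARD('d)) * (1 - \<epsilon>\<^sup>2) powr (p / (p - 2))
      * C_const CARD('d) p q powr (2 * p / (2 - p)))"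
proof (intro allI impI)
  fix p q :: real assume p: "2 < p" and q: "1 / p + 1 / q = 1"
  let ?d = "CARD('d)" and ?P = "2 * pi"
  let ?\<delta> = "1 - \<epsilon>\<^sup>2"
  obtain f' where f': "sq_int f'" "\<And>y. sq_int (slice f' y)" "AE y in lborel. f y = f' y"
    using L2_borel_representative[OF assms(1)] by blast
  obtain g' where g': "sq_int g'" "\<And>y. sq_int (slice g' y)" "AE y in lborel. g y = g' y"
    using L2_borel_representative[OF assms(2)] by blast
  have wp: "wigner_pair f' g'" using f' g' by unfold_locales auto
  interpret wigner_pair f' g' by (rule wp)
  have nz: "square_integral h' \<noteq> 0" if "sq_int h'" "AE y in lborel. h y = h' y" "\<not> (AE x in mu. h x = 0)"
    for h h' :: "(real^'d) \<times> (real^'d) \<Rightarrow> quat"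
  proof
    assume "square_integral h' = 0"
    then have "AE y in lborel. h' y = 0"
      using that(1) unfolding square_integral_def sq_int_def by (subst (asm) nn_integral_0_iff_AE) auto
    with that(2) have "AE y in lborel. h y = 0" by eventually_elim simp
    with that(3) show False by (simp add: AE_mu_iff)
  qed
  define N where "N = enn2real (square_integral f' * square_integral g')"
  have fin: "square_integral f' * square_integral g' < \<infinity>" using f' g' by (simp add: sq_int_def ennreal_mult_less_top)
  then have N: "square_integral f' * square_integral g' = ennreal N" by (simp add: N_def less_top)
  have "square_integral f' * square_integral g' \<noteq> 0" using nz[OF f'(1,3) assms(3)] nz[OF g'(1,3) assms(4)] by simp
  then have "0 < N" unfolding N by (simp add: not_le ennreal_eq_0_iff)
  define F where "F z = (norm (wigner f g z))\<^sup>2" for z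
  \<comment> \<open>The product of the squared norms of f and g for the normalised measure, and by
    Plancherel the integral of F.\<close>
  define S where "S = N / ?P ^ (2 * ?d)"
  have S: "0 < S" using \<open>0 < N\<close> by (simp add: S_def)
  have F_eq: "F z = 1 / ?P ^ (2 * ?d) * (norm (W z))\<^sup>2" for z
    unfolding F_def wigner_eq_W[OF wp f'(3) g'(3)]
    by (simp add: power_mult_distrib power_divide power_mult[symmetric] mult.commute)
  note [measurable] = W_measurable
  have Fb[measurable]: "F \<in> borel_measurable borel" unfolding F_eq[abs_def] by measurable
  have Fl: "(\<lambda>z. F z ^ k) \<in> borel_measurable lebesgue" for k
    by (rule measurable_completion) simp
  have F0: "0 \<le> F z" for z by (simp add: F_def)
  have const: "mu_const TYPE(((real^'d) \<times> (real^'d)) \<times> ((real^'d) \<times> (real^'d))) = 1 / ?P ^ (2 * ?d)"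
  proof -
    have "DIM(((real^'d) \<times> (real^'d)) \<times> ((real^'d) \<times> (real^'d))) = 4 * ?d" by simp
    moreover have "real (4 * ?d) / 2 = real (2 * ?d)" by simp
    moreover have "?P powr real (2 * ?d) = ?P ^ (2 * ?d)" by (rule powr_realpow) simp
    ultimately show ?thesis by (simp only: mu_const_def)
  qed
  have nn: "(\<integral>\<^sup>+z. ennreal (F z ^ k) \<partial>mu) =
    ennreal (1 / ?P ^ (2 * ?d)) * (ennreal ((1 / ?P ^ (2 * ?d)) ^ k) * (\<integral>\<^sup>+z. ennreal ((norm (W z))\<^sup>2) ^ k \<partial>lborel))" for k
  proof -
    have "(\<integral>\<^sup>+z. ennreal (F z ^ k) \<partial>mu) = ennreal (1 / ?P ^ (2 * ?d)) * (\<integral>\<^sup>+z. ennreal (F z ^ k) \<partial>lborel)"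
      unfolding const[symmetric] using Fl by (intro nn_integral_mu) auto
    also have "(\<integral>\<^sup>+z. ennreal (F z ^ k) \<partial>lborel) = (\<integral>\<^sup>+z. ennreal ((1 / ?P ^ (2 * ?d)) ^ k) * ennreal ((norm (W z))\<^sup>2) ^ k \<partial>lborel)"
    proof (rule nn_integral_cong)
      fix z
      have "F z ^ k = (1 / ?P ^ (2 * ?d)) ^ k * ((norm (W z))\<^sup>2) ^ k"
        unfolding F_eq by (rule power_mult_distrib)
      then show "ennreal (F z ^ k) = ennreal ((1 / ?P ^ (2 * ?d)) ^ k) * ennreal ((norm (W z))\<^sup>2) ^ k"
        by (simp only: ennreal_power zero_le_power2) (rule ennreal_mult, simp_all)
    qed
    also have "\<dots> = ennreal ((1 / ?P ^ (2 * ?d)) ^ k) * (\<integral>\<^sup>+z. ennreal ((norm (W z))\<^sup>2) ^ k \<partial>lborel)"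
      by (rule nn_integral_cmult) measurable
    finally show ?thesis .
  qed
  have nn1: "(\<integral>\<^sup>+z. ennreal (F z) \<partial>mu) = ennreal S"
  proof -
    have "(\<integral>\<^sup>+z. ennreal (F z) \<partial>mu) = ennreal (1 / ?P ^ (2 * ?d)) * (ennreal (1 / ?P ^ (2 * ?d)) * ((ennreal (?P ^ ?d))\<^sup>2 * ennreal N))"
      using nn[of 1] W_square by (simp add: N)
    also have "\<dots> = ennreal (1 / ?P ^ (2 * ?d) * (1 / ?P ^ (2 * ?d) * ((?P ^ ?d)\<^sup>2 * N)))"
      using \<open>0 < N\<close> ennreal_mult_power4[of "1 / ?P ^ (2 * ?d)" "1 / ?P ^ (2 * ?d)" "?P ^ ?d" N 2 1] by simp
    also have "1 / ?P ^ (2 * ?d) * (1 / ?P ^ (2 * ?d) * ((?P ^ ?d)\<^sup>2 * N)) = S"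
    proof -
      have "?P ^ (2 * ?d) = (?P ^ ?d)\<^sup>2" by (simp add: power_even_eq)
      moreover have "?P ^ ?d \<noteq> 0" by simp
      ultimately show ?thesis unfolding S_def by (simp only:) (simp add: field_simps)
    qed
    finally show ?thesis .
  qed
  \<comment> \<open>The square of \<open>Lieb_const k\<close> freed from its powers of 2 pi, which
    are absorbed by the normalisations of F and \<open>mu\<close> and by
    \<open>S ^ k\<close>.\<close>
  let ?K = "\<lambda>k. (4 ^ ?d) ^ (2 * k) / (4 * real k) ^ (2 * ?d)"
  have nnk: "(\<integral>\<^sup>+z. ennreal (F z ^ k) \<partial>mu) \<le> ennreal (?K k * S ^ k)" if "0 < k" for k
  proof -
    have hc: "Lieb_const k = ennreal ((4 ^ ?d) ^ k * ?P ^ ?d * (1 / (4 * real k) ^ ?d))"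
    proof -
      have "((4::ennreal) ^ ?d) ^ k = ennreal ((4 ^ ?d) ^ k)"
        by (simp add: ennreal_power[symmetric])
      then show ?thesis
        unfolding Lieb_const_def by (subst ennreal_mult3) simp_all
    qed
    have "(\<integral>\<^sup>+z. ennreal (F z ^ k) \<partial>mu) \<le>
      ennreal (1 / ?P ^ (2 * ?d)) * (ennreal ((1 / ?P ^ (2 * ?d)) ^ k) * ((Lieb_const k)\<^sup>2 * ennreal N ^ k))"
      unfolding nn N[symmetric] by (intro mult_left_mono W_power_le that) auto
    also have "\<dots> = ennreal (1 / ?P ^ (2 * ?d) * ((1 / ?P ^ (2 * ?d)) ^ k * ((((4 ^ ?d) ^ k * ?P ^ ?d * (1 / (4 * real k) ^ ?d)))\<^sup>2 * N ^ k)))"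
      unfolding hc using \<open>0 < N\<close> by (intro ennreal_mult_power4) auto
    also have "\<dots> = ennreal (?K k * S ^ k)"
      unfolding S_def by (subst Lieb_const_eq) auto
    finally show ?thesis .
  qed
  have Fint: "integrable mu (\<lambda>z. F z ^ k)" if "0 < k" for k
  proof (rule integrableI_bounded)
    show "(\<lambda>z. F z ^ k) \<in> borel_measurable mu" using Fl by (simp add: measurable_mu)
    show "(\<integral>\<^sup>+z. ennreal (norm (F z ^ k)) \<partial>mu) < \<infinity>"
      using nnk[OF that] F0 by (simp add: le_less_trans)
  qed
  have Fint1: "integrable mu F" using Fint[of 1] by simp
  have int1: "(\<integral>z. F z \<partial>mu) = S"
    using nn_integral_eq_integral[OF Fint1] F0 nn1 S by (simp add: ennreal_inj Bochner_Integration.integral_nonneg)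
  have intk: "(\<integral>z. F z ^ k \<partial>mu) \<le> ?K k * S ^ k" if "0 < k" for k
    using nn_integral_eq_integral[OF Fint[OF that]] F0 nnk[OF that] S by (simp add: ennreal_le_iff)
  have U: "U \<in> sets mu" by fact
  have "sqrt (LINT z:(- U)|mu. F z) \<le> \<epsilon> * sqrt S"
    using assms(8) by (simp add: eps_concentrated_def norm2_def F_def[symmetric] int1)
  then have "(LINT z:(- U)|mu. F z) \<le> (\<epsilon> * sqrt S)\<^sup>2"
    by (rule sqrt_le_D)
  then have out: "(LINT z:(- U)|mu. F z) \<le> \<epsilon>\<^sup>2 * S"
    using S by (simp add: power_mult_distrib)
  have spl: "(LINT z:U|mu. F z) + (LINT z:(- U)|mu. F z) = S"
  proof -
    have U': "- U \<in> sets mu" using U sets.compl_sets[of U mu] by (simp add: Compl_eq_Diff_UNIV mu_def)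
    have i: "integrable mu (\<lambda>z. indicator U z *\<^sub>R F z)" "integrable mu (\<lambda>z. indicator (- U) z *\<^sub>R F z)"
      by (rule integrable_mult_indicator[OF U Fint1]) (rule integrable_mult_indicator[OF U' Fint1])
    have "(LINT z:U|mu. F z) + (LINT z:(- U)|mu. F z) = (\<integral>z. indicator U z *\<^sub>R F z + indicator (- U) z *\<^sub>R F z \<partial>mu)"
      unfolding set_lebesgue_integral_def by (rule Bochner_Integration.integral_add[OF i, symmetric])
    also have "\<dots> = (\<integral>z. F z \<partial>mu)"
      by (intro Bochner_Integration.integral_cong) (auto simp: indicator_def)
    finally show ?thesis using int1 by simp
  qed
  have inside: "?\<delta> * S \<le> (LINT z:U|mu. F z)" using out spl by (simp add: algebra_simps)
  show "ennreal (1 / 2 ^ (4 * ?d) * ?\<delta> powr (p / (p - 2)) * C_const ?d p q powr (2 * p / (2 - p))) \<le> emeasure mu U"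
  proof (cases "emeasure mu U = \<infinity> \<or> ?\<delta> = 0")
    \<comment> \<open>If \<open>1 - \<epsilon>\<^sup>2\<close> is 0, so is its real power, and the
      bound reads 0.\<close>
    case True
    then show ?thesis by auto
  next
    case False
    have "\<epsilon>\<^sup>2 \<le> 1" using assms(6,7) by (simp add: power_le_one)
    with False have \<delta>: "0 < ?\<delta>" "?\<delta> \<le> 1" by auto
    have Ufin: "emeasure mu U < \<infinity>" using False by (simp add: less_top)
    let ?m = "measure mu U"
    note lower = measure_lower_bound_of_concentration[OF U Ufin Fint1 Fint F0 S intk \<delta>(1) inside]
    have m: "0 < ?m" using lower(1)[of 1] by simp
    have "?\<delta> powr (p / (p - 2)) * C_const ?d p q powr (2 * p / (2 - p)) \<le> 2 ^ (4 * ?d) * ?m"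
    proof (rule C_const_bound[OF p q \<delta>])
      show "0 < 2 ^ (4 * ?d) * ?m" using m by simp
      fix k :: nat assume k: "2 \<le> k"
      have "?\<delta> ^ k \<le> ?K k * ?m ^ (k - 1)" using lower(2)[of k] k by simp
      then have "?\<delta> ^ k * real k ^ (2 * ?d) \<le> ?K k * ?m ^ (k - 1) * real k ^ (2 * ?d)"
        by (rule mult_right_mono) simp
      also have "\<dots> = (2 ^ (4 * ?d) * ?m) ^ (k - 1)"
      proof -
        \<comment> \<open>Of the 2k factors 4^d, 2(k - 1) form the power of 2^(4d) that joins the
          measure, and the remaining two cancel the 4 in (4k)^(2d). This is the origin of the
          constant 2^(-4d).\<close>
        have "(4 ^ ?d) ^ (2 * k) = ((2::real) ^ (4 * ?d)) ^ (k - 1) * 4 ^ (2 * ?d)"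
        proof -
          have "(2::real) ^ (4 * ?d) = 2 ^ (2 * (2 * ?d))" by simp
          also have "\<dots> = 4 ^ (2 * ?d)" by (subst power_mult) simp
          finally have "((2::real) ^ (4 * ?d)) ^ (k - 1) * 4 ^ (2 * ?d) = (4 ^ (2 * ?d)) ^ (k - 1) * 4 ^ (2 * ?d)"
            by (simp only:)
          also have "\<dots> = (4 ^ (2 * ?d)) ^ Suc (k - 1)" by simp
          also have "\<dots> = (4 ^ ?d) ^ (2 * k)" using k by (simp flip: power_mult add: mult_ac)
          finally show ?thesis ..
        qed
        then show ?thesis using k by (simp add: power_mult_distrib field_simps)
      qed
      finally show "?\<delta> ^ k * real k ^ (2 * ?d) \<le> (2 ^ (4 * ?d) * ?m) ^ (k - 1)" .
    qed
    then have "1 / 2 ^ (4 * ?d) * (?\<delta> powr (p / (p - 2)) * C_const ?d p q powr (2 * p / (2 - p))) \<le> ?m"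
      by (simp add: divide_le_eq mult.commute)
    then have "ennreal (1 / 2 ^ (4 * ?d) * ?\<delta> powr (p / (p - 2)) * C_const ?d p q powr (2 * p / (2 - p))) \<le> ennreal ?m"
      by (intro ennreal_leI) (simp only: mult.assoc)
    also have "\<dots> = emeasure mu U"
      using False by (intro emeasure_eq_ennreal_measure[symmetric]) simp
    finally show ?thesis .
  qed
qed

end
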